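(* Let $\Omega$ be a domain and let $u:\Omega\to\mathbb{D}$ be a non-constant holomorphic function such that $u(\mathbf{w})=0$ for some $\mathbf{w}\in\Omega$. Consider the kernel $K=K_u\circ K_u$ on $\Omega$. Let $\varphi:\Omega\to\mathbb{D}$ be a non-constant holomorphic function in $\mathcal{M}_1(\mathcal{H}(K))$ with $\varphi(\mathbf{w})=0$. Then the de Branges-Rovnyak space $\mathcal{H}(K^\varphi)$ is a CNP space if and only if there exists $\lambda\in\mathbb{T}$ such that $\varphi(x)=\lambda u(x)$ for all $x\in\Omega$.
   Context: A domain is a non-empty connected open subset of $\mathbb{C}^d$ for some $d\ge1$. $\mathbb{D}$ is the open unit disc in $\mathbb{C}$ and $\mathbb{T}=\{z\in\mathbb{C}:|z|=1\}$. For $u:\Omega\to\mathbb{D}$, $K_u(x,y)=\frac{1}{1-u(x)\overline{u(y)}}$. The Schur product of kernels $K_1,K_2$ on $\Omega$ is the kernel $(K_1\circ K_2)(x,y)=K_1(x,y)K_2(x,y)$ on $\Omega$. For a kernel (positive semi-definite function) $K$ on $\Omega$, $\mathcal{H}(K)$ is the associated reproducing kernel Hilbert space. A multiplier of $\mathcal{H}(K)$ is a function $\varphi:\Omega\to\mathbb{C}$ with $\varphi f\in\mathcal{H}(K)$ for all $f\in\mathcal{H}(K)$; it is contractive if the multiplication operator $M_\varphi f=\varphi f$ satisfies $\|M_\varphi\|\le1$, equivalently if $(1-\varphi(x)\overline{\varphi(y)})K(x,y)$ is a kernel. $\mathcal{M}_1(\mathcal{H}(K))$ is the set of contractive multipliers.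 For $\varphi\in\mathcal{M}_1(\mathcal{H}(K))$, $K^\varphi(x,y)=(1-\varphi(x)\overline{\varphi(y)})K(x,y)$, and $\mathcal{H}(K^\varphi)$ is the de Branges-Rovnyak space associated to $\varphi$. A kernel $K$ on $\Omega$ is a complete Nevanlinna-Pick (CNP) kernel, and $\mathcal{H}(K)$ a CNP space, if for all $m,n\in\mathbb{N}$, every finite set of distinct points $x_1,\dots,x_k\in\Omega$ and all complex $m\times n$ matrices $W_1,\dots,W_k$ for which the block matrix $[(I-W_iW_j^* )K(x_i,x_j)]_{i,j=1}^k$ is positive semi-definite, there is a function $\Phi$ from $\Omega$ to the $m\times n$ matrices, multiplying $\mathcal{H}(K)\otimes\mathbb{C}^n$ into $\mathcal{H}(K)\otimes\mathbb{C}^m$, with $\Phi(x_i)=W_i$ for all $i$ and $\|M_\Phi\|\le1$. *)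

theory Defs
  imports "HOL-Analysis.Analysis" "Jordan_Normal_Form.Schur_Decomposition"
begin

definition complex_domain :: "(complex ^ 'd) set \<Rightarrow> bool" where
  "complex_domain \<Omega> \<longleftrightarrow> \<Omega> \<noteq> {} \<and> open \<Omega> \<and> connected \<Omega>"

text \<open>Holomorphy in several variables on an open set: at every point the Frechet derivative
  exists and is complex linear.\<close>

definition holomorphic_multi_on :: "(complex ^ 'd \<Rightarrow> complex) \<Rightarrow> (complex ^ 'd) set \<Rightarrow> bool" where
  "holomorphic_multi_on f \<Omega> \<longleftrightarrow>
     (\<forall>z\<in>\<Omega>. \<exists>D. (f has_derivative D) (at z) \<and> (\<forall>c v. D (c *s v) = c * D v))"

text \<open>The order on \<^typ>\<open>complex\<close> is the one of Complex_Order: \<open>0 \<le> z\<close> says that \<open>z\<close> is real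
  and nonnegative.\<close>

definition is_kernel :: "'a set \<Rightarrow> ('a \<Rightarrow> 'a \<Rightarrow> complex) \<Rightarrow> bool" where
  "is_kernel X K \<longleftrightarrow>
     (\<forall>S c. finite S \<and> S \<subseteq> X \<longrightarrow> 0 \<le> (\<Sum>x\<in>S. \<Sum>y\<in>S. cnj (c x) * c y * K x y))"

definition schur_product ::
  "('a \<Rightarrow> 'a \<Rightarrow> complex) \<Rightarrow> ('a \<Rightarrow> 'a \<Rightarrow> complex) \<Rightarrow> 'a \<Rightarrow> 'a \<Rightarrow> complex" where
  "schur_product K1 K2 = (\<lambda>x y. K1 x y * K2 x y)"

definition K_fun :: "('a \<Rightarrow> complex) \<Rightarrow> 'a \<Rightarrow> 'a \<Rightarrow> complex" where
  "K_fun u = (\<lambda>x y. 1 / (1 - u x * cnj (u y)))"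

definition dbr_kernel :: "('a \<Rightarrow> complex) \<Rightarrow> ('a \<Rightarrow> 'a \<Rightarrow> complex) \<Rightarrow> 'a \<Rightarrow> 'a \<Rightarrow> complex" where
  "dbr_kernel \<phi> K = (\<lambda>x y. (1 - \<phi> x * cnj (\<phi> y)) * K x y)"

text \<open>\<open>is_rkhs X K H ip\<close>: the set \<open>H\<close> with the inner product \<open>ip\<close> (linear in the first argument) is
  a complex Hilbert space of functions on \<open>X\<close> with reproducing kernel \<open>K\<close>.  A function on \<open>X\<close> is
  represented by the total function that extends it by \<open>0\<close>.\<close>

definition is_rkhs :: "'a set \<Rightarrow> ('a \<Rightarrow> 'a \<Rightarrow> complex) \<Rightarrow> ('a \<Rightarrow> complex) set
    \<Rightarrow> (('a \<Rightarrow> complex) \<Rightarrow> ('a \<Rightarrow> complex) \<Rightarrow> complex) \<Rightarrow> bool" where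
  "is_rkhs X K H ip \<longleftrightarrow>
     (\<forall>f\<in>H. \<forall>x. x \<notin> X \<longrightarrow> f x = 0) \<and>
     (\<lambda>x. 0) \<in> H \<and>
     (\<forall>f\<in>H. \<forall>g\<in>H. (\<lambda>x. f x + g x) \<in> H) \<and>
     (\<forall>f\<in>H. \<forall>c. (\<lambda>x. c * f x) \<in> H) \<and>
     (\<forall>f\<in>H. \<forall>g\<in>H. \<forall>h\<in>H. ip (\<lambda>x. f x + g x) h = ip f h + ip g h) \<and>
     (\<forall>f\<in>H. \<forall>g\<in>H. \<forall>c. ip (\<lambda>x. c * f x) g = c * ip f g) \<and>
     (\<forall>f\<in>H. \<forall>g\<in>H. ip g f = cnj (ip f g)) \<and>
     (\<forall>f\<in>H. 0 \<le> ip f f) \<and>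
     (\<forall>f\<in>H. ip f f = 0 \<longrightarrow> f = (\<lambda>x. 0)) \<and>
     (let d = (\<lambda>f g. sqrt (Re (ip (\<lambda>x. f x - g x) (\<lambda>x. f x - g x)))) in
        \<forall>F :: nat \<Rightarrow> 'a \<Rightarrow> complex.
          range F \<subseteq> H \<and> (\<forall>\<epsilon>>0. \<exists>N. \<forall>m\<ge>N. \<forall>n\<ge>N. d (F m) (F n) < \<epsilon>) \<longrightarrow>
          (\<exists>f\<in>H. (\<lambda>n. d (F n) f) \<longlonglongrightarrow> 0)) \<and>
     (\<forall>y\<in>X. (\<lambda>x. if x \<in> X then K x y else 0) \<in> H) \<and>
     (\<forall>f\<in>H. \<forall>y\<in>X. ip f (\<lambda>x. if x \<in> X then K x y else 0) = f y)"

text \<open>For a kernel \<open>K\<close> on \<open>X\<close> the space \<open>H\<close> and the restriction of \<open>ip\<close> to \<open>H\<close> exist and are unique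
  (Moore-Aronszajn).  The values of \<open>ip\<close> outside \<open>H\<close> are arbitrary and never used, hence the
  indefinite choice of the inner product.\<close>

definition rkhs :: "'a set \<Rightarrow> ('a \<Rightarrow> 'a \<Rightarrow> complex) \<Rightarrow> ('a \<Rightarrow> complex) set" where
  "rkhs X K = (THE H. \<exists>ip. is_rkhs X K H ip)"

definition rkhs_inner :: "'a set \<Rightarrow> ('a \<Rightarrow> 'a \<Rightarrow> complex)
    \<Rightarrow> ('a \<Rightarrow> complex) \<Rightarrow> ('a \<Rightarrow> complex) \<Rightarrow> complex" where
  "rkhs_inner X K = (SOME ip. is_rkhs X K (rkhs X K) ip)"

definition rkhs_norm :: "'a set \<Rightarrow> ('a \<Rightarrow> 'a \<Rightarrow> complex) \<Rightarrow> ('a \<Rightarrow> complex) \<Rightarrow> real" where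
  "rkhs_norm X K f = sqrt (Re (rkhs_inner X K f f))"

definition contractive_multipliers ::
  "'a set \<Rightarrow> ('a \<Rightarrow> 'a \<Rightarrow> complex) \<Rightarrow> ('a \<Rightarrow> complex) set" where
  "contractive_multipliers X K =
     {\<phi>. \<forall>f\<in>rkhs X K. (\<lambda>x. \<phi> x * f x) \<in> rkhs X K \<and>
           rkhs_norm X K (\<lambda>x. \<phi> x * f x) \<le> rkhs_norm X K f}"

text \<open>An element of \<open>\<H>(K) \<otimes> \<complex>\<^sup>n\<close> is an \<open>n\<close>-tuple \<open>F 0, \<dots>, F (n - 1)\<close> of elements of \<open>\<H>(K)\<close>, with
  squared norm the sum of the squared norms of its entries.\<close>

definition contractive_matrix_multiplier ::
  "'a set \<Rightarrow> ('a \<Rightarrow> 'a \<Rightarrow> complex) \<Rightarrow> nat \<Rightarrow> nat \<Rightarrow> ('a \<Rightarrow> complex mat) \<Rightarrow> bool" where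
  "contractive_matrix_multiplier X K m n \<Phi> \<longleftrightarrow>
     (\<forall>x\<in>X. \<Phi> x \<in> carrier_mat m n) \<and>
     (\<forall>F :: nat \<Rightarrow> 'a \<Rightarrow> complex. (\<forall>j<n. F j \<in> rkhs X K) \<longrightarrow>
        (\<forall>i<m. (\<lambda>x. \<Sum>j<n. \<Phi> x $$ (i, j) * F j x) \<in> rkhs X K) \<and>
        sqrt (\<Sum>i<m. (rkhs_norm X K (\<lambda>x. \<Sum>j<n. \<Phi> x $$ (i, j) * F j x))\<^sup>2)
          \<le> sqrt (\<Sum>j<n. (rkhs_norm X K (F j))\<^sup>2))"

text \<open>The block matrix is positive semi-definite iff it is a kernel on its finite index set
  \<open>S \<times> {..<m}\<close>, where the entry at \<open>((x, i), (y, j))\<close> is the \<open>(i, j)\<close> entry of the block at \<open>(x, y)\<close>.\<close>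

definition CNP_kernel :: "'a set \<Rightarrow> ('a \<Rightarrow> 'a \<Rightarrow> complex) \<Rightarrow> bool" where
  "CNP_kernel X K \<longleftrightarrow> is_kernel X K \<and>
     (\<forall>m\<ge>1. \<forall>n\<ge>1. \<forall>S W.
        finite S \<and> S \<subseteq> X \<and> (\<forall>x\<in>S. W x \<in> carrier_mat m n) \<and>
        is_kernel (S \<times> {..<m})
          (\<lambda>(x, i) (y, j). (1\<^sub>m m - W x * mat_adjoint (W y)) $$ (i, j) * K x y) \<longrightarrow>
        (\<exists>\<Phi>. contractive_matrix_multiplier X K m n \<Phi> \<and> (\<forall>x\<in>S. \<Phi> x = W x)))"

end

theory Submission
  imports Defs "HOL-Complex_Analysis.Complex_Analysis"
begin

text \<open>
  Since \<open>K\<^sup>\<phi>(\<cdot>, w) = 1\<close>, the CNP property makes \<open>1 - 1 / K\<^sup>\<phi>\<close> a kernel: Gram vectors of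
  \<open>1 - 1 / K\<^sup>\<phi>\<close> on a finite set are interpolation data whose Pick matrix consists of ones, and
  extending them to one more point gives the next Gram vector.  For the kernel at hand this says
  that \<open>1 - (1 - u u\<^sup>*)\<^sup>2 / (1 - \<phi> \<phi>\<^sup>*)\<close> is positive.  Put \<open>\<psi> = \<phi> / u\<close>.  By the open mapping theorem \<open>u\<close>
  attains \<open>\<plusminus>\<delta>\<close> for all small \<open>\<delta> > 0\<close>; positivity at two such points forces \<open>\<bar>\<psi>\<bar> \<rightarrow> 1\<close> along a
  subsequence as \<open>\<delta> \<rightarrow> 0\<close>, and the Cauchy-Schwarz inequality against these points then forces \<open>\<psi>\<close> to be constant.

  Conversely, \<open>K\<^sup>\<phi> = K\<^sub>u\<close> when \<open>\<phi> = \<lambda> u\<close>, and matrix interpolation for \<open>K\<^sub>u\<close> follows from the lurking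
  isometry argument.  Multipliers are handled through the Moore-Aronszajn space, realised as the
  space of bounded functionals on finite combinations of kernel functions.
\<close>

text \<open>At order zero nothing is decided: with \<open>P = \<psi>(x) cnj(\<psi>(y))\<close>, the
  kernel \<open>2 - P\<close> is positive for every constant \<psi> with
  \<open>|\<psi>|^2 <= 2\<close>, so \<open>|\<psi>| = 1\<close> has to come from the second-order
  term. Opposite values of \<open>u\<close> make the constant \<open>2\<close> cancel, and as
  \<open>u\<close> tends to \<open>0\<close> what remains is
  \<open>4 (1 - |\<psi>|^2)^2 <= 0\<close>. Since \<psi> is undefined on the zero set of
  \<open>u\<close>, which need not be discrete in several variables, limits come from boundedness
  and compactness and not from an extension of \<psi>. One limit value of modulus \<open>1\<close>
  is enough: the diagonal of the kernel tends to \<open>2 - 1 = 1\<close> there, small enough for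
  Cauchy-Schwarz to be sharp at every other point.

  In the necessity part each new point costs one more coordinate, so the interpolation property is
  used for rows of unbounded length. Multipliers are defined by their action on \<open>H(K)\<close>,
  so both directions need the translation between contractivity and positivity of a block kernel; it
  rests on the adjoint, which maps finite combinations of kernel functions to finite
  combinations.\<close>

lemma Re_nonneg_complex: "0 \<le> (z::complex) \<Longrightarrow> 0 \<le> Re z"
  by (simp add: less_eq_complex_def)

lemma Im_nonneg_complex: "0 \<le> (z::complex) \<Longrightarrow> Im z = 0"
  by (simp add: less_eq_complex_def)

text \<open>The discriminant criterion behind the Cauchy-Schwarz inequalities below. The number
  \<open>a\<close> may be a squared error instead of a squared norm, as in
  \<open>kernel_comb_dense\<close>.\<close>

lemma cmod_square_le_mult:
  fixes z :: complex and a b :: real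
  assumes quad: "\<And>t. 0 \<le> a + 2 * Re (cnj t * z) + (cmod t)\<^sup>2 * b" and "0 \<le> b"
  shows "(cmod z)\<^sup>2 \<le> a * b"
proof (cases "b = 0")
  case True
  have "z = 0"
  proof (rule ccontr)
    assume "z \<noteq> 0"
    \<comment> \<open>Large enough for the linear term, which becomes
      \<open>- 2 * (\<bar>a\<bar> + 1)\<close>, to outweigh \<open>a\<close>.\<close>
    define t where "t = - complex_of_real ((\<bar>a\<bar> + 1) / (cmod z)\<^sup>2) * z"
    have "cnj t * z = - complex_of_real ((\<bar>a\<bar> + 1) / (cmod z)\<^sup>2) * complex_of_real ((cmod z)\<^sup>2)"
      unfolding t_def complex_norm_square by (simp add: mult_ac)
    also have "\<dots> = - complex_of_real (\<bar>a\<bar> + 1)"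
      using \<open>z \<noteq> 0\<close> by simp
    finally have "Re (cnj t * z) = - (\<bar>a\<bar> + 1)"
      by simp
    with quad[of t] True show False by simp
  qed
  then show ?thesis using True by simp
next
  case False
  with \<open>0 \<le> b\<close> have "b > 0" by simp
  \<comment> \<open>The minimiser of the quadratic expression.\<close>
  define t where "t = - complex_of_real (1 / b) * z"
  have "cnj t * z = - complex_of_real (1 / b) * complex_of_real ((cmod z)\<^sup>2)"
    unfolding t_def complex_norm_square by (simp add: mult_ac)
  then have "Re (cnj t * z) = - (cmod z)\<^sup>2 / b"
    by (metis Re_complex_of_real divide_inverse inverse_eq_divide mult.commute mult_minus_right of_real_minus of_real_mult)
  moreover have "(cmod t)\<^sup>2 * b = (cmod z)\<^sup>2 / b"
    using \<open>b > 0\<close> by (simp add: t_def norm_mult norm_divide power_divide power_mult_distrib field_simps power2_eq_square)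
  ultimately have "0 \<le> a - (cmod z)\<^sup>2 / b"
    using quad[of t] by simp
  then show ?thesis
    using \<open>b > 0\<close> by (simp add: field_simps)
qed

subsection \<open>Reproducing kernel Hilbert spaces\<close>

definition fin_coeffs :: "'a set \<Rightarrow> ('a \<Rightarrow> complex) set" where
  "fin_coeffs X = {c. finite {x. c x \<noteq> 0} \<and> {x. c x \<noteq> 0} \<subseteq> X}"

text \<open>The value that the reproducing property dictates for the inner product of
  \<open>f\<close> with the combination of kernel functions with coefficients \<open>c\<close>. It
  makes sense for every function \<open>f\<close>, before any Hilbert space is available.\<close>

definition pairing :: "('a \<Rightarrow> complex) \<Rightarrow> ('a \<Rightarrow> complex) \<Rightarrow> complex" where
  "pairing f c = (\<Sum>x | c x \<noteq> 0. f x * cnj (c x))"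

definition kernel_comb :: "'a set \<Rightarrow> ('a \<Rightarrow> 'a \<Rightarrow> complex) \<Rightarrow> ('a \<Rightarrow> complex) \<Rightarrow> 'a \<Rightarrow> complex" where
  "kernel_comb X K c = (\<lambda>x. if x \<in> X then \<Sum>y | c y \<noteq> 0. c y * K x y else 0)"

text \<open>For a kernel, only a seminorm on coefficients: it vanishes at a nonzero \<open>c\<close>
  when kernel functions are linearly dependent.\<close>

definition comb_norm :: "'a set \<Rightarrow> ('a \<Rightarrow> 'a \<Rightarrow> complex) \<Rightarrow> ('a \<Rightarrow> complex) \<Rightarrow> real" where
  "comb_norm X K c = sqrt (Re (pairing (kernel_comb X K c) c))"

lemma fin_coeffsI: "finite S \<Longrightarrow> S \<subseteq> X \<Longrightarrow> (\<And>x. x \<notin> S \<Longrightarrow> c x = 0) \<Longrightarrow> c \<in> fin_coeffs X"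
  unfolding fin_coeffs_def by (auto intro: finite_subset)

lemma fin_coeffs_scale: "c \<in> fin_coeffs X \<Longrightarrow> (\<lambda>x. a * c x) \<in> fin_coeffs X"
  unfolding fin_coeffs_def by (auto intro: finite_subset[of _ "{x. c x \<noteq> 0}"])

lemma fin_coeffs_add: "c \<in> fin_coeffs X \<Longrightarrow> d \<in> fin_coeffs X \<Longrightarrow> (\<lambda>x. c x + d x) \<in> fin_coeffs X"
  by (rule fin_coeffsI[of "{x. c x \<noteq> 0} \<union> {x. d x \<noteq> 0}"]) (auto simp: fin_coeffs_def)

lemma fin_coeffs_diff: "c \<in> fin_coeffs X \<Longrightarrow> d \<in> fin_coeffs X \<Longrightarrow> (\<lambda>x. c x - d x) \<in> fin_coeffs X"
  by (rule fin_coeffsI[of "{x. c x \<noteq> 0} \<union> {x. d x \<noteq> 0}"]) (auto simp: fin_coeffs_def)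

lemma fin_coeffs_zero: "(\<lambda>x. 0) \<in> fin_coeffs X"
  by (simp add: fin_coeffs_def)

lemma fin_coeffs_common_support:
  assumes "c \<in> fin_coeffs X" "d \<in> fin_coeffs X"
  obtains S where "finite S" "S \<subseteq> X" "\<And>x. x \<notin> S \<Longrightarrow> c x = 0" "\<And>x. x \<notin> S \<Longrightarrow> d x = 0"
  using assms unfolding fin_coeffs_def
  by (intro that[of "{x. c x \<noteq> 0} \<union> {x. d x \<noteq> 0}"]) auto

lemma pairing_eq:
  assumes "finite S" "\<And>x. x \<notin> S \<Longrightarrow> c x = 0"
  shows "pairing f c = (\<Sum>x\<in>S. f x * cnj (c x))"
  unfolding pairing_def using assms by (intro sum.mono_neutral_left) auto

lemma kernel_comb_eq:
  assumes "finite S" "\<And>x. x \<notin> S \<Longrightarrow> c x = 0" "x \<in> X"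
  shows "kernel_comb X K c x = (\<Sum>y\<in>S. c y * K x y)"
  unfolding kernel_comb_def using assms by (auto intro!: sum.mono_neutral_left)

lemma kernel_comb_outside: "x \<notin> X \<Longrightarrow> kernel_comb X K c x = 0"
  by (simp add: kernel_comb_def)

lemma pairing_add_left: "pairing (\<lambda>x. f x + g x) c = pairing f c + pairing g c"
  by (simp add: pairing_def distrib_right sum.distrib)

lemma pairing_diff_left: "pairing (\<lambda>x. f x - g x) c = pairing f c - pairing g c"
  by (simp add: pairing_def left_diff_distrib sum_subtractf)

lemma pairing_scale_left: "pairing (\<lambda>x. a * f x) c = a * pairing f c"
  by (simp add: pairing_def sum_distrib_left mult.assoc)

lemma pairing_scale_right: "pairing f (\<lambda>x. a * c x) = cnj a * pairing f c"
  by (cases "a = 0") (simp_all add: pairing_def sum_distrib_left mult_ac)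

lemma pairing_add_right:
  assumes "c \<in> fin_coeffs X" "d \<in> fin_coeffs X"
  shows "pairing f (\<lambda>x. c x + d x) = pairing f c + pairing f d"
proof -
  obtain S where S: "finite S" "S \<subseteq> X" "\<And>x. x \<notin> S \<Longrightarrow> c x = 0" "\<And>x. x \<notin> S \<Longrightarrow> d x = 0"
    using fin_coeffs_common_support[OF assms] by blast
  then show ?thesis
    by (simp add: pairing_eq[of S] distrib_left sum.distrib)
qed

lemma pairing_diff_right:
  assumes "c \<in> fin_coeffs X" "d \<in> fin_coeffs X"
  shows "pairing f (\<lambda>x. c x - d x) = pairing f c - pairing f d"
  using pairing_add_right[OF assms(1) fin_coeffs_scale[OF assms(2), of "-1"], of f]
    pairing_scale_right[of f "-1" d] by simp

lemma pairing_single: "pairing f (\<lambda>x. if x = y then 1 else 0) = f y"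
  using pairing_eq[of "{y}" "\<lambda>x. if x = y then 1 else 0" f] by simp

lemma single_in_fin_coeffs: "y \<in> X \<Longrightarrow> (\<lambda>x. if x = y then 1 else 0) \<in> fin_coeffs X"
  by (rule fin_coeffsI[of "{y}"]) auto

lemma kernel_comb_single:
  "kernel_comb X K (\<lambda>x. if x = y then 1 else 0) = (\<lambda>x. if x \<in> X then K x y else 0)"
proof
  fix x show "kernel_comb X K (\<lambda>x. if x = y then 1 else 0) x = (if x \<in> X then K x y else 0)"
    using kernel_comb_eq[of "{y}" "\<lambda>x. if x = y then 1 else 0" x X K]
    by (auto simp: kernel_comb_outside)
qed

lemma kernel_comb_zero: "kernel_comb X K (\<lambda>x. 0) = (\<lambda>x. 0)"
  by (rule ext) (simp add: kernel_comb_def)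

lemma kernel_comb_scale: "kernel_comb X K (\<lambda>x. a * c x) = (\<lambda>x. a * kernel_comb X K c x)"
proof
  fix x show "kernel_comb X K (\<lambda>x. a * c x) x = a * kernel_comb X K c x"
    by (cases "a = 0") (simp_all add: kernel_comb_def sum_distrib_left mult_ac)
qed

lemma kernel_comb_add:
  assumes "c \<in> fin_coeffs X" "d \<in> fin_coeffs X"
  shows "kernel_comb X K (\<lambda>x. c x + d x) = (\<lambda>x. kernel_comb X K c x + kernel_comb X K d x)"
proof
  fix x
  obtain S where S: "finite S" "S \<subseteq> X" "\<And>x. x \<notin> S \<Longrightarrow> c x = 0" "\<And>x. x \<notin> S \<Longrightarrow> d x = 0"
    using fin_coeffs_common_support[OF assms] by blast
  then show "kernel_comb X K (\<lambda>x. c x + d x) x = kernel_comb X K c x + kernel_comb X K d x"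
    by (cases "x \<in> X") (simp_all add: kernel_comb_eq[of S] kernel_comb_outside distrib_right sum.distrib)
qed

lemma kernel_comb_diff:
  assumes "c \<in> fin_coeffs X" "d \<in> fin_coeffs X"
  shows "kernel_comb X K (\<lambda>x. c x - d x) = (\<lambda>x. kernel_comb X K c x - kernel_comb X K d x)"
  using kernel_comb_add[OF assms(1) fin_coeffs_scale[OF assms(2), of "-1"], of K]
    kernel_comb_scale[of X K "-1" d] by simp

section \<open>Elementary consequences of positivity\<close>

lemma is_kernel_diag_nonneg:
  assumes "is_kernel X K" "x \<in> X"
  shows "0 \<le> K x x"
  using assms(1)[unfolded is_kernel_def, rule_format, of "{x}" "\<lambda>_. 1"] assms(2) by simp

lemma is_kernel_two_points:
  assumes "is_kernel X K" "x \<in> X" "y \<in> X" "x \<noteq> y"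
  shows "0 \<le> cnj a * a * K x x + cnj a * b * K x y + (cnj b * a * K y x + cnj b * b * K y y)"
  using assms(1)[unfolded is_kernel_def, rule_format, of "{x, y}" "\<lambda>z. if z = x then a else b"]
    assms(2-) by (simp add: add_ac)

text \<open>Symmetry follows from the form being real: the coefficients \<open>1, 1\<close> settle
  the imaginary parts of the two entries and \<open>1, \<i>\<close> the real parts.\<close>

lemma is_kernel_hermitian:
  assumes "is_kernel X K" "x \<in> X" "y \<in> X"
  shows "K y x = cnj (K x y)"
proof (cases "x = y")
  case True
  then show ?thesis
    using Im_nonneg_complex[OF is_kernel_diag_nonneg[OF assms(1,2)]] by (simp add: complex_eq_iff)
next
  case False
  have d: "Im (K x x) = 0" "Im (K y y) = 0"
    using Im_nonneg_complex[OF is_kernel_diag_nonneg[OF assms(1)]] assms(2,3) by auto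
  have "Im (K x x + K x y + (K y x + K y y)) = 0"
    using Im_nonneg_complex[OF is_kernel_two_points[OF assms False, of 1 1]] by simp
  moreover have "Im (K x x + \<i> * K x y + (- \<i> * K y x + K y y)) = 0"
    using Im_nonneg_complex[OF is_kernel_two_points[OF assms False, of 1 \<i>]] by simp
  ultimately show ?thesis
    using d by (simp add: complex_eq_iff)
qed

lemma is_kernel_Cauchy_Schwarz:
  assumes "is_kernel X K" "x \<in> X" "y \<in> X"
  shows "(cmod (K x y))\<^sup>2 \<le> Re (K x x) * Re (K y y)"
proof (cases "x = y")
  case True
  then show ?thesis
    using Im_nonneg_complex[OF is_kernel_diag_nonneg[OF assms(1,2)]]
    by (simp add: cmod_eq_Re flip: power2_eq_square)
next
  case False
  show ?thesis
  proof (rule cmod_square_le_mult)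
    show "0 \<le> Re (K y y)"
      by (rule Re_nonneg_complex[OF is_kernel_diag_nonneg[OF assms(1,3)]])
    fix t
    have "0 \<le> Re (K x x + cnj t * K x y + (t * cnj (K x y) + t * cnj t * K y y))"
      using Re_nonneg_complex[OF is_kernel_two_points[OF assms False, of 1 "cnj t"]]
        is_kernel_hermitian[OF assms] by simp
    also have "\<dots> = Re (K x x) + 2 * Re (cnj t * K x y) + (cmod t)\<^sup>2 * Re (K y y)"
      using Im_nonneg_complex[OF is_kernel_diag_nonneg[OF assms(1,3)]]
      by (simp add: cmod_power2) (simp add: algebra_simps power2_eq_square)
    finally show "0 \<le> Re (K x x) + 2 * Re (cnj t * K x y) + (cmod t)\<^sup>2 * Re (K y y)" .
  qed
qed

lemma is_kernel_cong:
  assumes "\<And>x y. x \<in> X \<Longrightarrow> y \<in> X \<Longrightarrow> K x y = L x y"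
  shows "is_kernel X K = is_kernel X L"
proof -
  have "(\<Sum>x\<in>S. \<Sum>y\<in>S. cnj (c x) * c y * K x y) = (\<Sum>x\<in>S. \<Sum>y\<in>S. cnj (c x) * c y * L x y)"
    if "S \<subseteq> X" for S c
    using that assms by (intro sum.cong refl) (metis subsetD)
  then show ?thesis
    unfolding is_kernel_def by (metis (no_types, lifting))
qed

section \<open>The semi-inner product on finite combinations\<close>

lemma pairing_kernel_comb:
  assumes "finite S" "S \<subseteq> X" "\<And>x. x \<notin> S \<Longrightarrow> c x = 0" "\<And>x. x \<notin> S \<Longrightarrow> d x = 0"
  shows "pairing (kernel_comb X K c) d = (\<Sum>x\<in>S. \<Sum>y\<in>S. cnj (d x) * c y * K x y)"
proof -
  have "pairing (kernel_comb X K c) d = (\<Sum>x\<in>S. (\<Sum>y\<in>S. c y * K x y) * cnj (d x))"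
    using assms by (simp add: pairing_eq[of S]) (intro sum.cong refl, auto simp: kernel_comb_eq[of S])
  then show ?thesis
    by (simp add: sum_distrib_left sum_distrib_right mult_ac)
qed

lemma pairing_self_nonneg:
  assumes "is_kernel X K" "c \<in> fin_coeffs X"
  shows "0 \<le> pairing (kernel_comb X K c) c"
proof -
  have S: "finite {x. c x \<noteq> 0}" "{x. c x \<noteq> 0} \<subseteq> X"
    using assms(2) by (auto simp: fin_coeffs_def)
  then have "pairing (kernel_comb X K c) c
      = (\<Sum>x | c x \<noteq> 0. \<Sum>y | c y \<noteq> 0. cnj (c x) * c y * K x y)"
    by (intro pairing_kernel_comb) auto
  with S assms(1) show ?thesis
    by (simp add: is_kernel_def)
qed

lemma comb_norm_nonneg: "is_kernel X K \<Longrightarrow> c \<in> fin_coeffs X \<Longrightarrow> 0 \<le> comb_norm X K c"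
  using Re_nonneg_complex[OF pairing_self_nonneg] by (simp add: comb_norm_def)

lemma pairing_self:
  assumes "is_kernel X K" "c \<in> fin_coeffs X"
  shows "pairing (kernel_comb X K c) c = complex_of_real ((comb_norm X K c)\<^sup>2)"
  using pairing_self_nonneg[OF assms] Re_nonneg_complex[OF pairing_self_nonneg[OF assms]]
    Im_nonneg_complex[OF pairing_self_nonneg[OF assms]]
  by (simp add: comb_norm_def complex_eq_iff)

lemma pairing_hermitian:
  assumes "is_kernel X K" "c \<in> fin_coeffs X" "d \<in> fin_coeffs X"
  shows "pairing (kernel_comb X K d) c = cnj (pairing (kernel_comb X K c) d)"
proof -
  obtain S where S: "finite S" "S \<subseteq> X" "\<And>x. x \<notin> S \<Longrightarrow> c x = 0" "\<And>x. x \<notin> S \<Longrightarrow> d x = 0"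
    using fin_coeffs_common_support[OF assms(2,3)] by blast
  have "(\<Sum>x\<in>S. \<Sum>y\<in>S. cnj (c x) * d y * K x y) = (\<Sum>x\<in>S. \<Sum>y\<in>S. cnj (c y) * d x * K y x)"
    by (rule sum.swap)
  also have "\<dots> = (\<Sum>x\<in>S. \<Sum>y\<in>S. cnj (cnj (d x) * c y * K x y))"
  proof (intro sum.cong refl)
    fix x y assume "x \<in> S" "y \<in> S"
    then have "K y x = cnj (K x y)"
      using S(2) by (intro is_kernel_hermitian[OF assms(1)]) auto
    then show "cnj (c y) * d x * K y x = cnj (cnj (d x) * c y * K x y)"
      by (simp add: mult_ac)
  qed
  finally show ?thesis
    by (subst (1 2) pairing_kernel_comb[of S]) (use S in \<open>auto simp: cnj_sum\<close>)
qed

lemma comb_norm_scale_square: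
  assumes "is_kernel X K" "c \<in> fin_coeffs X"
  shows "(comb_norm X K (\<lambda>x. a * c x))\<^sup>2 = (cmod a)\<^sup>2 * (comb_norm X K c)\<^sup>2"
proof -
  have "complex_of_real ((comb_norm X K (\<lambda>x. a * c x))\<^sup>2) = a * cnj a * complex_of_real ((comb_norm X K c)\<^sup>2)"
    using pairing_self[OF assms(1) fin_coeffs_scale[OF assms(2), of a]] pairing_self[OF assms]
    by (simp add: kernel_comb_scale pairing_scale_left pairing_scale_right mult_ac)
  also have "\<dots> = complex_of_real ((cmod a)\<^sup>2 * (comb_norm X K c)\<^sup>2)"
    by (simp only: complex_norm_square[symmetric] of_real_mult)
  finally show ?thesis
    using of_real_eq_iff by blast
qed

lemma comb_norm_add_scale_square:
  assumes "is_kernel X K" "c \<in> fin_coeffs X" "d \<in> fin_coeffs X"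
  shows "(comb_norm X K (\<lambda>x. c x + t * d x))\<^sup>2
    = (comb_norm X K c)\<^sup>2 + 2 * Re (cnj t * pairing (kernel_comb X K c) d) + (cmod t)\<^sup>2 * (comb_norm X K d)\<^sup>2"
proof -
  let ?B = "\<lambda>c d. pairing (kernel_comb X K c) d"
  have td: "(\<lambda>x. t * d x) \<in> fin_coeffs X"
    by (rule fin_coeffs_scale[OF assms(3)])
  have "complex_of_real ((comb_norm X K (\<lambda>x. c x + t * d x))\<^sup>2) = ?B (\<lambda>x. c x + t * d x) (\<lambda>x. c x + t * d x)"
    using pairing_self[OF assms(1) fin_coeffs_add[OF assms(2) td]] by simp
  also have "\<dots> = ?B c c + ?B c (\<lambda>x. t * d x) + (?B (\<lambda>x. t * d x) c + ?B (\<lambda>x. t * d x) (\<lambda>x. t * d x))"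
    by (simp add: kernel_comb_add[OF assms(2) td] pairing_add_left pairing_add_right[OF assms(2) td])
  also have "?B (\<lambda>x. t * d x) c = cnj (?B c (\<lambda>x. t * d x))"
    by (rule pairing_hermitian[OF assms(1,2) td])
  also have "?B c (\<lambda>x. t * d x) = cnj t * ?B c d"
    by (rule pairing_scale_right)
  finally show ?thesis
    unfolding pairing_self[OF assms(1,2)] pairing_self[OF assms(1) td]
      comb_norm_scale_square[OF assms(1,3)]
    by (simp add: complex_eq_iff)
qed

lemma pairing_Cauchy_Schwarz:
  assumes "is_kernel X K" "c \<in> fin_coeffs X" "d \<in> fin_coeffs X"
  shows "cmod (pairing (kernel_comb X K c) d) \<le> comb_norm X K c * comb_norm X K d"
proof -
  have "(cmod (pairing (kernel_comb X K c) d))\<^sup>2 \<le> (comb_norm X K c)\<^sup>2 * (comb_norm X K d)\<^sup>2"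
  proof (rule cmod_square_le_mult)
    fix t
    show "0 \<le> (comb_norm X K c)\<^sup>2 + 2 * Re (cnj t * pairing (kernel_comb X K c) d) + (cmod t)\<^sup>2 * (comb_norm X K d)\<^sup>2"
      using comb_norm_add_scale_square[OF assms, of t] by (metis zero_le_power2)
  qed simp
  then show ?thesis
    using comb_norm_nonneg[OF assms(1)] assms(2,3)
    by (metis mult_nonneg_nonneg power2_le_imp_le power_mult_distrib)
qed

text \<open>By the Riesz theorem this is all of \<open>H(K)\<close>. It consists of functions from
  the start, whereas an abstract completion yields classes of Cauchy sequences that still have to be
  identified with functions.\<close>

definition bounded_functionals :: "'a set \<Rightarrow> ('a \<Rightarrow> 'a \<Rightarrow> complex) \<Rightarrow> ('a \<Rightarrow> complex) set" where
  "bounded_functionals X K = {f. (\<forall>x. x \<notin> X \<longrightarrow> f x = 0) \<and>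
     (\<exists>M\<ge>0. \<forall>c\<in>fin_coeffs X. cmod (pairing f c) \<le> M * comb_norm X K c)}"

text \<open>An infimum of admissible constants and not a supremum of quotients, since
  \<open>comb_norm\<close> may vanish; \<open>pairing_le_dual_norm\<close> shows that the infimum is
  itself admissible.\<close>

definition dual_norm :: "'a set \<Rightarrow> ('a \<Rightarrow> 'a \<Rightarrow> complex) \<Rightarrow> ('a \<Rightarrow> complex) \<Rightarrow> real" where
  "dual_norm X K f = Inf {M. 0 \<le> M \<and> (\<forall>c\<in>fin_coeffs X. cmod (pairing f c) \<le> M * comb_norm X K c)}"

lemma bounded_functionalsI:
  assumes "\<And>x. x \<notin> X \<Longrightarrow> f x = 0" "0 \<le> M"
    "\<And>c. c \<in> fin_coeffs X \<Longrightarrow> cmod (pairing f c) \<le> M * comb_norm X K c"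
  shows "f \<in> bounded_functionals X K"
  using assms unfolding bounded_functionals_def by blast

lemma bounded_functionals_outside: "f \<in> bounded_functionals X K \<Longrightarrow> x \<notin> X \<Longrightarrow> f x = 0"
  by (simp add: bounded_functionals_def)

lemma dual_norm_le:
  assumes "0 \<le> M" "\<And>c. c \<in> fin_coeffs X \<Longrightarrow> cmod (pairing f c) \<le> M * comb_norm X K c"
  shows "dual_norm X K f \<le> M"
  unfolding dual_norm_def using assms by (intro cInf_lower bdd_belowI[of _ 0]) auto

lemma dual_norm_nonneg:
  assumes "f \<in> bounded_functionals X K"
  shows "0 \<le> dual_norm X K f"
  unfolding dual_norm_def using assms unfolding bounded_functionals_def
  by (intro cInf_greatest) auto

lemma pairing_le_dual_norm:
  assumes k: "is_kernel X K" and f: "f \<in> bounded_functionals X K" and c: "c \<in> fin_coeffs X"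
  shows "cmod (pairing f c) \<le> dual_norm X K f * comb_norm X K c"
proof -
  let ?A = "{M. 0 \<le> M \<and> (\<forall>c\<in>fin_coeffs X. cmod (pairing f c) \<le> M * comb_norm X K c)}"
  have ne: "?A \<noteq> {}"
    using f unfolding bounded_functionals_def by auto
  show ?thesis
  proof (cases "comb_norm X K c = 0")
    case True
    with ne c show ?thesis by auto
  next
    case False
    with comb_norm_nonneg[OF k c] have pos: "comb_norm X K c > 0" by simp
    have "cmod (pairing f c) / comb_norm X K c \<le> Inf ?A"
      using ne c pos by (intro cInf_greatest) (auto simp: divide_le_eq)
    then show ?thesis
      using pos by (simp add: dual_norm_def divide_le_eq)
  qed
qed

lemma bounded_functionals_add:
  assumes k: "is_kernel X K" and f: "f \<in> bounded_functionals X K" and g: "g \<in> bounded_functionals X K"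
  shows "(\<lambda>x. f x + g x) \<in> bounded_functionals X K"
    and "dual_norm X K (\<lambda>x. f x + g x) \<le> dual_norm X K f + dual_norm X K g"
proof -
  have b: "cmod (pairing (\<lambda>x. f x + g x) c) \<le> (dual_norm X K f + dual_norm X K g) * comb_norm X K c"
    if "c \<in> fin_coeffs X" for c
    using pairing_le_dual_norm[OF k f that] pairing_le_dual_norm[OF k g that]
      norm_triangle_ineq[of "pairing f c" "pairing g c"]
    by (simp add: pairing_add_left distrib_right)
  have p: "0 \<le> dual_norm X K f + dual_norm X K g"
    by (rule add_nonneg_nonneg[OF dual_norm_nonneg[OF f] dual_norm_nonneg[OF g]])
  show "(\<lambda>x. f x + g x) \<in> bounded_functionals X K"
    using p b by (rule bounded_functionalsI[rotated]) (use f g in \<open>auto simp: bounded_functionals_outside\<close>)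
  show "dual_norm X K (\<lambda>x. f x + g x) \<le> dual_norm X K f + dual_norm X K g"
    using p b by (rule dual_norm_le)
qed

lemma bounded_functionals_scale:
  assumes k: "is_kernel X K" and f: "f \<in> bounded_functionals X K"
  shows "(\<lambda>x. a * f x) \<in> bounded_functionals X K"
    and "dual_norm X K (\<lambda>x. a * f x) \<le> cmod a * dual_norm X K f"
proof -
  have b: "cmod (pairing (\<lambda>x. a * f x) c) \<le> cmod a * dual_norm X K f * comb_norm X K c"
    if "c \<in> fin_coeffs X" for c
    using mult_left_mono[OF pairing_le_dual_norm[OF k f that], of "cmod a"]
    by (simp add: pairing_scale_left norm_mult mult.assoc)
  have p: "0 \<le> cmod a * dual_norm X K f"
    by (rule mult_nonneg_nonneg[OF norm_ge_zero dual_norm_nonneg[OF f]])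
  show "(\<lambda>x. a * f x) \<in> bounded_functionals X K"
    using p b by (rule bounded_functionalsI[rotated]) (use f in \<open>auto simp: bounded_functionals_outside\<close>)
  show "dual_norm X K (\<lambda>x. a * f x) \<le> cmod a * dual_norm X K f"
    using p b by (rule dual_norm_le)
qed

lemma bounded_functionals_diff:
  assumes k: "is_kernel X K" and f: "f \<in> bounded_functionals X K" and g: "g \<in> bounded_functionals X K"
  shows "(\<lambda>x. f x - g x) \<in> bounded_functionals X K"
    and "dual_norm X K (\<lambda>x. f x - g x) \<le> dual_norm X K f + dual_norm X K g"
  using bounded_functionals_add[OF k f bounded_functionals_scale(1)[OF k g, of "-1"]]
    bounded_functionals_scale(2)[OF k g, of "-1"] by simp_all

lemma kernel_comb_bounded:
  assumes k: "is_kernel X K" and c: "c \<in> fin_coeffs X"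
  shows "kernel_comb X K c \<in> bounded_functionals X K"
    and "dual_norm X K (kernel_comb X K c) = comb_norm X K c"
proof -
  show m: "kernel_comb X K c \<in> bounded_functionals X K"
    using comb_norm_nonneg[OF k c] pairing_Cauchy_Schwarz[OF k c]
    by (intro bounded_functionalsI) (auto simp: kernel_comb_outside)
  have "comb_norm X K c \<le> dual_norm X K (kernel_comb X K c)"
  proof (cases "comb_norm X K c = 0")
    case True
    then show ?thesis using dual_norm_nonneg[OF m] by simp
  next
    case False
    \<comment> \<open>The functional is tested on its own coefficients.\<close>
    have "(comb_norm X K c)\<^sup>2 \<le> dual_norm X K (kernel_comb X K c) * comb_norm X K c"
      using pairing_le_dual_norm[OF k m c] by (simp only: pairing_self[OF k c] norm_of_real abs_power2)
    then show ?thesis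
      using False comb_norm_nonneg[OF k c] by (simp add: power2_eq_square)
  qed
  then show "dual_norm X K (kernel_comb X K c) = comb_norm X K c"
    by (intro antisym dual_norm_le comb_norm_nonneg[OF k c] pairing_Cauchy_Schwarz[OF k c])
qed

lemma eval_le_dual_norm:
  assumes k: "is_kernel X K" and f: "f \<in> bounded_functionals X K" and "x \<in> X"
  shows "cmod (f x) \<le> dual_norm X K f * sqrt (Re (K x x))"
  using pairing_le_dual_norm[OF k f single_in_fin_coeffs[OF \<open>x \<in> X\<close>]] \<open>x \<in> X\<close>
  by (simp add: pairing_single comb_norm_def kernel_comb_single)

text \<open>A near-maximiser \<open>c\<close> of \<open>2 Re \<langle>f, k\<^sub>c\<rangle> - \<parallel>k\<^sub>c\<parallel>\<^sup>2\<close> is close to \<open>f\<close>, by the usual variational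
  argument for orthogonal projections.\<close>

lemma kernel_comb_dense:
  assumes k: "is_kernel X K" and f: "f \<in> bounded_functionals X K" and "e > 0"
  shows "\<exists>c\<in>fin_coeffs X. dual_norm X K (\<lambda>x. f x - kernel_comb X K c x) \<le> e"
proof -
  \<comment> \<open>In a Hilbert space this is \<open>\<parallel>f\<parallel>\<^sup>2 - \<parallel>f
    - k\<^sub>c\<parallel>\<^sup>2\<close>. Completing the square bounds it from above using only
    that \<open>f\<close> is a bounded functional.\<close>
  define J where "J = (\<lambda>c. 2 * Re (pairing f c) - (comb_norm X K c)\<^sup>2)"
  have bnd: "J c \<le> (dual_norm X K f)\<^sup>2" if "c \<in> fin_coeffs X" for c
  proof -
    have "Re (pairing f c) \<le> dual_norm X K f * comb_norm X K c"
      using pairing_le_dual_norm[OF k f that] complex_Re_le_cmod order_trans by blast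
    then have "J c \<le> 2 * (dual_norm X K f * comb_norm X K c) - (comb_norm X K c)\<^sup>2"
      by (simp add: J_def)
    also have "\<dots> = (dual_norm X K f)\<^sup>2 - (dual_norm X K f - comb_norm X K c)\<^sup>2"
      by (simp add: power2_diff)
    finally show ?thesis
      using zero_le_power2[of "dual_norm X K f - comb_norm X K c"] by linarith
  qed
  then have bdd: "bdd_above (J ` fin_coeffs X)"
    by (intro bdd_aboveI2)
  have ne: "J ` fin_coeffs X \<noteq> {}"
    using fin_coeffs_zero by blast
  have "Sup (J ` fin_coeffs X) - e\<^sup>2 < Sup (J ` fin_coeffs X)"
    using \<open>e > 0\<close> by simp
  then obtain c where c: "c \<in> fin_coeffs X" "Sup (J ` fin_coeffs X) - e\<^sup>2 < J c"
    using less_cSup_iff[OF ne bdd] by blast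
  have near: "J d \<le> J c + e\<^sup>2" if "d \<in> fin_coeffs X" for d
    using cSup_upper[OF imageI[OF that] bdd] c(2) by linarith
  have "cmod (pairing (\<lambda>x. f x - kernel_comb X K c x) d) \<le> e * comb_norm X K d"
    if d: "d \<in> fin_coeffs X" for d
  proof -
    let ?z = "pairing (\<lambda>x. f x - kernel_comb X K c x) d"
    have "(cmod ?z)\<^sup>2 \<le> e\<^sup>2 * (comb_norm X K d)\<^sup>2"
    proof (rule cmod_square_le_mult)
      fix t
      \<comment> \<open>Perturbing by \<open>- t\<close> turns near-maximality into the hypothesis
        of \<open>cmod_square_le_mult\<close> with the right signs; its constant term
        \<open>e\<^sup>2\<close> bounds how far \<open>c\<close> is from maximal.\<close>
      have td: "(\<lambda>x. (-t) * d x) \<in> fin_coeffs X"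
        by (rule fin_coeffs_scale[OF d])
      have "J (\<lambda>x. c x + (-t) * d x) = J c - 2 * Re (cnj t * ?z) - (cmod t)\<^sup>2 * (comb_norm X K d)\<^sup>2"
        unfolding J_def comb_norm_add_scale_square[OF k c(1) d] pairing_add_right[OF c(1) td]
          pairing_scale_right pairing_diff_left
        by (simp add: algebra_simps)
      then show "0 \<le> e\<^sup>2 + 2 * Re (cnj t * ?z) + (cmod t)\<^sup>2 * (comb_norm X K d)\<^sup>2"
        using near[OF fin_coeffs_add[OF c(1) td]] by simp
    qed simp
    then show ?thesis
      using comb_norm_nonneg[OF k d] \<open>e > 0\<close>
      by (metis less_imp_le mult_nonneg_nonneg power2_le_imp_le power_mult_distrib)
  qed
  then show ?thesis
    using dual_norm_le[of e X "\<lambda>x. f x - kernel_comb X K c x" K] c(1) \<open>e > 0\<close> by fastforce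
qed

section \<open>The inner product on bounded functionals\<close>

definition comb_approx :: "'a set \<Rightarrow> ('a \<Rightarrow> 'a \<Rightarrow> complex) \<Rightarrow> ('a \<Rightarrow> complex) \<Rightarrow> nat \<Rightarrow> 'a \<Rightarrow> complex" where
  "comb_approx X K f n =
    (SOME c. c \<in> fin_coeffs X \<and> dual_norm X K (\<lambda>x. f x - kernel_comb X K c x) \<le> 1 / real (Suc n))"

lemma comb_approx:
  assumes "is_kernel X K" "f \<in> bounded_functionals X K"
  shows "comb_approx X K f n \<in> fin_coeffs X"
    and "dual_norm X K (\<lambda>x. f x - kernel_comb X K (comb_approx X K f n) x) \<le> 1 / real (Suc n)"
proof -
  have "\<exists>c. c \<in> fin_coeffs X \<and> dual_norm X K (\<lambda>x. f x - kernel_comb X K c x) \<le> 1 / real (Suc n)"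
    using kernel_comb_dense[OF assms, of "1 / real (Suc n)"] by auto
  from someI_ex[OF this]
  show "comb_approx X K f n \<in> fin_coeffs X"
    and "dual_norm X K (\<lambda>x. f x - kernel_comb X K (comb_approx X K f n) x) \<le> 1 / real (Suc n)"
    by (simp_all add: comb_approx_def)
qed

lemma comb_approx_diff_bounded:
  assumes "is_kernel X K" "f \<in> bounded_functionals X K" "c \<in> fin_coeffs X"
  shows "(\<lambda>x. f x - kernel_comb X K c x) \<in> bounded_functionals X K"
  by (rule bounded_functionals_diff(1)[OF assms(1,2) kernel_comb_bounded(1)[OF assms(1,3)]])

lemma comb_approx_tendsto:
  assumes "is_kernel X K" "f \<in> bounded_functionals X K"
  shows "(\<lambda>n. dual_norm X K (\<lambda>x. f x - kernel_comb X K (comb_approx X K f n) x)) \<longlonglongrightarrow> 0"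
proof (rule tendsto_sandwich[where f = "\<lambda>_. 0" and h = "\<lambda>n. 1 / real (Suc n)"])
  show "(\<lambda>n. 1 / real (Suc n)) \<longlonglongrightarrow> 0"
    using LIMSEQ_inverse_real_of_nat by (simp add: inverse_eq_divide)
qed (use comb_approx[OF assms] dual_norm_nonneg[OF comb_approx_diff_bounded[OF assms]] in auto)

lemma comb_norm_diff_le:
  assumes k: "is_kernel X K" and f: "f \<in> bounded_functionals X K"
    and c: "c \<in> fin_coeffs X" and d: "d \<in> fin_coeffs X"
  shows "comb_norm X K (\<lambda>x. c x - d x)
    \<le> dual_norm X K (\<lambda>x. f x - kernel_comb X K c x) + dual_norm X K (\<lambda>x. f x - kernel_comb X K d x)"
proof -
  have "comb_norm X K (\<lambda>x. c x - d x) = dual_norm X K (\<lambda>x. kernel_comb X K c x - kernel_comb X K d x)"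
    using kernel_comb_bounded(2)[OF k fin_coeffs_diff[OF c d]] kernel_comb_diff[OF c d, of K] by simp
  also have "\<dots> = dual_norm X K (\<lambda>x. (f x - kernel_comb X K d x) - (f x - kernel_comb X K c x))"
    by simp
  also have "\<dots> \<le> dual_norm X K (\<lambda>x. f x - kernel_comb X K d x) + dual_norm X K (\<lambda>x. f x - kernel_comb X K c x)"
    by (rule bounded_functionals_diff(2)[OF k comb_approx_diff_bounded[OF k f d] comb_approx_diff_bounded[OF k f c]])
  finally show ?thesis by simp
qed

lemma comb_norm_bounds:
  assumes k: "is_kernel X K" and f: "f \<in> bounded_functionals X K" and c: "c \<in> fin_coeffs X"
  shows "\<bar>comb_norm X K c - dual_norm X K f\<bar> \<le> dual_norm X K (\<lambda>x. f x - kernel_comb X K c x)"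
proof -
  have "dual_norm X K (\<lambda>x. f x - (f x - kernel_comb X K c x))
      \<le> dual_norm X K f + dual_norm X K (\<lambda>x. f x - kernel_comb X K c x)"
    by (rule bounded_functionals_diff(2)[OF k f comb_approx_diff_bounded[OF k f c]])
  moreover have "dual_norm X K (\<lambda>x. (f x - kernel_comb X K c x) + kernel_comb X K c x)
      \<le> dual_norm X K (\<lambda>x. f x - kernel_comb X K c x) + dual_norm X K (kernel_comb X K c)"
    by (rule bounded_functionals_add(2)[OF k comb_approx_diff_bounded[OF k f c] kernel_comb_bounded(1)[OF k c]])
  ultimately show ?thesis
    by (simp add: kernel_comb_bounded(2)[OF k c] abs_le_iff)
qed

text \<open>The second argument has to be approximated because \<open>pairing\<close> takes only
  coefficients there. Linearity in \<open>f\<close> is then inherited directly, while Hermitian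
  symmetry has to be earned.\<close>

definition dual_inner :: "'a set \<Rightarrow> ('a \<Rightarrow> 'a \<Rightarrow> complex) \<Rightarrow> ('a \<Rightarrow> complex) \<Rightarrow> ('a \<Rightarrow> complex) \<Rightarrow> complex" where
  "dual_inner X K f g = lim (\<lambda>n. pairing f (comb_approx X K g n))"

lemma dual_inner_tendsto_approx:
  assumes k: "is_kernel X K" and f: "f \<in> bounded_functionals X K" and g: "g \<in> bounded_functionals X K"
  shows "(\<lambda>n. pairing f (comb_approx X K g n)) \<longlonglongrightarrow> dual_inner X K f g"
proof -
  let ?A = "comb_approx X K g"
  let ?r = "\<lambda>n. dual_norm X K (\<lambda>x. g x - kernel_comb X K (?A n) x)"
  have A: "?A n \<in> fin_coeffs X" for n
    by (rule comb_approx(1)[OF k g])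
  have diff: "cmod (pairing f (?A m) - pairing f (?A n)) \<le> dual_norm X K f * (?r m + ?r n)" for m n
  proof -
    have "cmod (pairing f (?A m) - pairing f (?A n)) \<le> dual_norm X K f * comb_norm X K (\<lambda>x. ?A m x - ?A n x)"
      using pairing_le_dual_norm[OF k f fin_coeffs_diff[OF A[of m] A[of n]]]
        pairing_diff_right[OF A[of m] A[of n], of f] by simp
    also have "\<dots> \<le> dual_norm X K f * (?r m + ?r n)"
      by (rule mult_left_mono[OF comb_norm_diff_le[OF k g A A] dual_norm_nonneg[OF f]])
    finally show ?thesis .
  qed
  have "Cauchy (\<lambda>n. pairing f (?A n))"
  proof (rule CauchyI)
    fix e :: real assume "e > 0"
    have "(\<lambda>n. dual_norm X K f * ?r n) \<longlonglongrightarrow> dual_norm X K f * 0"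
      by (intro tendsto_intros comb_approx_tendsto[OF k g])
    then have "eventually (\<lambda>n. dual_norm X K f * ?r n < e / 2) sequentially"
      using \<open>e > 0\<close> by (intro order_tendstoD) auto
    then obtain N where N: "\<And>n. n \<ge> N \<Longrightarrow> dual_norm X K f * ?r n < e / 2"
      by (auto simp: eventually_sequentially)
    have "cmod (pairing f (?A m) - pairing f (?A n)) < e" if "m \<ge> N" "n \<ge> N" for m n
      using order_le_less_trans[OF diff[of m n]] N[OF that(1)] N[OF that(2)]
      by (simp add: distrib_left)
    then show "\<exists>M. \<forall>m\<ge>M. \<forall>n\<ge>M. cmod (pairing f (?A m) - pairing f (?A n)) < e"
      by blast
  qed
  then show ?thesis
    unfolding dual_inner_def by (simp add: Cauchy_convergent convergent_LIMSEQ_iff[symmetric])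
qed

text \<open>Two sequences that approach \<open>g\<close> differ by combinations of small norm, so
  the limit does not depend on the approximants. The constant sequence then yields the reproducing
  property, in \<open>dual_inner_kernel_comb\<close>.\<close>

lemma dual_inner_tendsto:
  assumes k: "is_kernel X K" and f: "f \<in> bounded_functionals X K" and g: "g \<in> bounded_functionals X K"
    and G: "\<And>n. G n \<in> fin_coeffs X"
    and lim: "(\<lambda>n. dual_norm X K (\<lambda>x. g x - kernel_comb X K (G n) x)) \<longlonglongrightarrow> 0"
  shows "(\<lambda>n. pairing f (G n)) \<longlonglongrightarrow> dual_inner X K f g"
proof -
  let ?A = "comb_approx X K g"
  let ?r = "\<lambda>G n. dual_norm X K (\<lambda>x. g x - kernel_comb X K (G n) x)"
  have A: "?A n \<in> fin_coeffs X" for n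
    by (rule comb_approx(1)[OF k g])
  have "cmod (pairing f (G n) - pairing f (?A n)) \<le> dual_norm X K f * (?r G n + ?r ?A n)" for n
  proof -
    have "cmod (pairing f (G n) - pairing f (?A n)) \<le> dual_norm X K f * comb_norm X K (\<lambda>x. G n x - ?A n x)"
      using pairing_le_dual_norm[OF k f fin_coeffs_diff[OF G A]]
        pairing_diff_right[OF G A, of f] by simp
    also have "\<dots> \<le> dual_norm X K f * (?r G n + ?r ?A n)"
      by (rule mult_left_mono[OF comb_norm_diff_le[OF k g G A] dual_norm_nonneg[OF f]])
    finally show ?thesis .
  qed
  moreover have "(\<lambda>n. dual_norm X K f * (?r G n + ?r ?A n)) \<longlonglongrightarrow> 0"
    by (intro tendsto_mult_right_zero tendsto_add_zero lim comb_approx_tendsto[OF k g])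
  ultimately have "(\<lambda>n. pairing f (G n) - pairing f (?A n)) \<longlonglongrightarrow> 0"
    by (rule Lim_null_comparison[OF always_eventually[OF allI]])
  then show ?thesis
    by (rule Lim_transform[OF dual_inner_tendsto_approx[OF k f g]])
qed

lemma dual_inner_kernel_comb:
  assumes "is_kernel X K" "f \<in> bounded_functionals X K" "c \<in> fin_coeffs X"
  shows "dual_inner X K f (kernel_comb X K c) = pairing f c"
proof -
  have "dual_norm X K (\<lambda>x. kernel_comb X K c x - kernel_comb X K c x) = 0"
    using kernel_comb_bounded(2)[OF assms(1) fin_coeffs_zero]
    by (simp add: kernel_comb_zero comb_norm_def pairing_def)
  then have "(\<lambda>n. pairing f c) \<longlonglongrightarrow> dual_inner X K f (kernel_comb X K c)"
    using assms by (intro dual_inner_tendsto[where G = "\<lambda>_. c"] kernel_comb_bounded) auto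
  then show ?thesis
    by (simp add: LIMSEQ_const_iff)
qed

text \<open>Replacing both arguments by approximants makes the expression symmetric, so Hermitian
  symmetry and the value on the diagonal pass over from finite combinations.\<close>

lemma dual_inner_tendsto_both:
  assumes k: "is_kernel X K" and f: "f \<in> bounded_functionals X K" and g: "g \<in> bounded_functionals X K"
  shows "(\<lambda>n. pairing (kernel_comb X K (comb_approx X K f n)) (comb_approx X K g n)) \<longlonglongrightarrow> dual_inner X K f g"
proof -
  let ?F = "comb_approx X K f" and ?G = "comb_approx X K g"
  let ?r = "\<lambda>n. dual_norm X K (\<lambda>x. f x - kernel_comb X K (?F n) x)"
  have F: "?F n \<in> fin_coeffs X" and G: "?G n \<in> fin_coeffs X" for n
    by (rule comb_approx(1)[OF k f], rule comb_approx(1)[OF k g])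
  have "cmod (pairing f (?G n) - pairing (kernel_comb X K (?F n)) (?G n)) \<le> ?r n * (dual_norm X K g + 1)" for n
  proof -
    have "cmod (pairing f (?G n) - pairing (kernel_comb X K (?F n)) (?G n)) \<le> ?r n * comb_norm X K (?G n)"
      using pairing_le_dual_norm[OF k comb_approx_diff_bounded[OF k f F] G]
      by (simp add: pairing_diff_left)
    \<comment> \<open>Every approximant is within distance \<open>1\<close> of \<open>g\<close>,
      which bounds their norms uniformly.\<close>
    also have "\<dots> \<le> ?r n * (dual_norm X K g + 1)"
    proof (rule mult_left_mono[OF _ dual_norm_nonneg[OF comb_approx_diff_bounded[OF k f F]]])
      have "1 / real (Suc n) \<le> 1" by simp
      then show "comb_norm X K (?G n) \<le> dual_norm X K g + 1"
        using comb_norm_bounds[OF k g G, of n] comb_approx(2)[OF k g, of n] by linarith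
    qed
    finally show ?thesis .
  qed
  moreover have "(\<lambda>n. ?r n * (dual_norm X K g + 1)) \<longlonglongrightarrow> 0"
    by (intro tendsto_mult_left_zero comb_approx_tendsto[OF k f])
  ultimately have "(\<lambda>n. pairing f (?G n) - pairing (kernel_comb X K (?F n)) (?G n)) \<longlonglongrightarrow> 0"
    by (rule Lim_null_comparison[OF always_eventually[OF allI]])
  then show ?thesis
    by (rule Lim_transform2[OF dual_inner_tendsto_approx[OF k f g]])
qed

lemma dual_inner_hermitian:
  assumes "is_kernel X K" "f \<in> bounded_functionals X K" "g \<in> bounded_functionals X K"
  shows "dual_inner X K g f = cnj (dual_inner X K f g)"
proof -
  have "(\<lambda>n. cnj (pairing (kernel_comb X K (comb_approx X K f n)) (comb_approx X K g n)))
      \<longlonglongrightarrow> dual_inner X K g f"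
    using dual_inner_tendsto_both[OF assms(1,3,2)]
      pairing_hermitian[OF assms(1) comb_approx(1)[OF assms(1,2)] comb_approx(1)[OF assms(1,3)]]
    by simp
  from LIMSEQ_unique[OF this tendsto_cnj[OF dual_inner_tendsto_both[OF assms]]] show ?thesis .
qed

lemma comb_norm_approx_tendsto:
  assumes k: "is_kernel X K" and f: "f \<in> bounded_functionals X K"
  shows "(\<lambda>n. comb_norm X K (comb_approx X K f n)) \<longlonglongrightarrow> dual_norm X K f"
  by (rule LIM_zero_cancel, rule Lim_null_comparison[OF _ comb_approx_tendsto[OF k f]])
     (use comb_norm_bounds[OF k f comb_approx(1)[OF k f]] in auto)

lemma dual_inner_self:
  assumes "is_kernel X K" "f \<in> bounded_functionals X K"
  shows "dual_inner X K f f = complex_of_real ((dual_norm X K f)\<^sup>2)"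
proof -
  have "(\<lambda>n. complex_of_real ((comb_norm X K (comb_approx X K f n))\<^sup>2)) \<longlonglongrightarrow> dual_inner X K f f"
    using dual_inner_tendsto_both[OF assms(1,2,2)] pairing_self[OF assms(1) comb_approx(1)[OF assms]]
    by simp
  moreover have "(\<lambda>n. complex_of_real ((comb_norm X K (comb_approx X K f n))\<^sup>2))
      \<longlonglongrightarrow> complex_of_real ((dual_norm X K f)\<^sup>2)"
    by (intro tendsto_intros comb_norm_approx_tendsto[OF assms])
  ultimately show ?thesis by (rule LIMSEQ_unique)
qed

lemma dual_inner_add:
  assumes "is_kernel X K" "f \<in> bounded_functionals X K" "g \<in> bounded_functionals X K" "h \<in> bounded_functionals X K"
  shows "dual_inner X K (\<lambda>x. f x + g x) h = dual_inner X K f h + dual_inner X K g h"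
proof (rule LIMSEQ_unique)
  show "(\<lambda>n. pairing (\<lambda>x. f x + g x) (comb_approx X K h n)) \<longlonglongrightarrow> dual_inner X K (\<lambda>x. f x + g x) h"
    using assms by (intro dual_inner_tendsto_approx bounded_functionals_add(1))
  show "(\<lambda>n. pairing (\<lambda>x. f x + g x) (comb_approx X K h n)) \<longlonglongrightarrow> dual_inner X K f h + dual_inner X K g h"
    unfolding pairing_add_left using assms by (intro tendsto_add dual_inner_tendsto_approx)
qed

lemma dual_inner_scale:
  assumes "is_kernel X K" "f \<in> bounded_functionals X K" "h \<in> bounded_functionals X K"
  shows "dual_inner X K (\<lambda>x. a * f x) h = a * dual_inner X K f h"
proof (rule LIMSEQ_unique)
  show "(\<lambda>n. pairing (\<lambda>x. a * f x) (comb_approx X K h n)) \<longlonglongrightarrow> dual_inner X K (\<lambda>x. a * f x) h"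
    using assms by (intro dual_inner_tendsto_approx bounded_functionals_scale(1))
  show "(\<lambda>n. pairing (\<lambda>x. a * f x) (comb_approx X K h n)) \<longlonglongrightarrow> a * dual_inner X K f h"
    unfolding pairing_scale_left using assms by (intro tendsto_mult tendsto_const dual_inner_tendsto_approx)
qed

text \<open>Evaluations are bounded, so a Cauchy sequence converges pointwise. A pairing with fixed
  coefficients is a finite sum, so the Cauchy estimates survive the pointwise limit.\<close>

lemma bounded_functionals_complete:
  fixes F :: "nat \<Rightarrow> 'a \<Rightarrow> complex"
  assumes k: "is_kernel X K" and F: "\<And>n. F n \<in> bounded_functionals X K"
    and Cau: "\<And>e. e > 0 \<Longrightarrow> \<exists>N. \<forall>m\<ge>N. \<forall>n\<ge>N. dual_norm X K (\<lambda>x. F m x - F n x) < e"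
  shows "\<exists>f\<in>bounded_functionals X K. (\<lambda>n. dual_norm X K (\<lambda>x. F n x - f x)) \<longlonglongrightarrow> 0"
proof -
  have FF: "(\<lambda>x. F m x - F n x) \<in> bounded_functionals X K" for m n
    by (rule bounded_functionals_diff(1)[OF k F F])
  have "convergent (\<lambda>n. F n x)" for x
  proof (cases "x \<in> X")
    case True
    have "Cauchy (\<lambda>n. F n x)"
    proof (rule CauchyI)
      fix e :: real assume "e > 0"
      \<comment> \<open>The summand \<open>1\<close> keeps \<open>q\<close> positive when
        \<open>K x x = 0\<close>.\<close>
      define q where "q = sqrt (Re (K x x)) + 1"
      have "sqrt (Re (K x x)) \<ge> 0"
        using Re_nonneg_complex[OF is_kernel_diag_nonneg[OF k True]] by simp
      then have "q > 0" by (simp add: q_def add_nonneg_pos)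
      then obtain N where N: "\<And>m n. m \<ge> N \<Longrightarrow> n \<ge> N \<Longrightarrow> dual_norm X K (\<lambda>x. F m x - F n x) < e / q"
        using Cau[of "e / q"] \<open>e > 0\<close> by auto
      have "cmod (F m x - F n x) < e" if "m \<ge> N" "n \<ge> N" for m n
      proof -
        have "cmod (F m x - F n x) \<le> dual_norm X K (\<lambda>x. F m x - F n x) * q"
          using eval_le_dual_norm[OF k FF True, of m n] dual_norm_nonneg[OF FF, of m n]
          by (simp add: q_def distrib_left)
        also have "\<dots> < e / q * q"
          using N[OF that] \<open>q > 0\<close> by (intro mult_strict_right_mono)
        finally show ?thesis using \<open>q > 0\<close> by simp
      qed
      then show "\<exists>M. \<forall>m\<ge>M. \<forall>n\<ge>M. cmod (F m x - F n x) < e" by blast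
    qed
    then show ?thesis by (rule Cauchy_convergent)
  next
    case False
    then have "F n x = 0" for n
      by (rule bounded_functionals_outside[OF F])
    then show ?thesis by (simp add: convergent_const)
  qed
  then obtain f where f: "\<And>x. (\<lambda>n. F n x) \<longlonglongrightarrow> f x"
    unfolding convergent_def by metis
  have pt: "(\<lambda>n. pairing (F n) c) \<longlonglongrightarrow> pairing f c" for c
    unfolding pairing_def by (intro tendsto_intros f)
  have close: "\<exists>N. \<forall>m\<ge>N. \<forall>c\<in>fin_coeffs X. cmod (pairing (\<lambda>x. F m x - f x) c) \<le> e * comb_norm X K c"
    if "e > 0" for e
  proof -
    obtain N where N: "\<And>m n. m \<ge> N \<Longrightarrow> n \<ge> N \<Longrightarrow> dual_norm X K (\<lambda>x. F m x - F n x) < e"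
      using Cau[OF \<open>e > 0\<close>] by blast
    have "cmod (pairing (\<lambda>x. F m x - f x) c) \<le> e * comb_norm X K c" if "m \<ge> N" "c \<in> fin_coeffs X" for m c
    proof (rule tendsto_upperbound)
      show "(\<lambda>n. cmod (pairing (\<lambda>x. F m x - F n x) c)) \<longlonglongrightarrow> cmod (pairing (\<lambda>x. F m x - f x) c)"
        unfolding pairing_diff_left by (intro tendsto_intros pt)
      show "eventually (\<lambda>n. cmod (pairing (\<lambda>x. F m x - F n x) c) \<le> e * comb_norm X K c) sequentially"
        unfolding eventually_sequentially
      proof (intro exI[of _ N] allI impI)
        fix n assume "N \<le> n"
        show "cmod (pairing (\<lambda>x. F m x - F n x) c) \<le> e * comb_norm X K c"
          using pairing_le_dual_norm[OF k FF that(2), of m n]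
            mult_right_mono[OF less_imp_le[OF N[OF that(1) \<open>N \<le> n\<close>]] comb_norm_nonneg[OF k that(2)]]
          by linarith
      qed
    qed simp
    then show ?thesis by blast
  qed
  have fz: "f x = 0" if "x \<notin> X" for x
    using f[of x] bounded_functionals_outside[OF F that] by (simp add: LIMSEQ_const_iff)
  obtain N where N: "\<And>c. c \<in> fin_coeffs X \<Longrightarrow> cmod (pairing (\<lambda>x. F N x - f x) c) \<le> 1 * comb_norm X K c"
    using close[of 1] by auto
  \<comment> \<open>The limit is known only pointwise so far; it is a bounded functional because it
    differs from one by another.\<close>
  have "(\<lambda>x. F N x - f x) \<in> bounded_functionals X K"
    using N by (intro bounded_functionalsI[of _ _ 1])
      (use bounded_functionals_outside[OF F] fz in auto)
  from bounded_functionals_diff(1)[OF k F[of N] this] have fb: "f \<in> bounded_functionals X K"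
    by simp
  have "(\<lambda>n. dual_norm X K (\<lambda>x. F n x - f x)) \<longlonglongrightarrow> 0"
  proof (rule LIMSEQ_I)
    fix e :: real assume "e > 0"
    then obtain M where M: "\<And>m c. m \<ge> M \<Longrightarrow> c \<in> fin_coeffs X \<Longrightarrow> cmod (pairing (\<lambda>x. F m x - f x) c) \<le> e / 2 * comb_norm X K c"
      using close[of "e / 2"] by auto
    have "norm (dual_norm X K (\<lambda>x. F m x - f x) - 0) < e" if "m \<ge> M" for m
    proof -
      have "dual_norm X K (\<lambda>x. F m x - f x) \<le> e / 2"
        using \<open>e > 0\<close> M[OF that] by (intro dual_norm_le) auto
      then show ?thesis
        using \<open>e > 0\<close> dual_norm_nonneg[OF bounded_functionals_diff(1)[OF k F[of m] fb]] by simp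
    qed
    then show "\<exists>no. \<forall>n\<ge>no. norm (dual_norm X K (\<lambda>x. F n x - f x) - 0) < e" by blast
  qed
  with fb show ?thesis by blast
qed

section \<open>Existence in the Moore-Aronszajn theorem\<close>

lemma sqrt_Re_dual_inner_self:
  assumes "is_kernel X K" "f \<in> bounded_functionals X K"
  shows "sqrt (Re (dual_inner X K f f)) = dual_norm X K f"
  using dual_inner_self[OF assms] dual_norm_nonneg[OF assms(2)] by simp

lemma is_rkhs_bounded_functionals:
  assumes k: "is_kernel X K"
  shows "is_rkhs X K (bounded_functionals X K) (dual_inner X K)"
  unfolding is_rkhs_def Let_def
proof (intro conjI ballI allI impI)
  fix f g h and c :: complex
  assume f: "f \<in> bounded_functionals X K"
  show "f x = 0" if "x \<notin> X" for x
    using f that by (rule bounded_functionals_outside)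
  show "(\<lambda>x. c * f x) \<in> bounded_functionals X K"
    by (rule bounded_functionals_scale(1)[OF k f])
  show "0 \<le> dual_inner X K f f"
    by (simp add: dual_inner_self[OF k f] less_eq_complex_def)
  show "f = (\<lambda>x. 0)" if "dual_inner X K f f = 0"
  proof
    fix x
    have "dual_norm X K f = 0"
      using that dual_inner_self[OF k f] by simp
    then show "f x = 0"
      using eval_le_dual_norm[OF k f, of x] bounded_functionals_outside[OF f, of x] by fastforce
  qed
  show "dual_inner X K f (\<lambda>x. if x \<in> X then K x y else 0) = f y" if "y \<in> X" for y
    using dual_inner_kernel_comb[OF k f single_in_fin_coeffs[OF that]]
    by (simp add: pairing_single kernel_comb_single)
  assume g: "g \<in> bounded_functionals X K"
  show "(\<lambda>x. f x + g x) \<in> bounded_functionals X K"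
    by (rule bounded_functionals_add(1)[OF k f g])
  show "dual_inner X K (\<lambda>x. c * f x) g = c * dual_inner X K f g"
    by (rule dual_inner_scale[OF k f g])
  show "dual_inner X K g f = cnj (dual_inner X K f g)"
    by (rule dual_inner_hermitian[OF k f g])
  assume h: "h \<in> bounded_functionals X K"
  show "dual_inner X K (\<lambda>x. f x + g x) h = dual_inner X K f h + dual_inner X K g h"
    by (rule dual_inner_add[OF k f g h])
next
  show "(\<lambda>x. 0) \<in> bounded_functionals X K"
    using kernel_comb_bounded(1)[OF k fin_coeffs_zero] by (simp add: kernel_comb_zero)
  show "(\<lambda>x. if x \<in> X then K x y else 0) \<in> bounded_functionals X K" if "y \<in> X" for y
    using kernel_comb_bounded(1)[OF k single_in_fin_coeffs[OF that]] by (simp add: kernel_comb_single)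
next
  fix F :: "nat \<Rightarrow> 'a \<Rightarrow> complex"
  assume *: "range F \<subseteq> bounded_functionals X K \<and> (\<forall>\<epsilon>>0. \<exists>N. \<forall>m\<ge>N. \<forall>n\<ge>N.
      sqrt (Re (dual_inner X K (\<lambda>x. F m x - F n x) (\<lambda>x. F m x - F n x))) < \<epsilon>)"
  then have F: "F n \<in> bounded_functionals X K" for n by blast
  have eq: "sqrt (Re (dual_inner X K (\<lambda>x. F m x - f x) (\<lambda>x. F m x - f x))) = dual_norm X K (\<lambda>x. F m x - f x)"
    if "f \<in> bounded_functionals X K" for m f
    by (rule sqrt_Re_dual_inner_self[OF k bounded_functionals_diff(1)[OF k F that]])
  have "\<exists>f\<in>bounded_functionals X K. (\<lambda>n. dual_norm X K (\<lambda>x. F n x - f x)) \<longlonglongrightarrow> 0"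
    by (rule bounded_functionals_complete[OF k F]) (use * eq[OF F] in simp)
  then show "\<exists>f\<in>bounded_functionals X K.
      (\<lambda>n. sqrt (Re (dual_inner X K (\<lambda>x. F n x - f x) (\<lambda>x. F n x - f x)))) \<longlonglongrightarrow> 0"
    using eq by auto
qed

section \<open>Uniqueness in the Moore-Aronszajn theorem\<close>

context
  fixes X :: "'a set" and K :: "'a \<Rightarrow> 'a \<Rightarrow> complex"
    and H :: "('a \<Rightarrow> complex) set" and ip :: "('a \<Rightarrow> complex) \<Rightarrow> ('a \<Rightarrow> complex) \<Rightarrow> complex"
  assumes H: "is_rkhs X K H ip" and k: "is_kernel X K"
begin

lemma is_rkhs_rules:
  shows "f \<in> H \<Longrightarrow> x \<notin> X \<Longrightarrow> f x = 0"
    and "(\<lambda>x. 0) \<in> H"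
    and "f \<in> H \<Longrightarrow> g \<in> H \<Longrightarrow> (\<lambda>x. f x + g x) \<in> H"
    and "f \<in> H \<Longrightarrow> (\<lambda>x. c * f x) \<in> H"
    and "f \<in> H \<Longrightarrow> g \<in> H \<Longrightarrow> h \<in> H \<Longrightarrow> ip (\<lambda>x. f x + g x) h = ip f h + ip g h"
    and "f \<in> H \<Longrightarrow> g \<in> H \<Longrightarrow> ip (\<lambda>x. c * f x) g = c * ip f g"
    and "f \<in> H \<Longrightarrow> g \<in> H \<Longrightarrow> ip g f = cnj (ip f g)"
    and "f \<in> H \<Longrightarrow> 0 \<le> ip f f"
    and "y \<in> X \<Longrightarrow> (\<lambda>x. if x \<in> X then K x y else 0) \<in> H"
    and "f \<in> H \<Longrightarrow> y \<in> X \<Longrightarrow> ip f (\<lambda>x. if x \<in> X then K x y else 0) = f y"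
proof -
  note c1 = H[unfolded is_rkhs_def Let_def]
  note c2 = c1[THEN conjunct2]
  note c3 = c2[THEN conjunct2]
  note c4 = c3[THEN conjunct2]
  note c5 = c4[THEN conjunct2]
  note c6 = c5[THEN conjunct2]
  note c7 = c6[THEN conjunct2]
  note c8 = c7[THEN conjunct2]
  note c11 = c8[THEN conjunct2, THEN conjunct2, THEN conjunct2]
  show "f \<in> H \<Longrightarrow> x \<notin> X \<Longrightarrow> f x = 0" using c1[THEN conjunct1] by blast
  show "(\<lambda>x. 0) \<in> H" using c2[THEN conjunct1] .
  show "f \<in> H \<Longrightarrow> g \<in> H \<Longrightarrow> (\<lambda>x. f x + g x) \<in> H" using c3[THEN conjunct1] by blast
  show "f \<in> H \<Longrightarrow> (\<lambda>x. c * f x) \<in> H" using c4[THEN conjunct1] by blast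
  show "f \<in> H \<Longrightarrow> g \<in> H \<Longrightarrow> h \<in> H \<Longrightarrow> ip (\<lambda>x. f x + g x) h = ip f h + ip g h"
    using c5[THEN conjunct1] by blast
  show "f \<in> H \<Longrightarrow> g \<in> H \<Longrightarrow> ip (\<lambda>x. c * f x) g = c * ip f g"
    using c6[THEN conjunct1] by blast
  show "f \<in> H \<Longrightarrow> g \<in> H \<Longrightarrow> ip g f = cnj (ip f g)" using c7[THEN conjunct1] by blast
  show "f \<in> H \<Longrightarrow> 0 \<le> ip f f" using c8[THEN conjunct1] by blast
  show "y \<in> X \<Longrightarrow> (\<lambda>x. if x \<in> X then K x y else 0) \<in> H" using c11[THEN conjunct1] by blast
  show "f \<in> H \<Longrightarrow> y \<in> X \<Longrightarrow> ip f (\<lambda>x. if x \<in> X then K x y else 0) = f y"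
    using c11[THEN conjunct2] by blast
qed

lemma is_rkhs_complete:
  fixes F :: "nat \<Rightarrow> 'a \<Rightarrow> complex"
  assumes "\<And>n. F n \<in> H"
    and "\<And>e. e > 0 \<Longrightarrow> \<exists>N. \<forall>m\<ge>N. \<forall>n\<ge>N. sqrt (Re (ip (\<lambda>x. F m x - F n x) (\<lambda>x. F m x - F n x))) < e"
  shows "\<exists>f\<in>H. (\<lambda>n. sqrt (Re (ip (\<lambda>x. F n x - f x) (\<lambda>x. F n x - f x)))) \<longlonglongrightarrow> 0"
proof -
  have "range F \<subseteq> H" using assms(1) by blast
  then show ?thesis
    using H[unfolded is_rkhs_def Let_def, THEN conjunct2, THEN conjunct2, THEN conjunct2,
      THEN conjunct2, THEN conjunct2, THEN conjunct2, THEN conjunct2, THEN conjunct2,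
      THEN conjunct2, THEN conjunct1] assms(2) by blast
qed

lemma is_rkhs_diff:
  assumes "f \<in> H" "g \<in> H"
  shows "(\<lambda>x. f x - g x) \<in> H"
  using is_rkhs_rules(3)[OF assms(1) is_rkhs_rules(4)[OF assms(2), of "-1"]] by simp

lemma is_rkhs_self:
  assumes "f \<in> H"
  shows "ip f f = complex_of_real (Re (ip f f))" "0 \<le> Re (ip f f)"
  using is_rkhs_rules(8)[OF assms] by (auto simp: less_eq_complex_def complex_eq_iff)

lemma is_rkhs_inner_add_scale_square:
  assumes f: "f \<in> H" and g: "g \<in> H"
  shows "0 \<le> Re (ip f f) + 2 * Re (cnj t * ip f g) + (cmod t)\<^sup>2 * Re (ip g g)"
proof -
  have tg: "(\<lambda>x. t * g x) \<in> H" by (rule is_rkhs_rules(4)[OF g])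
  have s: "(\<lambda>x. f x + t * g x) \<in> H" by (rule is_rkhs_rules(3)[OF f tg])
  have "ip (\<lambda>x. f x + t * g x) h = ip f h + t * ip g h" if "h \<in> H" for h
    using is_rkhs_rules(5)[OF f tg that] is_rkhs_rules(6)[OF g that] by simp
  note lin = this
  have "ip f (\<lambda>x. f x + t * g x) = ip f f + cnj t * ip f g"
    using lin[OF f] is_rkhs_rules(7)[OF s f] is_rkhs_rules(7)[OF f g] is_rkhs_rules(7)[OF f f]
    by simp
  moreover have "ip g (\<lambda>x. f x + t * g x) = ip g f + cnj t * ip g g"
    using lin[OF g] is_rkhs_rules(7)[OF s g] is_rkhs_rules(7)[OF g f] is_rkhs_rules(7)[OF g g]
    by simp
  ultimately have "ip (\<lambda>x. f x + t * g x) (\<lambda>x. f x + t * g x)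
      = ip f f + cnj t * ip f g + t * cnj (ip f g) + t * cnj t * ip g g"
    using lin[OF s] is_rkhs_rules(7)[OF f g] by (simp add: algebra_simps)
  moreover have "t * cnj t * ip g g = complex_of_real ((cmod t)\<^sup>2 * Re (ip g g))"
    using is_rkhs_self(1)[OF g] by (metis complex_norm_square of_real_mult)
  ultimately show ?thesis
    using is_rkhs_self(2)[OF s] by simp
qed

lemma is_rkhs_Cauchy_Schwarz:
  assumes "f \<in> H" "g \<in> H"
  shows "cmod (ip f g) \<le> sqrt (Re (ip f f)) * sqrt (Re (ip g g))"
proof -
  have "(cmod (ip f g))\<^sup>2 \<le> Re (ip f f) * Re (ip g g)"
    using is_rkhs_inner_add_scale_square[OF assms] is_rkhs_self(2)[OF assms(2)]
    by (rule cmod_square_le_mult)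
  then show ?thesis
    by (metis norm_ge_zero real_le_rsqrt real_sqrt_mult)
qed

lemma is_rkhs_sum:
  assumes "finite S" "\<And>y. y \<in> S \<Longrightarrow> y \<in> X"
  shows "(\<lambda>x. if x \<in> X then \<Sum>y\<in>S. c y * K x y else 0) \<in> H \<and>
    (\<forall>f\<in>H. ip f (\<lambda>x. if x \<in> X then \<Sum>y\<in>S. c y * K x y else 0) = (\<Sum>y\<in>S. f y * cnj (c y)))"
  using assms
proof (induction S)
  case empty
  have "ip f (\<lambda>x. 0) = 0" if "f \<in> H" for f
    using is_rkhs_rules(6)[OF is_rkhs_rules(2) that, of 0] is_rkhs_rules(7)[OF is_rkhs_rules(2) that]
    by simp
  moreover have "(\<lambda>x. if x \<in> X then \<Sum>y\<in>{}. c y * K x y else 0) = (\<lambda>x. 0)"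
    by auto
  ultimately show ?case using is_rkhs_rules(2) by (simp only: sum.empty) simp
next
  case (insert z S)
  let ?s = "\<lambda>x. if x \<in> X then \<Sum>y\<in>S. c y * K x y else 0"
  let ?k = "\<lambda>x. if x \<in> X then K x z else 0"
  have k: "?k \<in> H" and s: "?s \<in> H"
    using insert is_rkhs_rules(9) by auto
  have ck: "(\<lambda>x. c z * ?k x) \<in> H" by (rule is_rkhs_rules(4)[OF k])
  have eq: "(\<lambda>x. if x \<in> X then \<Sum>y\<in>insert z S. c y * K x y else 0) = (\<lambda>x. c z * ?k x + ?s x)"
    using insert by auto
  have "ip f (\<lambda>x. c z * ?k x + ?s x) = (\<Sum>y\<in>insert z S. f y * cnj (c y))" if f: "f \<in> H" for f
  proof -
    have "ip (\<lambda>x. c z * ?k x + ?s x) f = c z * ip ?k f + ip ?s f"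
      using is_rkhs_rules(5)[OF ck s f] is_rkhs_rules(6)[OF k f] by simp
    moreover have "ip f (\<lambda>x. c z * ?k x + ?s x) = cnj (ip (\<lambda>x. c z * ?k x + ?s x) f)"
      by (rule is_rkhs_rules(7)[OF is_rkhs_rules(3)[OF ck s] f])
    moreover have "ip ?k f = cnj (ip f ?k)" "ip ?s f = cnj (ip f ?s)"
      using is_rkhs_rules(7)[OF f k] is_rkhs_rules(7)[OF f s] by auto
    moreover have "ip f ?k = f z"
      using insert.prems by (intro is_rkhs_rules(10)[OF f]) auto
    moreover have "ip f ?s = (\<Sum>y\<in>S. f y * cnj (c y))"
      using insert f by auto
    ultimately show ?thesis
      using insert.hyps by (simp add: mult.commute)
  qed
  with is_rkhs_rules(3)[OF ck s] show ?case
    unfolding eq by blast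
qed

lemma is_rkhs_kernel_comb:
  assumes "c \<in> fin_coeffs X"
  shows "kernel_comb X K c \<in> H"
    and "f \<in> H \<Longrightarrow> ip f (kernel_comb X K c) = pairing f c"
proof -
  have "finite {x. c x \<noteq> 0}" "\<And>y. y \<in> {x. c x \<noteq> 0} \<Longrightarrow> y \<in> X"
    using assms by (auto simp: fin_coeffs_def)
  from is_rkhs_sum[OF this, of c]
  show "kernel_comb X K c \<in> H" "f \<in> H \<Longrightarrow> ip f (kernel_comb X K c) = pairing f c"
    by (auto simp: kernel_comb_def pairing_def)
qed

lemma is_rkhs_comb_norm:
  assumes "c \<in> fin_coeffs X"
  shows "sqrt (Re (ip (kernel_comb X K c) (kernel_comb X K c))) = comb_norm X K c"
  using is_rkhs_kernel_comb[OF assms] by (simp add: comb_norm_def)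

lemma is_rkhs_bounded:
  assumes f: "f \<in> H"
  shows "f \<in> bounded_functionals X K" and "dual_norm X K f \<le> sqrt (Re (ip f f))"
proof -
  have b: "cmod (pairing f c) \<le> sqrt (Re (ip f f)) * comb_norm X K c" if "c \<in> fin_coeffs X" for c
    using is_rkhs_Cauchy_Schwarz[OF f is_rkhs_kernel_comb(1)[OF that]]
    by (simp only: is_rkhs_kernel_comb(2)[OF that f] is_rkhs_comb_norm[OF that])
  have p: "0 \<le> sqrt (Re (ip f f))"
    using is_rkhs_self(2)[OF f] by simp
  show "f \<in> bounded_functionals X K"
    using p b by (rule bounded_functionalsI[rotated]) (use is_rkhs_rules(1)[OF f] in auto)
  show "dual_norm X K f \<le> sqrt (Re (ip f f))"
    using p b by (rule dual_norm_le)
qed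

text \<open>On finite combinations the norm of any such \<open>H\<close> is
  \<open>comb_norm\<close>, so the approximants of \<open>f\<close> are Cauchy in \<open>H\<close>.
  Evaluations are continuous for both norms, so the limit in \<open>H\<close> agrees with
  \<open>f\<close> at every point.\<close>

lemma is_rkhs_approx_tendsto:
  assumes f: "f \<in> bounded_functionals X K"
  shows "f \<in> H \<and> (\<lambda>n. sqrt (Re (ip (\<lambda>x. kernel_comb X K (comb_approx X K f n) x - f x)
    (\<lambda>x. kernel_comb X K (comb_approx X K f n) x - f x)))) \<longlonglongrightarrow> 0"
proof -
  let ?A = "comb_approx X K f"
  let ?F = "\<lambda>n. kernel_comb X K (?A n)"
  let ?r = "\<lambda>n. dual_norm X K (\<lambda>x. f x - ?F n x)"
  have A: "?A n \<in> fin_coeffs X" for n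
    by (rule comb_approx(1)[OF k f])
  have FH: "?F n \<in> H" for n
    by (rule is_rkhs_kernel_comb(1)[OF A])
  have d: "sqrt (Re (ip (\<lambda>x. ?F m x - ?F n x) (\<lambda>x. ?F m x - ?F n x))) \<le> ?r m + ?r n" for m n
    using is_rkhs_comb_norm[OF fin_coeffs_diff[OF A[of m] A[of n]]]
      comb_norm_diff_le[OF k f A[of m] A[of n]]
    by (simp only: kernel_comb_diff[OF A[of m] A[of n]])
  have "\<exists>g\<in>H. (\<lambda>n. sqrt (Re (ip (\<lambda>x. ?F n x - g x) (\<lambda>x. ?F n x - g x)))) \<longlonglongrightarrow> 0"
  proof (rule is_rkhs_complete[OF FH])
    fix e :: real assume "e > 0"
    then have "eventually (\<lambda>n. ?r n < e / 2) sequentially"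
      using comb_approx_tendsto[OF k f] by (intro order_tendstoD) auto
    then obtain N where N: "\<And>n. n \<ge> N \<Longrightarrow> ?r n < e / 2"
      by (auto simp: eventually_sequentially)
    have "sqrt (Re (ip (\<lambda>x. ?F m x - ?F n x) (\<lambda>x. ?F m x - ?F n x))) < e" if "m \<ge> N" "n \<ge> N" for m n
      using d[of m n] N[OF that(1)] N[OF that(2)] by linarith
    then show "\<exists>N. \<forall>m\<ge>N. \<forall>n\<ge>N. sqrt (Re (ip (\<lambda>x. ?F m x - ?F n x) (\<lambda>x. ?F m x - ?F n x))) < e"
      by blast
  qed
  then obtain g where g: "g \<in> H"
    and gl: "(\<lambda>n. sqrt (Re (ip (\<lambda>x. ?F n x - g x) (\<lambda>x. ?F n x - g x)))) \<longlonglongrightarrow> 0"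
    by blast
  have "f x = g x" for x
  proof (cases "x \<in> X")
    case True
    let ?q = "sqrt (Re (K x x))"
    have q: "?q \<ge> 0"
      using Re_nonneg_complex[OF is_kernel_diag_nonneg[OF k True]] by simp
    have "cmod (?F n x - g x) \<le> sqrt (Re (ip (\<lambda>x. ?F n x - g x) (\<lambda>x. ?F n x - g x))) * ?q" for n
      using eval_le_dual_norm[OF k is_rkhs_bounded(1)[OF is_rkhs_diff[OF FH g]] True]
        mult_right_mono[OF is_rkhs_bounded(2)[OF is_rkhs_diff[OF FH g]] q] order_trans by blast
    moreover have "(\<lambda>n. sqrt (Re (ip (\<lambda>x. ?F n x - g x) (\<lambda>x. ?F n x - g x))) * ?q) \<longlonglongrightarrow> 0"
      by (intro tendsto_mult_left_zero gl)
    ultimately have "(\<lambda>n. ?F n x - g x) \<longlonglongrightarrow> 0"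
      by (rule Lim_null_comparison[OF always_eventually[OF allI]])
    then have 1: "(\<lambda>n. ?F n x) \<longlonglongrightarrow> g x"
      by (rule LIM_zero_cancel)
    have "cmod (?F n x - f x) \<le> ?r n * ?q" for n
      using eval_le_dual_norm[OF k comb_approx_diff_bounded[OF k f A] True] by (simp add: norm_minus_commute)
    moreover have "(\<lambda>n. ?r n * ?q) \<longlonglongrightarrow> 0"
      by (intro tendsto_mult_left_zero comb_approx_tendsto[OF k f])
    ultimately have "(\<lambda>n. ?F n x - f x) \<longlonglongrightarrow> 0"
      by (rule Lim_null_comparison[OF always_eventually[OF allI]])
    then have "(\<lambda>n. ?F n x) \<longlonglongrightarrow> f x"
      by (rule LIM_zero_cancel)
    from LIMSEQ_unique[OF this 1] show ?thesis .
  next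
    case False
    then show ?thesis
      using bounded_functionals_outside[OF f] is_rkhs_rules(1)[OF g] by simp
  qed
  then have "f = g" by blast
  with g gl show ?thesis by simp
qed

lemma is_rkhs_carrier_unique: "H = bounded_functionals X K"
  using is_rkhs_bounded(1) is_rkhs_approx_tendsto by blast

text \<open>The inner product \<open>rkhs_inner\<close> is an arbitrary choice, so its norm has to
  be computed for every admissible \<open>ip\<close>. For the remaining inequality
  \<open>ip f f\<close> is split into a pairing with an approximant, controlled by
  \<open>dual_norm\<close>, and an error that tends to \<open>0\<close>.\<close>

lemma is_rkhs_norm_unique:
  assumes f: "f \<in> H"
  shows "sqrt (Re (ip f f)) = dual_norm X K f"
proof (rule antisym[OF _ is_rkhs_bounded(2)[OF f]])
  let ?A = "comb_approx X K f"
  let ?F = "\<lambda>n. kernel_comb X K (?A n)"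
  let ?e = "\<lambda>n. sqrt (Re (ip (\<lambda>x. ?F n x - f x) (\<lambda>x. ?F n x - f x)))"
  let ?n = "sqrt (Re (ip f f))" and ?N = "dual_norm X K f"
  note fb = is_rkhs_bounded(1)[OF f]
  have A: "?A n \<in> fin_coeffs X" for n
    by (rule comb_approx(1)[OF k fb])
  have FH: "?F n \<in> H" for n
    by (rule is_rkhs_kernel_comb(1)[OF A])
  have D: "(\<lambda>x. ?F n x - f x) \<in> H" for n
    by (rule is_rkhs_diff[OF FH f])
  have "?n\<^sup>2 \<le> ?N * comb_norm X K (?A n) + ?n * ?e n" for n
  proof -
    have e: "(\<lambda>x. ?F n x + (-1) * (?F n x - f x)) = f"
      by (rule ext) simp
    have "ip f f = ip (?F n) f + (-1) * ip (\<lambda>x. ?F n x - f x) f"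
      using is_rkhs_rules(5)[OF FH is_rkhs_rules(4)[OF D, of "-1"] f, of n n]
      unfolding e is_rkhs_rules(6)[OF D f] .
    then have "?n\<^sup>2 = Re (ip (?F n) f) - Re (ip (\<lambda>x. ?F n x - f x) f)"
      using is_rkhs_self(2)[OF f] by simp
    also have "\<dots> \<le> cmod (ip (?F n) f) + cmod (ip (\<lambda>x. ?F n x - f x) f)"
      using abs_Re_le_cmod[of "ip (?F n) f"] abs_Re_le_cmod[of "ip (\<lambda>x. ?F n x - f x) f"] by linarith
    also have "cmod (ip (?F n) f) = cmod (pairing f (?A n))"
      using is_rkhs_rules(7)[OF f FH] is_rkhs_kernel_comb(2)[OF A f] by simp
    also have "\<dots> \<le> ?N * comb_norm X K (?A n)"
      by (rule pairing_le_dual_norm[OF k fb A])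
    also have "cmod (ip (\<lambda>x. ?F n x - f x) f) \<le> ?n * ?e n"
      using is_rkhs_Cauchy_Schwarz[OF D f] by (simp add: mult.commute)
    finally show ?thesis by simp
  qed
  note bound = this
  have "?e \<longlonglongrightarrow> 0"
    using is_rkhs_approx_tendsto[OF fb] by (rule conjunct2)
  then have "(\<lambda>n. ?N * comb_norm X K (?A n) + ?n * ?e n) \<longlonglongrightarrow> ?N * ?N + ?n * 0"
    by (intro tendsto_add tendsto_mult tendsto_const comb_norm_approx_tendsto[OF k fb])
  then have "?n\<^sup>2 \<le> ?N * ?N + ?n * 0"
    by (rule LIMSEQ_le_const) (intro exI allI impI, rule bound)
  then have "?n\<^sup>2 \<le> ?N\<^sup>2"
    by (simp only: power2_eq_square mult_zero_right add_0_right)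
  then show "?n \<le> ?N"
    by (rule power2_le_imp_le[OF _ dual_norm_nonneg[OF fb]])
qed

end

lemma rkhs_eq: "is_kernel X K \<Longrightarrow> rkhs X K = bounded_functionals X K"
  unfolding rkhs_def using is_rkhs_bounded_functionals is_rkhs_carrier_unique
  by (intro the_equality) blast+

lemma is_rkhs_rkhs:
  assumes "is_kernel X K"
  shows "is_rkhs X K (rkhs X K) (rkhs_inner X K)"
  unfolding rkhs_inner_def
proof (rule someI[of "is_rkhs X K (rkhs X K)"])
  show "is_rkhs X K (rkhs X K) (dual_inner X K)"
    using is_rkhs_bounded_functionals[OF assms] rkhs_eq[OF assms] by simp
qed

lemma rkhs_norm_eq:
  assumes "is_kernel X K" "f \<in> rkhs X K"
  shows "rkhs_norm X K f = dual_norm X K f"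
  unfolding rkhs_norm_def using is_rkhs_norm_unique[OF is_rkhs_rkhs] assms by blast

subsection \<open>Contractive multipliers and positive kernels\<close>

text \<open>A finite set of pairs is enlarged to a grid by coefficients \<open>0\<close>. On a grid
  the sums over points and over components separate.\<close>

lemma is_kernel_grid_iff:
  fixes m :: nat and L :: "'a \<times> nat \<Rightarrow> 'a \<times> nat \<Rightarrow> complex"
  shows "is_kernel (X \<times> {..<m}) L \<longleftrightarrow> (\<forall>S (c :: 'a \<times> nat \<Rightarrow> complex). finite S \<and> S \<subseteq> X \<longrightarrow>
    0 \<le> (\<Sum>p\<in>S \<times> {..<m}. \<Sum>q\<in>S \<times> {..<m}. cnj (c p) * c q * L p q))"
    (is "?l \<longleftrightarrow> ?r")
proof
  assume l: ?l
  show ?r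
  proof (intro allI impI)
    fix S and c :: "'a \<times> nat \<Rightarrow> complex" assume "finite S \<and> S \<subseteq> X"
    then have "finite (S \<times> {..<m}) \<and> S \<times> {..<m} \<subseteq> X \<times> {..<m}" by auto
    with l show "0 \<le> (\<Sum>p\<in>S \<times> {..<m}. \<Sum>q\<in>S \<times> {..<m}. cnj (c p) * c q * L p q)"
      unfolding is_kernel_def by blast
  qed
next
  assume r: ?r
  show ?l
    unfolding is_kernel_def
  proof (intro allI impI)
    fix T and c :: "'a \<times> nat \<Rightarrow> complex" assume T: "finite T \<and> T \<subseteq> X \<times> {..<m}"
    let ?c = "\<lambda>p. if p \<in> T then c p else 0"
    let ?S = "fst ` T \<times> {..<m}"
    have sub: "finite ?S" "T \<subseteq> ?S"
      using T by (force simp: image_iff)+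
    have "(\<Sum>p\<in>T. \<Sum>q\<in>T. cnj (c p) * c q * L p q) = (\<Sum>p\<in>T. \<Sum>q\<in>T. cnj (?c p) * ?c q * L p q)"
      by simp
    also have "\<dots> = (\<Sum>p\<in>T. \<Sum>q\<in>?S. cnj (?c p) * ?c q * L p q)"
      using sub by (intro sum.cong refl sum.mono_neutral_left) auto
    also have "\<dots> = (\<Sum>p\<in>?S. \<Sum>q\<in>?S. cnj (?c p) * ?c q * L p q)"
      using sub by (intro sum.mono_neutral_left) auto
    finally have eq: "(\<Sum>p\<in>T. \<Sum>q\<in>T. cnj (c p) * c q * L p q) = \<dots>" .
    have "finite (fst ` T) \<and> fst ` T \<subseteq> X"
      using T by auto
    then show "0 \<le> (\<Sum>p\<in>T. \<Sum>q\<in>T. cnj (c p) * c q * L p q)"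
      unfolding eq by (rule r[rule_format])
  qed
qed

text \<open>The kernel whose block at \<open>(x, y)\<close> is \<open>K x y\<close> times the
  identity minus \<open>a x\<close> times the adjoint of \<open>a y\<close>. Entries given by plain
  functions carry no dimensions through the computations.\<close>

definition mult_kernel :: "nat \<Rightarrow> ('a \<Rightarrow> nat \<Rightarrow> nat \<Rightarrow> complex) \<Rightarrow> ('a \<Rightarrow> 'a \<Rightarrow> complex)
    \<Rightarrow> 'a \<times> nat \<Rightarrow> 'a \<times> nat \<Rightarrow> complex" where
  "mult_kernel n a K = (\<lambda>(x, i) (y, j).
     ((if i = j then 1 else 0) - (\<Sum>l<n. a x i l * cnj (a y j l))) * K x y)"

lemma is_kernel_mult_kernel_iff:
  assumes "\<And>x. x \<in> X \<Longrightarrow> \<Phi> x \<in> carrier_mat m n"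
  shows "is_kernel (X \<times> {..<m}) (\<lambda>(x, i) (y, j). (1\<^sub>m m - \<Phi> x * mat_adjoint (\<Phi> y)) $$ (i, j) * K x y)
    \<longleftrightarrow> is_kernel (X \<times> {..<m}) (mult_kernel n (\<lambda>x i l. \<Phi> x $$ (i, l)) K)"
proof (rule is_kernel_cong)
  fix p q assume "p \<in> X \<times> {..<m}" "q \<in> X \<times> {..<m}"
  then obtain x i y j where *: "p = (x, i)" "q = (y, j)" "x \<in> X" "y \<in> X" "i < m" "j < m"
    by auto
  have "dim_row (\<Phi> x) = m" "dim_col (\<Phi> x) = n" "dim_row (\<Phi> y) = m" "dim_col (\<Phi> y) = n"
    using assms[OF *(3)] assms[OF *(4)] by auto
  then have "(1\<^sub>m m - \<Phi> x * mat_adjoint (\<Phi> y)) $$ (i, j)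
      = (if i = j then 1 else 0) - (\<Sum>l<n. \<Phi> x $$ (i, l) * cnj (\<Phi> y $$ (j, l)))"
    using * by (simp add: mat_adjoint_def scalar_prod_def mat_of_rows_def atLeast0LessThan)
  then show "(case p of (x, i) \<Rightarrow> \<lambda>(y, j). (1\<^sub>m m - \<Phi> x * mat_adjoint (\<Phi> y)) $$ (i, j) * K x y) q
      = mult_kernel n (\<lambda>x i l. \<Phi> x $$ (i, l)) K p q"
    by (simp add: * mult_kernel_def)
qed

text \<open>\<open>d l\<close> is component \<open>l\<close> of the adjoint multiplication operator
  applied to the tuple of combinations with coefficients \<open>c\<close>. The form of the block
  kernel is the squared norm of this tuple minus that of its image.\<close>

lemma mult_kernel_sum:
  fixes c :: "'a \<times> nat \<Rightarrow> complex" and a :: "'a \<Rightarrow> nat \<Rightarrow> nat \<Rightarrow> complex" and m :: nat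
  assumes "finite S"
  defines "d \<equiv> \<lambda>l y. \<Sum>i<m. c (y, i) * cnj (a y i l)"
  shows "(\<Sum>p\<in>S \<times> {..<m}. \<Sum>q\<in>S \<times> {..<m}. cnj (c p) * c q * mult_kernel n a K p q)
    = (\<Sum>i<m. \<Sum>x\<in>S. \<Sum>y\<in>S. cnj (c (x, i)) * c (y, i) * K x y)
      - (\<Sum>l<n. \<Sum>x\<in>S. \<Sum>y\<in>S. cnj (d l x) * d l y * K x y)"
proof -
  have pt: "(\<Sum>i<m. \<Sum>j<m. cnj (c (x, i)) * c (y, j) * mult_kernel n a K (x, i) (y, j))
      = (\<Sum>i<m. cnj (c (x, i)) * c (y, i) * K x y) - (\<Sum>l<n. cnj (d l x) * d l y * K x y)" for x y
  proof -
    have 1: "(\<Sum>j<m. cnj (c (x, i)) * c (y, j) * ((if i = j then 1 else 0) * K x y))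
        = cnj (c (x, i)) * c (y, i) * K x y" if "i < m" for i
    proof -
      have "(\<Sum>j<m. cnj (c (x, i)) * c (y, j) * ((if i = j then 1 else 0) * K x y))
          = (\<Sum>j<m. if j = i then cnj (c (x, i)) * c (y, j) * K x y else 0)"
        by (intro sum.cong refl) auto
      then show ?thesis using that by simp
    qed
    have "(\<Sum>l<n. cnj (d l x) * d l y * K x y)
        = (\<Sum>l<n. \<Sum>i<m. \<Sum>j<m. cnj (c (x, i)) * a x i l * (c (y, j) * cnj (a y j l)) * K x y)"
      by (simp only: d_def cnj_sum complex_cnj_mult complex_cnj_cnj sum_product)
        (simp only: sum_distrib_right)
    also have "\<dots> = (\<Sum>i<m. \<Sum>l<n. \<Sum>j<m. cnj (c (x, i)) * a x i l * (c (y, j) * cnj (a y j l)) * K x y)"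
      by (rule sum.swap)
    also have "\<dots> = (\<Sum>i<m. \<Sum>j<m. \<Sum>l<n. cnj (c (x, i)) * a x i l * (c (y, j) * cnj (a y j l)) * K x y)"
      by (rule sum.cong[OF refl]) (rule sum.swap)
    also have "\<dots> = (\<Sum>i<m. \<Sum>j<m. cnj (c (x, i)) * c (y, j) * ((\<Sum>l<n. a x i l * cnj (a y j l)) * K x y))"
      by (intro sum.cong refl) (simp add: sum_distrib_left sum_distrib_right mult_ac)
    finally have 2: "(\<Sum>l<n. cnj (d l x) * d l y * K x y) = \<dots>" .
    have "(\<Sum>i<m. \<Sum>j<m. cnj (c (x, i)) * c (y, j) * mult_kernel n a K (x, i) (y, j))
        = (\<Sum>i<m. \<Sum>j<m. cnj (c (x, i)) * c (y, j) * ((if i = j then 1 else 0) * K x y))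
          - (\<Sum>i<m. \<Sum>j<m. cnj (c (x, i)) * c (y, j) * ((\<Sum>l<n. a x i l * cnj (a y j l)) * K x y))"
      unfolding mult_kernel_def prod.case
      by (simp only: left_diff_distrib right_diff_distrib sum_subtractf)
    also have "(\<Sum>i<m. \<Sum>j<m. cnj (c (x, i)) * c (y, j) * ((if i = j then 1 else 0) * K x y))
        = (\<Sum>i<m. cnj (c (x, i)) * c (y, i) * K x y)"
      by (rule sum.cong[OF refl]) (use 1 in auto)
    finally show ?thesis
      unfolding 2 .
  qed
  have sw: "(\<Sum>i<k. \<Sum>x\<in>S. \<Sum>y\<in>S. f i x y) = (\<Sum>x\<in>S. \<Sum>y\<in>S. \<Sum>i<k. f i x y)" for k :: nat and f :: "nat \<Rightarrow> 'a \<Rightarrow> 'a \<Rightarrow> complex"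
    by (subst sum.swap, rule sum.cong[OF refl], rule sum.swap)
  have "(\<Sum>p\<in>S \<times> {..<m}. \<Sum>q\<in>S \<times> {..<m}. cnj (c p) * c q * mult_kernel n a K p q)
      = (\<Sum>x\<in>S. \<Sum>i<m. \<Sum>y\<in>S. \<Sum>j<m. cnj (c (x, i)) * c (y, j) * mult_kernel n a K (x, i) (y, j))"
    by (simp add: sum.cartesian_product[symmetric] sum.cartesian_product')
  also have "\<dots> = (\<Sum>x\<in>S. \<Sum>y\<in>S. \<Sum>i<m. \<Sum>j<m. cnj (c (x, i)) * c (y, j) * mult_kernel n a K (x, i) (y, j))"
    by (rule sum.cong[OF refl]) (rule sum.swap)
  finally show ?thesis
    unfolding sw by (simp only: pt sum_subtractf)
qed

lemma comb_norm_square_sum: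
  assumes "is_kernel X K" "finite S" "S \<subseteq> X" "\<And>x. x \<notin> S \<Longrightarrow> c x = 0"
  shows "(\<Sum>x\<in>S. \<Sum>y\<in>S. cnj (c x) * c y * K x y) = complex_of_real ((comb_norm X K c)\<^sup>2)"
  using pairing_self[OF assms(1) fin_coeffsI[OF assms(2-4)]] pairing_kernel_comb[OF assms(2-4) assms(4)]
  by simp

text \<open>Positivity is contractivity of the adjoint multiplication operator, tested on tuples of
  finite combinations.\<close>

lemma is_kernel_mult_kernel_norm_iff:
  assumes k: "is_kernel X K"
  shows "is_kernel (X \<times> {..<m}) (mult_kernel n a K) \<longleftrightarrow>
    (\<forall>c. (\<forall>i<m. c i \<in> fin_coeffs X) \<longrightarrow>
      (\<Sum>l<n. (comb_norm X K (\<lambda>y. \<Sum>i<m. c i y * cnj (a y i l)))\<^sup>2) \<le> (\<Sum>i<m. (comb_norm X K (c i))\<^sup>2))"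
    (is "?l \<longleftrightarrow> ?r")
proof -
  have key: "(\<Sum>p\<in>S \<times> {..<m}. \<Sum>q\<in>S \<times> {..<m}. cnj (c (snd p) (fst p)) * c (snd q) (fst q) * mult_kernel n a K p q)
      = complex_of_real ((\<Sum>i<m. (comb_norm X K (c i))\<^sup>2)
        - (\<Sum>l<n. (comb_norm X K (\<lambda>y. \<Sum>i<m. c i y * cnj (a y i l)))\<^sup>2))"
    if S: "finite S" "S \<subseteq> X" "\<And>i x. i < m \<Longrightarrow> x \<notin> S \<Longrightarrow> c i x = 0" for S and c :: "nat \<Rightarrow> 'a \<Rightarrow> complex"
  proof -
    have "(\<Sum>i<m. \<Sum>x\<in>S. \<Sum>y\<in>S. cnj (c i x) * c i y * K x y)
        = (\<Sum>i<m. complex_of_real ((comb_norm X K (c i))\<^sup>2))"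
      by (rule sum.cong[OF refl], rule comb_norm_square_sum[OF k S(1,2)]) (use S(3) in auto)
    moreover have "(\<Sum>l<n. \<Sum>x\<in>S. \<Sum>y\<in>S. cnj (\<Sum>i<m. c i x * cnj (a x i l)) * (\<Sum>i<m. c i y * cnj (a y i l)) * K x y)
        = (\<Sum>l<n. complex_of_real ((comb_norm X K (\<lambda>y. \<Sum>i<m. c i y * cnj (a y i l)))\<^sup>2))"
      by (rule sum.cong[OF refl], rule comb_norm_square_sum[OF k S(1,2)]) (use S(3) in auto)
    ultimately show ?thesis
      using mult_kernel_sum[OF S(1), where c = "\<lambda>p. c (snd p) (fst p)" and m = m and n = n and a = a and K = K] by simp
  qed
  show ?thesis
  proof
    assume l: ?l
    show ?r
    proof (intro allI impI)
      fix c :: "nat \<Rightarrow> 'a \<Rightarrow> complex" assume c: "\<forall>i<m. c i \<in> fin_coeffs X"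
      define S where "S = (\<Union>i<m. {x. c i x \<noteq> 0})"
      have S: "finite S" "S \<subseteq> X" "\<And>i x. i < m \<Longrightarrow> x \<notin> S \<Longrightarrow> c i x = 0"
        using c by (auto simp: S_def fin_coeffs_def)
      have "0 \<le> (\<Sum>p\<in>S \<times> {..<m}. \<Sum>q\<in>S \<times> {..<m}. cnj (c (snd p) (fst p)) * c (snd q) (fst q) * mult_kernel n a K p q)"
        using l[unfolded is_kernel_grid_iff, rule_format, of S "\<lambda>p. c (snd p) (fst p)"] S by blast
      also have "\<dots> = complex_of_real ((\<Sum>i<m. (comb_norm X K (c i))\<^sup>2)
          - (\<Sum>l<n. (comb_norm X K (\<lambda>y. \<Sum>i<m. c i y * cnj (a y i l)))\<^sup>2))"
        by (rule key) (use S in auto)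
      finally have "0 \<le> (\<Sum>i<m. (comb_norm X K (c i))\<^sup>2)
          - (\<Sum>l<n. (comb_norm X K (\<lambda>y. \<Sum>i<m. c i y * cnj (a y i l)))\<^sup>2)"
        by (simp only: less_eq_complex_def Re_complex_of_real zero_complex.sel)
      then show "(\<Sum>l<n. (comb_norm X K (\<lambda>y. \<Sum>i<m. c i y * cnj (a y i l)))\<^sup>2) \<le> (\<Sum>i<m. (comb_norm X K (c i))\<^sup>2)"
        by simp
    qed
  next
    assume r: ?r
    show ?l
      unfolding is_kernel_grid_iff
    proof (intro allI impI)
      fix S and c :: "'a \<times> nat \<Rightarrow> complex" assume S: "finite S \<and> S \<subseteq> X"
      define C where "C = (\<lambda>i x. if x \<in> S then c (x, i) else 0)"
      have C: "\<forall>i<m. C i \<in> fin_coeffs X"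
        using S by (auto intro!: fin_coeffsI[of S] simp: C_def)
      have "(\<Sum>p\<in>S \<times> {..<m}. \<Sum>q\<in>S \<times> {..<m}. cnj (c p) * c q * mult_kernel n a K p q)
          = (\<Sum>p\<in>S \<times> {..<m}. \<Sum>q\<in>S \<times> {..<m}. cnj (C (snd p) (fst p)) * C (snd q) (fst q) * mult_kernel n a K p q)"
        by (intro sum.cong refl) (auto simp: C_def)
      also have "\<dots> = complex_of_real ((\<Sum>i<m. (comb_norm X K (C i))\<^sup>2)
          - (\<Sum>l<n. (comb_norm X K (\<lambda>y. \<Sum>i<m. C i y * cnj (a y i l)))\<^sup>2))"
        using S by (intro key) (auto simp: C_def)
      finally have eq: "(\<Sum>p\<in>S \<times> {..<m}. \<Sum>q\<in>S \<times> {..<m}. cnj (c p) * c q * mult_kernel n a K p q) = \<dots>" .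
      show "0 \<le> (\<Sum>p\<in>S \<times> {..<m}. \<Sum>q\<in>S \<times> {..<m}. cnj (c p) * c q * mult_kernel n a K p q)"
        unfolding eq using r C by (simp only: less_eq_complex_def Re_complex_of_real Im_complex_of_real zero_complex.sel) simp
    qed
  qed
qed

text \<open>The adjoint relation \<open>\<langle>\<Phi> F, c\<rangle> = \<langle>F, \<Phi>\<^sup>*
  c\<rangle>\<close> at the level of coefficients.\<close>

lemma pairing_mult_sum:
  fixes m n :: nat
  assumes "\<And>i. i < m \<Longrightarrow> c i \<in> fin_coeffs X"
  shows "(\<Sum>i<m. pairing (\<lambda>x. \<Sum>l<n. a x i l * F l x) (c i))
    = (\<Sum>l<n. pairing (F l) (\<lambda>y. \<Sum>i<m. c i y * cnj (a y i l)))"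
proof -
  define S where "S = (\<Union>i<m. {x. c i x \<noteq> 0})"
  have S: "finite S" "\<And>i x. i < m \<Longrightarrow> x \<notin> S \<Longrightarrow> c i x = 0"
    using assms[unfolded fin_coeffs_def mem_Collect_eq, THEN conjunct1] by (auto simp: S_def)
  have "(\<Sum>i<m. pairing (\<lambda>x. \<Sum>l<n. a x i l * F l x) (c i))
      = (\<Sum>i<m. \<Sum>x\<in>S. (\<Sum>l<n. a x i l * F l x) * cnj (c i x))"
    using S by (intro sum.cong refl pairing_eq) auto
  also have "\<dots> = (\<Sum>i<m. \<Sum>x\<in>S. \<Sum>l<n. a x i l * F l x * cnj (c i x))"
    by (simp only: sum_distrib_right)
  also have "\<dots> = (\<Sum>i<m. \<Sum>l<n. \<Sum>x\<in>S. a x i l * F l x * cnj (c i x))"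
    by (rule sum.cong[OF refl]) (rule sum.swap)
  also have "\<dots> = (\<Sum>l<n. \<Sum>i<m. \<Sum>x\<in>S. a x i l * F l x * cnj (c i x))"
    by (rule sum.swap)
  also have "\<dots> = (\<Sum>l<n. \<Sum>x\<in>S. \<Sum>i<m. a x i l * F l x * cnj (c i x))"
    by (rule sum.cong[OF refl]) (rule sum.swap)
  also have "\<dots> = (\<Sum>l<n. \<Sum>x\<in>S. F l x * cnj (\<Sum>i<m. c i x * cnj (a x i l)))"
    by (simp add: cnj_sum sum_distrib_left mult_ac)
  also have "\<dots> = (\<Sum>l<n. pairing (F l) (\<lambda>y. \<Sum>i<m. c i y * cnj (a y i l)))"
    using S by (intro sum.cong refl pairing_eq[symmetric]) auto
  finally show ?thesis .
qed

lemma fin_coeffs_mult_sum: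
  fixes m :: nat
  assumes "\<And>i. i < m \<Longrightarrow> c i \<in> fin_coeffs X"
  shows "(\<lambda>y. \<Sum>i<m. c i y * b y i) \<in> fin_coeffs X"
proof (rule fin_coeffsI)
  show "finite (\<Union>i<m. {x. c i x \<noteq> 0})" "(\<Union>i<m. {x. c i x \<noteq> 0}) \<subseteq> X"
    using assms[unfolded fin_coeffs_def mem_Collect_eq, THEN conjunct1]
      assms[unfolded fin_coeffs_def mem_Collect_eq, THEN conjunct2] by auto
qed auto

lemma sum_pairing_le:
  fixes n :: nat
  assumes k: "is_kernel X K" and F: "\<And>l. l < n \<Longrightarrow> F l \<in> bounded_functionals X K"
    and d: "\<And>l. l < n \<Longrightarrow> d l \<in> fin_coeffs X"
  shows "cmod (\<Sum>l<n. pairing (F l) (d l))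
    \<le> sqrt (\<Sum>l<n. (dual_norm X K (F l))\<^sup>2) * sqrt (\<Sum>l<n. (comb_norm X K (d l))\<^sup>2)"
proof -
  have "cmod (\<Sum>l<n. pairing (F l) (d l)) \<le> (\<Sum>l<n. cmod (pairing (F l) (d l)))"
    by (rule norm_sum)
  also have "\<dots> \<le> (\<Sum>l<n. \<bar>dual_norm X K (F l)\<bar> * \<bar>comb_norm X K (d l)\<bar>)"
    using pairing_le_dual_norm[OF k F d] dual_norm_nonneg[OF F] comb_norm_nonneg[OF k d]
    by (intro sum_mono) auto
  also have "\<dots> \<le> L2_set (\<lambda>l. dual_norm X K (F l)) {..<n} * L2_set (\<lambda>l. comb_norm X K (d l)) {..<n}"
    by (rule L2_set_mult_ineq)
  finally show ?thesis
    by (simp add: L2_set_def)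
qed

lemma le_of_square_le_mult:
  fixes s t :: real
  assumes "s\<^sup>2 \<le> t * s" "0 \<le> s" "0 \<le> t"
  shows "s \<le> t"
  using assms by (cases "s = 0") (auto simp: power2_eq_square)

text \<open>With \<open>M\<close> the multiplication operator, \<open>M\<^sup>* c\<close> is again a
  tuple of combinations, so \<open>M\<close> may be applied to it: \<open>\<parallel>M\<^sup>*
  c\<parallel>\<^sup>2 = \<langle>M M\<^sup>* c, c\<rangle> \<le> \<parallel>M\<^sup>* c\<parallel>
  \<parallel>c\<parallel>\<close>. Hence the adjoint is contractive.\<close>

lemma contractive_matrix_multiplier_imp_kernel:
  assumes k: "is_kernel X K" and c: "contractive_matrix_multiplier X K m n \<Phi>"
  shows "is_kernel (X \<times> {..<m}) (mult_kernel n (\<lambda>x i l. \<Phi> x $$ (i, l)) K)"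
  unfolding is_kernel_mult_kernel_norm_iff[OF k]
proof (intro allI impI)
  fix c assume "\<forall>i<m. c i \<in> fin_coeffs X"
  then have c': "\<And>i. i < m \<Longrightarrow> c i \<in> fin_coeffs X" by blast
  define d where "d = (\<lambda>l y. \<Sum>i<m. c i y * cnj (\<Phi> y $$ (i, l)))"
  define F where "F = (\<lambda>l. kernel_comb X K (d l))"
  define G where "G = (\<lambda>i x. \<Sum>l<n. \<Phi> x $$ (i, l) * F l x)"
  define s where "s = sqrt (\<Sum>l<n. (comb_norm X K (d l))\<^sup>2)"
  have d: "d l \<in> fin_coeffs X" for l
    unfolding d_def using c' by (rule fin_coeffs_mult_sum)
  have F: "F l \<in> bounded_functionals X K" "dual_norm X K (F l) = comb_norm X K (d l)" for l
    unfolding F_def using kernel_comb_bounded[OF k d] by auto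
  have "\<forall>j<n. F j \<in> rkhs X K"
    using F rkhs_eq[OF k] by simp
  then have "(\<forall>i<m. G i \<in> rkhs X K) \<and>
      sqrt (\<Sum>i<m. (rkhs_norm X K (G i))\<^sup>2) \<le> sqrt (\<Sum>j<n. (rkhs_norm X K (F j))\<^sup>2)"
    using c unfolding contractive_matrix_multiplier_def G_def by blast
  then have G: "\<And>i. i < m \<Longrightarrow> G i \<in> bounded_functionals X K"
    and le: "sqrt (\<Sum>i<m. (dual_norm X K (G i))\<^sup>2) \<le> s"
    using F rkhs_norm_eq[OF k] by (auto simp: rkhs_eq[OF k] s_def)
  have s2: "s\<^sup>2 = (\<Sum>l<n. (comb_norm X K (d l))\<^sup>2)"
    unfolding s_def by (intro real_sqrt_pow2 sum_nonneg) auto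
  have s0: "0 \<le> s"
    unfolding s_def by (intro real_sqrt_ge_zero sum_nonneg) auto
  have t0: "0 \<le> sqrt (\<Sum>i<m. (comb_norm X K (c i))\<^sup>2)"
    by (intro real_sqrt_ge_zero sum_nonneg) auto
  have "complex_of_real (s\<^sup>2) = (\<Sum>l<n. pairing (F l) (d l))"
    unfolding s2 F_def using pairing_self[OF k d] by simp
  also have "\<dots> = (\<Sum>i<m. pairing (G i) (c i))"
    unfolding G_def d_def using pairing_mult_sum[OF c', where a = "\<lambda>x i l. \<Phi> x $$ (i, l)"] by simp
  finally have "s\<^sup>2 = cmod (\<Sum>i<m. pairing (G i) (c i))"
    by (metis abs_power2 norm_of_real)
  also have "\<dots> \<le> sqrt (\<Sum>i<m. (dual_norm X K (G i))\<^sup>2) * sqrt (\<Sum>i<m. (comb_norm X K (c i))\<^sup>2)"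
    by (rule sum_pairing_le[OF k G c'])
  also have "\<dots> \<le> s * sqrt (\<Sum>i<m. (comb_norm X K (c i))\<^sup>2)"
    by (rule mult_right_mono[OF le t0])
  finally have "s\<^sup>2 \<le> sqrt (\<Sum>i<m. (comb_norm X K (c i))\<^sup>2) * s"
    by (subst mult.commute)
  from le_of_square_le_mult[OF this s0 t0] show "(\<Sum>l<n. (comb_norm X K (\<lambda>y. \<Sum>i<m. c i y * cnj (\<Phi> y $$ (i, l))))\<^sup>2) \<le> (\<Sum>i<m. (comb_norm X K (c i))\<^sup>2)"
    by (simp add: s_def d_def)
qed

text \<open>Contractivity of the adjoint bounds the product tuple \<open>G\<close> as a functional
  on tuples of combinations. This first puts each entry of \<open>G\<close> into the space; only
  then do approximants of \<open>G\<close> exist on which the bound can be tested to obtain the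
  norm.\<close>

lemma contractive_matrix_multiplierI:
  assumes k: "is_kernel X K" and \<Phi>: "\<And>x. x \<in> X \<Longrightarrow> \<Phi> x \<in> carrier_mat m n"
    and mk: "is_kernel (X \<times> {..<m}) (mult_kernel n (\<lambda>x i l. \<Phi> x $$ (i, l)) K)"
  shows "contractive_matrix_multiplier X K m n \<Phi>"
  unfolding contractive_matrix_multiplier_def
proof (intro conjI ballI allI impI \<Phi>)
  fix F :: "nat \<Rightarrow> 'a \<Rightarrow> complex"
  assume "\<forall>j<n. F j \<in> rkhs X K"
  then have F: "\<And>j. j < n \<Longrightarrow> F j \<in> bounded_functionals X K"
    by (simp add: rkhs_eq[OF k])
  define G where "G = (\<lambda>i x. \<Sum>l<n. \<Phi> x $$ (i, l) * F l x)"
  define M where "M = sqrt (\<Sum>l<n. (dual_norm X K (F l))\<^sup>2)"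
  have M0: "0 \<le> M"
    unfolding M_def by (intro real_sqrt_ge_zero sum_nonneg) auto
  have main: "cmod (\<Sum>i<m. pairing (G i) (c i)) \<le> M * sqrt (\<Sum>i<m. (comb_norm X K (c i))\<^sup>2)"
    if c: "\<And>i. i < m \<Longrightarrow> c i \<in> fin_coeffs X" for c
  proof -
    let ?d = "\<lambda>l y. \<Sum>i<m. c i y * cnj (\<Phi> y $$ (i, l))"
    have "cmod (\<Sum>i<m. pairing (G i) (c i)) = cmod (\<Sum>l<n. pairing (F l) (?d l))"
      unfolding G_def using pairing_mult_sum[OF c, where a = "\<lambda>x i l. \<Phi> x $$ (i, l)"] by simp
    also have "\<dots> \<le> M * sqrt (\<Sum>l<n. (comb_norm X K (?d l))\<^sup>2)"
      unfolding M_def by (rule sum_pairing_le[OF k F fin_coeffs_mult_sum[OF c]])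
    also have "\<dots> \<le> M * sqrt (\<Sum>i<m. (comb_norm X K (c i))\<^sup>2)"
      using mk[unfolded is_kernel_mult_kernel_norm_iff[OF k]] c
      by (intro mult_left_mono[OF _ M0] real_sqrt_le_mono) blast
    finally show ?thesis .
  qed
  have G: "G i \<in> bounded_functionals X K" if i: "i < m" for i
  proof (rule bounded_functionalsI[OF _ M0])
    show "G i x = 0" if "x \<notin> X" for x
      unfolding G_def using bounded_functionals_outside[OF F that] by simp
    fix e assume e: "e \<in> fin_coeffs X"
    \<comment> \<open>All slots but one are zero, which isolates one component of the joint
      bound.\<close>
    define c where "c = (\<lambda>j. if j = i then e else (\<lambda>x. 0))"
    have c: "c j \<in> fin_coeffs X" for j
      using e by (simp add: c_def fin_coeffs_zero)
    have "(\<Sum>j<m. pairing (G j) (c j)) = (\<Sum>j<m. if j = i then pairing (G i) e else 0)"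
      by (intro sum.cong refl) (simp add: c_def pairing_def)
    moreover have "(\<Sum>j<m. (comb_norm X K (c j))\<^sup>2) = (\<Sum>j<m. if j = i then (comb_norm X K e)\<^sup>2 else 0)"
      by (intro sum.cong refl) (simp add: c_def comb_norm_def pairing_def)
    ultimately show "cmod (pairing (G i) e) \<le> M * comb_norm X K e"
      using main[of c] c i comb_norm_nonneg[OF k e] by simp
  qed
  then show "(\<lambda>x. \<Sum>j<n. \<Phi> x $$ (i, j) * F j x) \<in> rkhs X K" if "i < m" for i
    using that by (simp add: rkhs_eq[OF k] G_def)
  let ?S = "\<Sum>i<m. (dual_norm X K (G i))\<^sup>2"
  have S0: "0 \<le> ?S" by (intro sum_nonneg) auto
  have "(\<lambda>r. pairing (G i) (comb_approx X K (G i) r)) \<longlonglongrightarrow> complex_of_real ((dual_norm X K (G i))\<^sup>2)"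
    if "i < m" for i
    unfolding dual_inner_self[OF k G[OF that], symmetric]
    by (rule dual_inner_tendsto_approx[OF k G[OF that] G[OF that]])
  then have "(\<lambda>r. cmod (\<Sum>i<m. pairing (G i) (comb_approx X K (G i) r)))
      \<longlonglongrightarrow> cmod (\<Sum>i<m. complex_of_real ((dual_norm X K (G i))\<^sup>2))"
    by (intro tendsto_norm tendsto_sum) (simp only: lessThan_iff)
  moreover have "(\<lambda>r. M * sqrt (\<Sum>i<m. (comb_norm X K (comb_approx X K (G i) r))\<^sup>2)) \<longlonglongrightarrow> M * sqrt ?S"
    by (intro tendsto_mult tendsto_const tendsto_real_sqrt tendsto_sum tendsto_power
        comb_norm_approx_tendsto[OF k G]) auto
  ultimately have "cmod (\<Sum>i<m. complex_of_real ((dual_norm X K (G i))\<^sup>2)) \<le> M * sqrt ?S"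
    by (rule LIMSEQ_le) (intro exI allI impI main comb_approx(1)[OF k G])
  moreover have "(\<Sum>i<m. complex_of_real ((dual_norm X K (G i))\<^sup>2)) = complex_of_real ?S"
    by (simp only: of_real_sum)
  ultimately have "(sqrt ?S)\<^sup>2 \<le> M * sqrt ?S"
    using S0 by (simp only: norm_of_real) simp
  from le_of_square_le_mult[OF this real_sqrt_ge_zero[OF S0] M0] have "sqrt ?S \<le> M" .
  moreover have "rkhs_norm X K (G i) = dual_norm X K (G i)" if "i < m" for i
    using rkhs_norm_eq[OF k] G[OF that] by (simp add: rkhs_eq[OF k])
  moreover have "rkhs_norm X K (F j) = dual_norm X K (F j)" if "j < n" for j
    using rkhs_norm_eq[OF k] F[OF that] by (simp add: rkhs_eq[OF k])
  ultimately show "sqrt (\<Sum>i<m. (rkhs_norm X K (\<lambda>x. \<Sum>j<n. \<Phi> x $$ (i, j) * F j x))\<^sup>2)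
      \<le> sqrt (\<Sum>j<n. (rkhs_norm X K (F j))\<^sup>2)"
    by (simp add: M_def G_def)
qed

subsection \<open>Finite-dimensional preliminaries\<close>

text \<open>Coordinates are indexed by arbitrary sets, so that \<open><+>\<close> can later serve as
  a direct sum.\<close>

definition vec_inner :: "'j set \<Rightarrow> ('j \<Rightarrow> complex) \<Rightarrow> ('j \<Rightarrow> complex) \<Rightarrow> complex" where
  "vec_inner J f g = (\<Sum>j\<in>J. f j * cnj (g j))"

definition vec_sqnorm :: "'j set \<Rightarrow> ('j \<Rightarrow> complex) \<Rightarrow> real" where
  "vec_sqnorm J f = (\<Sum>j\<in>J. (cmod (f j))\<^sup>2)"

lemma vec_inner_self: "vec_inner J f f = complex_of_real (vec_sqnorm J f)"
  by (simp only: vec_inner_def vec_sqnorm_def of_real_sum complex_norm_square)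

lemma vec_sqnorm_nonneg: "0 \<le> vec_sqnorm J f"
  by (simp add: vec_sqnorm_def sum_nonneg)

lemma vec_sqnorm_eq_0_iff: "finite J \<Longrightarrow> vec_sqnorm J f = 0 \<longleftrightarrow> (\<forall>j\<in>J. f j = 0)"
  by (simp add: vec_sqnorm_def sum_nonneg_eq_0_iff)

lemma vec_inner_add_left: "vec_inner J (\<lambda>j. f j + g j) h = vec_inner J f h + vec_inner J g h"
  by (simp add: vec_inner_def distrib_right sum.distrib)

lemma vec_inner_diff_left: "vec_inner J (\<lambda>j. f j - g j) h = vec_inner J f h - vec_inner J g h"
  by (simp add: vec_inner_def left_diff_distrib sum_subtractf)

lemma vec_inner_scale_left: "vec_inner J (\<lambda>j. t * f j) h = t * vec_inner J f h"
  by (simp add: vec_inner_def sum_distrib_left mult.assoc)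

lemma vec_inner_commute: "vec_inner J g f = cnj (vec_inner J f g)"
  by (simp add: vec_inner_def cnj_sum mult.commute)

lemma vec_inner_sum_left:
  "vec_inner J (\<lambda>j. \<Sum>k\<in>I. c k * a k j) h = (\<Sum>k\<in>I. c k * vec_inner J (a k) h)"
proof -
  have "vec_inner J (\<lambda>j. \<Sum>k\<in>I. c k * a k j) h = (\<Sum>j\<in>J. \<Sum>k\<in>I. c k * (a k j * cnj (h j)))"
    by (simp add: vec_inner_def sum_distrib_right mult.assoc)
  also have "\<dots> = (\<Sum>k\<in>I. \<Sum>j\<in>J. c k * (a k j * cnj (h j)))"
    by (rule sum.swap)
  finally show ?thesis
    by (simp add: vec_inner_def sum_distrib_left)
qed

lemma vec_inner_sum_right:
  "vec_inner J h (\<lambda>j. \<Sum>k\<in>I. c k * a k j) = (\<Sum>k\<in>I. cnj (c k) * vec_inner J h (a k))"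
  using vec_inner_sum_left[where J = J and I = I and c = c and a = a and h = h]
  by (simp add: vec_inner_commute[of J h] cnj_sum)

lemma vec_inner_cong:
  "(\<And>j. j \<in> J \<Longrightarrow> f j = f' j) \<Longrightarrow> (\<And>j. j \<in> J \<Longrightarrow> g j = g' j) \<Longrightarrow> vec_inner J f g = vec_inner J f' g'"
  unfolding vec_inner_def by (intro sum.cong) auto

lemma vec_sqnorm_cong: "(\<And>j. j \<in> J \<Longrightarrow> f j = f' j) \<Longrightarrow> vec_sqnorm J f = vec_sqnorm J f'"
  unfolding vec_sqnorm_def by (intro sum.cong) auto

lemma vec_sqnorm_scale: "vec_sqnorm J (\<lambda>j. t * f j) = (cmod t)\<^sup>2 * vec_sqnorm J f"
  by (simp add: vec_sqnorm_def norm_mult power_mult_distrib sum_distrib_left)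

lemma vec_sqnorm_pythagoras:
  assumes "vec_inner J f g = 0"
  shows "vec_sqnorm J (\<lambda>j. f j + g j) = vec_sqnorm J f + vec_sqnorm J g"
proof -
  have "vec_inner J h (\<lambda>j. f j + g j) = vec_inner J h f + vec_inner J h g" for h
    by (simp add: vec_inner_def distrib_left sum.distrib)
  then have "vec_inner J (\<lambda>j. f j + g j) (\<lambda>j. f j + g j)
      = vec_inner J f f + vec_inner J f g + (cnj (vec_inner J f g) + vec_inner J g g)"
    using vec_inner_commute[of J g f] by (simp add: vec_inner_add_left)
  then have "complex_of_real (vec_sqnorm J (\<lambda>j. f j + g j)) = complex_of_real (vec_sqnorm J f + vec_sqnorm J g)"
    using assms by (simp add: vec_inner_self)
  then show ?thesis
    using of_real_eq_iff by blast
qed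

text \<open>Gram-Schmidt by induction for a possibly dependent family: \<open>s\<close> and
  \<open>r\<close> are the residuals of \<open>e\<close> and of the new vector, and a multiple of
  \<open>r\<close> corrects \<open>s\<close>.\<close>

lemma orthogonal_projection_exists:
  assumes "finite I" "finite J"
  shows "\<exists>c. \<forall>i\<in>I. vec_inner J (\<lambda>j. e j - (\<Sum>k\<in>I. c k * a k j)) (a i) = 0"
  using assms(1)
proof (induction I arbitrary: e)
  case empty
  then show ?case by simp
next
  case (insert z I)
  obtain c where c: "\<And>i. i \<in> I \<Longrightarrow> vec_inner J (\<lambda>j. e j - (\<Sum>k\<in>I. c k * a k j)) (a i) = 0"
    using insert.IH[of e] by blast
  obtain c' where c': "\<And>i. i \<in> I \<Longrightarrow> vec_inner J (\<lambda>j. a z j - (\<Sum>k\<in>I. c' k * a k j)) (a i) = 0"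
    using insert.IH[of "a z"] by blast
  define s where "s = (\<lambda>j. e j - (\<Sum>k\<in>I. c k * a k j))"
  define r where "r = (\<lambda>j. a z j - (\<Sum>k\<in>I. c' k * a k j))"
  have inner_az: "vec_inner J h (a z) = vec_inner J h r"
    if "\<And>i. i \<in> I \<Longrightarrow> vec_inner J h (a i) = 0" for h
  proof -
    have "vec_inner J h (a z) = vec_inner J h r + vec_inner J h (\<lambda>j. \<Sum>k\<in>I. c' k * a k j)"
      by (simp add: r_def vec_inner_def right_diff_distrib sum_subtractf)
    then show ?thesis
      using that by (simp add: vec_inner_sum_right)
  qed
  have "\<exists>t. vec_inner J (\<lambda>j. s j - t * r j) (a z) = 0"
  proof (cases "vec_sqnorm J r = 0")
    \<comment> \<open>The new vector already lies in the span of the others, so no correction is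
      made.\<close>
    case True
    then have "\<forall>j\<in>J. r j = 0"
      using vec_sqnorm_eq_0_iff[OF assms(2)] by blast
    then have "vec_inner J s r = 0"
      by (simp add: vec_inner_def)
    moreover have "vec_inner J s (a z) = vec_inner J s r"
      using c by (intro inner_az) (simp add: s_def)
    ultimately show ?thesis
      by (intro exI[of _ 0]) simp
  next
    case False
    have "vec_inner J r (a z) = vec_inner J r r"
      using c' by (intro inner_az) (simp add: r_def)
    then have "vec_inner J r (a z) \<noteq> 0"
      using False by (simp add: vec_inner_self)
    then show ?thesis
      by (intro exI[of _ "vec_inner J s (a z) / vec_inner J r (a z)"])
         (simp only: vec_inner_diff_left vec_inner_scale_left, simp)
  qed
  then obtain t where t: "vec_inner J (\<lambda>j. s j - t * r j) (a z) = 0" by blast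
  define d where "d = (\<lambda>k. if k = z then t else c k - t * c' k)"
  have "(\<Sum>k\<in>insert z I. d k * a k j) = t * a z j + (\<Sum>k\<in>I. c k * a k j) - t * (\<Sum>k\<in>I. c' k * a k j)" for j
  proof -
    have "(\<Sum>k\<in>I. d k * a k j) = (\<Sum>k\<in>I. (c k - t * c' k) * a k j)"
      using insert.hyps by (intro sum.cong) (auto simp: d_def)
    then show ?thesis
      using insert.hyps by (simp add: d_def left_diff_distrib sum_subtractf sum_distrib_left mult.assoc)
  qed
  then have eq: "(\<lambda>j. e j - (\<Sum>k\<in>insert z I. d k * a k j)) = (\<lambda>j. s j - t * r j)"
    by (simp only: s_def r_def) (simp add: algebra_simps)
  have "vec_inner J (\<lambda>j. s j - t * r j) (a i) = 0" if "i \<in> I" for i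
    using c[OF that] c'[OF that]
    by (simp add: vec_inner_diff_left[of J s "\<lambda>j. t * r j"] vec_inner_scale_left s_def[symmetric] r_def[symmetric])
  with t show ?case
    unfolding eq[symmetric] by blast
qed

text \<open>The finite-dimensional lurking isometry argument: a contraction between spans extends to the
  whole space by composing it with the orthogonal projection.\<close>

lemma contraction_extension:
  assumes fin: "finite I" "finite J" "finite L"
    and le: "\<And>c. vec_sqnorm L (\<lambda>l. \<Sum>k\<in>I. c k * b k l) \<le> vec_sqnorm J (\<lambda>j. \<Sum>k\<in>I. c k * a k j)"
  shows "\<exists>V. (\<forall>d. vec_sqnorm L (\<lambda>l. \<Sum>j\<in>J. d j * V j l) \<le> vec_sqnorm J d) \<and>
    (\<forall>k\<in>I. \<forall>l\<in>L. b k l = (\<Sum>j\<in>J. a k j * V j l))"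
proof -
  define e :: "'b \<Rightarrow> 'b \<Rightarrow> complex" where "e = (\<lambda>i j. if j = i then 1 else 0)"
  have "\<forall>i. \<exists>c. \<forall>k\<in>I. vec_inner J (\<lambda>j. e i j - (\<Sum>k\<in>I. c k * a k j)) (a k) = 0"
    using orthogonal_projection_exists[OF fin(1,2)] by blast
  then obtain C where C: "\<And>i k. k \<in> I \<Longrightarrow> vec_inner J (\<lambda>j. e i j - (\<Sum>k\<in>I. C i k * a k j)) (a k) = 0"
    by metis
  \<comment> \<open>The projection of the unit vector at \<open>i\<close> is a combination of the
    \<open>a k\<close>; its image is the same combination of the \<open>b k\<close>.
    \<open>D\<close> below extends the choice of coefficients linearly.\<close>
  define V where "V = (\<lambda>i l. \<Sum>k\<in>I. C i k * b k l)"
  define D where "D = (\<lambda>d k. \<Sum>i\<in>J. d i * C i k)"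
  have V: "(\<Sum>j\<in>J. d j * V j l) = (\<Sum>k\<in>I. D d k * b k l)" for d l
  proof -
    have "(\<Sum>j\<in>J. d j * V j l) = (\<Sum>j\<in>J. \<Sum>k\<in>I. d j * C j k * b k l)"
      by (simp add: V_def sum_distrib_left mult.assoc)
    also have "\<dots> = (\<Sum>k\<in>I. \<Sum>j\<in>J. d j * C j k * b k l)"
      by (rule sum.swap)
    finally show ?thesis
      by (simp add: D_def sum_distrib_right)
  qed
  have orth: "vec_inner J (\<lambda>j. d j - (\<Sum>k\<in>I. D d k * a k j)) (a k) = 0" if "k \<in> I" for d k
  proof -
    have "d j - (\<Sum>k\<in>I. D d k * a k j) = (\<Sum>i\<in>J. d i * (e i j - (\<Sum>k\<in>I. C i k * a k j)))" if "j \<in> J" for j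
    proof -
      have "(\<Sum>i\<in>J. d i * e i j) = (\<Sum>i\<in>J. if i = j then d j else 0)"
        by (intro sum.cong) (auto simp: e_def)
      then have 1: "(\<Sum>i\<in>J. d i * e i j) = d j"
        using that fin(2) by simp
      have "(\<Sum>i\<in>J. d i * (\<Sum>k\<in>I. C i k * a k j)) = (\<Sum>i\<in>J. \<Sum>k\<in>I. d i * C i k * a k j)"
        by (simp add: sum_distrib_left mult.assoc)
      also have "\<dots> = (\<Sum>k\<in>I. \<Sum>i\<in>J. d i * C i k * a k j)"
        by (rule sum.swap)
      finally have "(\<Sum>i\<in>J. d i * (\<Sum>k\<in>I. C i k * a k j)) = (\<Sum>k\<in>I. D d k * a k j)"
        by (simp add: D_def sum_distrib_right)
      with 1 show ?thesis
        by (simp add: right_diff_distrib sum_subtractf)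
    qed
    then have "vec_inner J (\<lambda>j. d j - (\<Sum>k\<in>I. D d k * a k j)) (a k)
        = vec_inner J (\<lambda>j. \<Sum>i\<in>J. d i * (e i j - (\<Sum>k\<in>I. C i k * a k j))) (a k)"
      by (intro vec_inner_cong) auto
    also have "\<dots> = 0"
      using C[OF that] by (simp add: vec_inner_sum_left)
    finally show ?thesis .
  qed
  have "vec_sqnorm L (\<lambda>l. \<Sum>j\<in>J. d j * V j l) \<le> vec_sqnorm J d" for d
  proof -
    let ?p = "\<lambda>j. \<Sum>k\<in>I. D d k * a k j"
    have "vec_inner J (\<lambda>j. d j - ?p j) ?p = 0"
      using orth by (simp add: vec_inner_sum_right)
    from vec_sqnorm_pythagoras[OF this]
    have "vec_sqnorm J d = vec_sqnorm J (\<lambda>j. d j - ?p j) + vec_sqnorm J ?p"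
      by simp
    then have "vec_sqnorm J ?p \<le> vec_sqnorm J d"
      using vec_sqnorm_nonneg[of J "\<lambda>j. d j - ?p j"] by linarith
    with le[of "D d"] show ?thesis
      by (simp only: V)
  qed
  moreover have "b k l = (\<Sum>j\<in>J. a k j * V j l)" if "k \<in> I" "l \<in> L" for k l
  proof -
    \<comment> \<open>The relation saying that \<open>a k\<close> equals its own projection. The
      corresponding combination of the \<open>a i\<close> has norm \<open>0\<close>, and
      \<open>le\<close> transfers the relation to the \<open>b i\<close>.\<close>
    define f where "f = (\<lambda>i. (if i = k then 1 else 0) - D (a k) i)"
    have f: "(\<Sum>i\<in>I. f i * h i) = h k - (\<Sum>i\<in>I. D (a k) i * h i)" for h :: "'a \<Rightarrow> complex"
    proof -
      have "(\<Sum>i\<in>I. (if i = k then 1 else 0) * h i) = (\<Sum>i\<in>I. if i = k then h k else 0)"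
        by (intro sum.cong) auto
      then show ?thesis
        using that(1) fin(1) by (simp add: f_def left_diff_distrib sum_subtractf)
    qed
    let ?r = "\<lambda>j. \<Sum>i\<in>I. f i * a i j"
    have "?r = (\<lambda>j. a k j - (\<Sum>i\<in>I. D (a k) i * a i j))"
      by (rule ext) (rule f)
    then have "vec_inner J ?r (a i) = 0" if "i \<in> I" for i
      using orth[OF that, of "a k"] by (simp only:)
    then have "vec_inner J ?r ?r = 0"
      by (subst vec_inner_sum_right) simp
    then have r0: "vec_sqnorm J ?r = 0"
      by (simp only: vec_inner_self of_real_eq_0_iff)
    have "vec_sqnorm L (\<lambda>l. \<Sum>i\<in>I. f i * b i l) = 0"
      by (rule antisym[OF le[of f, unfolded r0] vec_sqnorm_nonneg])
    then have "(\<Sum>i\<in>I. f i * b i l) = 0"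
      using that(2) unfolding vec_sqnorm_eq_0_iff[OF fin(3)] by (rule bspec)
    then have "b k l - (\<Sum>i\<in>I. D (a k) i * b i l) = 0"
      by (simp only: f)
    then show ?thesis
      by (simp only: V right_minus_eq)
  qed
  ultimately show ?thesis by blast
qed

text \<open>The row vector \<open>q (1 - t D)\<^sup>-\<^sup>1\<close> as a Neumann series: the
  contraction keeps \<open>q D\<^sup>r\<close> bounded, and \<open>|t| < 1\<close> makes the series
  converge.\<close>

lemma resolvent_exists:
  fixes D :: "'k \<Rightarrow> 'k \<Rightarrow> complex"
  assumes fin: "finite I" and contr: "\<And>d. vec_sqnorm I (\<lambda>k'. \<Sum>k\<in>I. d k * D k k') \<le> vec_sqnorm I d"
    and t: "cmod t < 1"
  shows "\<exists>h. \<forall>k'\<in>I. h k' = q k' + t * (\<Sum>k\<in>I. h k * D k k')"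
proof -
  define Q where "Q = rec_nat q (\<lambda>_ f k'. \<Sum>k\<in>I. f k * D k k')"
  have Q: "Q 0 = q" "Q (Suc r) = (\<lambda>k'. \<Sum>k\<in>I. Q r k * D k k')" for r
    by (simp_all add: Q_def)
  have le: "vec_sqnorm I (Q r) \<le> vec_sqnorm I q" for r
  proof (induction r)
    case (Suc r)
    with contr[of "Q r"] show ?case by (simp add: Q)
  qed (simp add: Q)
  have B: "cmod (Q r k) \<le> sqrt (vec_sqnorm I q)" if "k \<in> I" for r k
  proof -
    have "(cmod (Q r k))\<^sup>2 \<le> vec_sqnorm I (Q r)"
      unfolding vec_sqnorm_def using fin that by (intro member_le_sum) auto
    with le[of r] show ?thesis
      by (intro real_le_rsqrt) linarith
  qed
  have summ: "summable (\<lambda>r. t ^ r * Q r k)" if "k \<in> I" for k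
  proof (rule summable_comparison_test')
    show "summable (\<lambda>r. cmod t ^ r * sqrt (vec_sqnorm I q))"
      using t by (intro summable_mult2 summable_geometric) simp
    show "norm (t ^ r * Q r k) \<le> cmod t ^ r * sqrt (vec_sqnorm I q)" for r
      using B[OF that, of r] by (simp add: norm_mult norm_power mult_left_mono)
  qed
  define h where "h = (\<lambda>k. \<Sum>r. t ^ r * Q r k)"
  have "h k' = q k' + t * (\<Sum>k\<in>I. h k * D k k')" if "k' \<in> I" for k'
  proof -
    have "h k' = (\<Sum>r. t ^ Suc r * Q (Suc r) k') + t ^ 0 * Q 0 k'"
      unfolding h_def using suminf_split_head[OF summ[OF that]] by simp
    also have "(\<Sum>r. t ^ Suc r * Q (Suc r) k') = (\<Sum>r. \<Sum>k\<in>I. t * D k k' * (t ^ r * Q r k))"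
      by (simp add: Q(2) sum_distrib_left mult_ac)
    also have "\<dots> = (\<Sum>k\<in>I. \<Sum>r. t * D k k' * (t ^ r * Q r k))"
      using summ by (intro suminf_sum summable_mult)
    also have "\<dots> = (\<Sum>k\<in>I. t * D k k' * h k)"
      unfolding h_def using summ by (intro sum.cong refl suminf_mult)
    finally show ?thesis
      by (simp add: Q(1) sum_distrib_left mult_ac)
  qed
  then show ?thesis by blast
qed

text \<open>The difference \<open>d\<close> of two solutions satisfies \<open>d = t d D\<close>,
  which shrinks its norm by the factor \<open>|t|\<close>. This later recognises given Gram vectors
  as resolvent solutions.\<close>

lemma resolvent_unique:
  fixes D :: "'k \<Rightarrow> 'k \<Rightarrow> complex"
  assumes fin: "finite I" and contr: "\<And>d. vec_sqnorm I (\<lambda>k'. \<Sum>k\<in>I. d k * D k k') \<le> vec_sqnorm I d"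
    and t: "cmod t < 1"
    and h: "\<And>k'. k' \<in> I \<Longrightarrow> h k' = q k' + t * (\<Sum>k\<in>I. h k * D k k')"
    and g: "\<And>k'. k' \<in> I \<Longrightarrow> g k' = q k' + t * (\<Sum>k\<in>I. g k * D k k')"
    and "k \<in> I"
  shows "h k = g k"
proof -
  let ?d = "\<lambda>k. h k - g k"
  have "?d k' = t * (\<Sum>k\<in>I. ?d k * D k k')" if "k' \<in> I" for k'
    using h[OF that] g[OF that] by (simp add: left_diff_distrib sum_subtractf right_diff_distrib)
  then have "vec_sqnorm I ?d = vec_sqnorm I (\<lambda>k'. t * (\<Sum>k\<in>I. ?d k * D k k'))"
    by (intro vec_sqnorm_cong)
  also have "\<dots> \<le> (cmod t)\<^sup>2 * vec_sqnorm I ?d"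
    unfolding vec_sqnorm_scale using contr by (intro mult_left_mono) auto
  finally have "(1 - (cmod t)\<^sup>2) * vec_sqnorm I ?d \<le> 0"
    by (simp add: left_diff_distrib)
  moreover have "1 - (cmod t)\<^sup>2 > 0"
    using t by (simp add: power_less_one_iff)
  ultimately have "vec_sqnorm I ?d = 0"
    using vec_sqnorm_nonneg[of I ?d] by (simp add: mult_le_0_iff)
  then show ?thesis
    using vec_sqnorm_eq_0_iff[OF fin] \<open>k \<in> I\<close> by force
qed

section \<open>Gram kernels and the factorisation of positive matrices\<close>

lemma is_kernel_gram:
  fixes g :: "'a \<Rightarrow> 'j \<Rightarrow> complex"
  assumes "finite J"
  shows "is_kernel X (\<lambda>x y. \<Sum>j\<in>J. g x j * cnj (g y j))"
  unfolding is_kernel_def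
proof (intro allI impI)
  fix S and c :: "'a \<Rightarrow> complex"
  let ?v = "\<lambda>j. \<Sum>x\<in>S. cnj (c x) * g x j"
  have "vec_inner J ?v ?v = (\<Sum>x\<in>S. \<Sum>y\<in>S. cnj (c x) * c y * (\<Sum>j\<in>J. g x j * cnj (g y j)))"
    unfolding vec_inner_sum_left
    by (simp add: vec_inner_sum_right sum_distrib_left mult.assoc) (simp add: vec_inner_def sum_distrib_left mult.assoc)
  then show "0 \<le> (\<Sum>x\<in>S. \<Sum>y\<in>S. cnj (c x) * c y * (\<Sum>j\<in>J. g x j * cnj (g y j)))"
    using vec_sqnorm_nonneg[of J ?v] by (simp add: vec_inner_self less_eq_complex_def complex_eq_iff)
qed

lemma is_kernel_schur_complement:
  assumes k: "is_kernel (insert z I) P" and "P z z \<noteq> 0" "z \<notin> I"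
  shows "is_kernel I (\<lambda>x y. P x y - P x z * P z y / P z z)"
  unfolding is_kernel_def
proof (intro allI impI)
  fix S and c :: "'a \<Rightarrow> complex" assume S: "finite S \<and> S \<subseteq> I"
  define A where "A = (\<Sum>x\<in>S. \<Sum>y\<in>S. cnj (c x) * c y * P x y)"
  define B where "B = (\<Sum>y\<in>S. c y * P z y)"
  \<comment> \<open>The coefficient at \<open>z\<close> that minimises the form for given
    coefficients on \<open>S\<close>; the minimum is the form of the Schur complement.\<close>
  define c' where "c' = (\<lambda>x. if x = z then - B / P z z else c x)"
  have pz: "cnj (P z z) = P z z"
    using is_kernel_hermitian[OF k, of z z] by simp
  have zS: "z \<notin> S" using S assms(3) by blast
  have cB: "(\<Sum>x\<in>S. cnj (c x) * P x z) = cnj B"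
    unfolding B_def cnj_sum
  proof (intro sum.cong refl)
    fix x assume "x \<in> S"
    then show "cnj (c x) * P x z = cnj (c x * P z x)"
      using is_kernel_hermitian[OF k, of z x] S by auto
  qed
  have c'S: "c' x = c x" if "x \<in> S" for x
    using that zS by (auto simp: c'_def)
  have c'A: "(\<Sum>x\<in>S. \<Sum>y\<in>S. cnj (c' x) * c' y * P x y) = A"
    unfolding A_def using c'S by (intro sum.cong refl) simp
  have c'B: "(\<Sum>y\<in>S. c' y * P z y) = B"
    unfolding B_def using c'S by (intro sum.cong refl) simp
  have c'cB: "(\<Sum>x\<in>S. cnj (c' x) * P x z) = cnj B"
    unfolding cB[symmetric] using c'S by (intro sum.cong refl) simp
  have "0 \<le> (\<Sum>x\<in>insert z S. \<Sum>y\<in>insert z S. cnj (c' x) * c' y * P x y)"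
    using k[unfolded is_kernel_def, rule_format, of "insert z S" c'] S by blast
  also have "\<dots> = cnj (c' z) * c' z * P z z + cnj (c' z) * (\<Sum>y\<in>S. c' y * P z y)
      + ((\<Sum>x\<in>S. cnj (c' x) * P x z) * c' z + (\<Sum>x\<in>S. \<Sum>y\<in>S. cnj (c' x) * c' y * P x y))"
    using S zS by (simp add: sum.distrib sum_distrib_left sum_distrib_right mult_ac)
  also have "\<dots> = cnj (c' z) * c' z * P z z + cnj (c' z) * B + (cnj B * c' z + A)"
    by (simp only: c'A c'B c'cB)
  also have "\<dots> = A - cnj B * B / P z z"
    using assms(2) by (simp add: c'_def pz field_simps)
  also have "\<dots> = (\<Sum>x\<in>S. \<Sum>y\<in>S. cnj (c x) * c y * (P x y - P x z * P z y / P z z))"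
  proof -
    have "cnj B * B / P z z = (\<Sum>x\<in>S. \<Sum>y\<in>S. cnj (c x) * c y * (P x z * P z y / P z z))"
      unfolding cB[symmetric] unfolding B_def sum_product sum_divide_distrib
      by (simp add: mult_ac)
    then show ?thesis
      by (simp add: A_def right_diff_distrib sum_subtractf)
  qed
  finally show "0 \<le> (\<Sum>x\<in>S. \<Sum>y\<in>S. cnj (c x) * c y * (P x y - P x z * P z y / P z z))" .
qed

lemma is_kernel_subset: "is_kernel X K \<Longrightarrow> Y \<subseteq> X \<Longrightarrow> is_kernel Y K"
  unfolding is_kernel_def by blast

text \<open>Cholesky factorisation, one point at a time. Coordinates are indexed by the points
  themselves, so the rank never has to be determined.\<close>

lemma gram_representation:
  assumes "finite I" "is_kernel I P"
  shows "\<exists>g. \<forall>x\<in>I. \<forall>y\<in>I. P x y = (\<Sum>l\<in>I. g x l * cnj (g y l))"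
  using assms
proof (induction I arbitrary: P)
  case empty
  then show ?case by simp
next
  case (insert z I)
  show ?case
  proof (cases "P z z = 0")
    \<comment> \<open>By Cauchy-Schwarz the whole row and column of \<open>z\<close> vanish, so
      \<open>z\<close> receives the zero vector.\<close>
    case True
    have zero: "P x z = 0 \<and> P z x = 0" if "x \<in> insert z I" for x
      using is_kernel_Cauchy_Schwarz[OF insert.prems that, of z] is_kernel_hermitian[OF insert.prems that, of z]
        True by simp
    have "is_kernel I P"
      using insert.prems by (rule is_kernel_subset) auto
    from insert.IH[OF this]
    obtain g where g: "\<And>x y. x \<in> I \<Longrightarrow> y \<in> I \<Longrightarrow> P x y = (\<Sum>l\<in>I. g x l * cnj (g y l))"
      by blast
    define g' where "g' = (\<lambda>x l. if x = z \<or> l = z then 0 else g x l)"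
    have "P x y = (\<Sum>l\<in>insert z I. g' x l * cnj (g' y l))" if "x \<in> insert z I" "y \<in> insert z I" for x y
    proof (cases "x = z \<or> y = z")
      case True
      then show ?thesis
        using zero[OF that(1)] zero[OF that(2)] by (auto simp: g'_def)
    next
      case False
      have "(\<Sum>l\<in>insert z I. g' x l * cnj (g' y l)) = (\<Sum>l\<in>I. g' x l * cnj (g' y l))"
        using insert.hyps by (simp add: g'_def)
      also have "\<dots> = (\<Sum>l\<in>I. g x l * cnj (g y l))"
        using False insert.hyps by (intro sum.cong) (auto simp: g'_def)
      finally show ?thesis
        using g that False by auto
    qed
    then show ?thesis by blast
  next
    case False
    obtain g where g: "\<And>x y. x \<in> I \<Longrightarrow> y \<in> I \<Longrightarrow> P x y - P x z * P z y / P z z = (\<Sum>l\<in>I. g x l * cnj (g y l))"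
      using insert.IH[OF is_kernel_schur_complement[OF insert.prems False insert.hyps(2)]] by blast
    define p where "p = sqrt (Re (P z z))"
    have "0 \<le> P z z" by (rule is_kernel_diag_nonneg[OF insert.prems]) simp
    then have pz: "P z z = complex_of_real (Re (P z z))" "Re (P z z) \<ge> 0"
      by (auto simp: less_eq_complex_def complex_eq_iff)
    have pp: "complex_of_real p * complex_of_real p = P z z"
      unfolding p_def using pz by (metis of_real_mult real_sqrt_mult_self abs_of_nonneg)
    then have p0: "complex_of_real p \<noteq> 0" using False by auto
    \<comment> \<open>Coordinate \<open>z\<close> produces the rank-one part that the Schur
      complement removes; the vector of \<open>z\<close> has no other coordinate.\<close>
    define g' where "g' = (\<lambda>x l. if l = z then P x z / complex_of_real p else if x = z then 0 else g x l)"
    have "P x y = (\<Sum>l\<in>insert z I. g' x l * cnj (g' y l))" if xy: "x \<in> insert z I" "y \<in> insert z I" for x y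
    proof -
      have "g' x z * cnj (g' y z) = P x z * P z y / P z z"
        using is_kernel_hermitian[OF insert.prems xy(2), of z] by (simp add: g'_def pp[symmetric])
      moreover have "(\<Sum>l\<in>I. g' x l * cnj (g' y l)) = P x y - P x z * P z y / P z z"
      proof (cases "x = z \<or> y = z")
        case True
        have "(\<Sum>l\<in>I. g' x l * cnj (g' y l)) = 0"
          using True insert.hyps by (intro sum.neutral) (auto simp: g'_def)
        then show ?thesis using True False by auto
      next
        case False
        have "(\<Sum>l\<in>I. g' x l * cnj (g' y l)) = (\<Sum>l\<in>I. g x l * cnj (g y l))"
          using False insert.hyps by (intro sum.cong) (auto simp: g'_def)
        then show ?thesis using g xy False by auto
      qed
      ultimately show ?thesis
        using insert.hyps by simp
    qed
    then show ?thesis by blast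
  qed
qed

subsection \<open>Matrix interpolation for the Szego kernel\<close>

lemma is_kernel_add:
  assumes "is_kernel X K" "is_kernel X L"
  shows "is_kernel X (\<lambda>x y. K x y + L x y)"
  using assms unfolding is_kernel_def by (simp add: distrib_left sum.distrib)

text \<open>A geometric series, each term of which is \<open>N\<close> rescaled by a power of
  \<open>v\<close>.\<close>

lemma is_kernel_div_szego:
  assumes k: "is_kernel X N" and v: "\<And>x. x \<in> X \<Longrightarrow> cmod (v x) < 1"
  shows "is_kernel X (\<lambda>x y. N x y / (1 - v x * cnj (v y)))"
  unfolding is_kernel_def
proof (intro allI impI)
  fix S and c :: "'a \<Rightarrow> complex" assume S: "finite S \<and> S \<subseteq> X"
  let ?f = "\<lambda>r. \<Sum>x\<in>S. \<Sum>y\<in>S. cnj (c x) * c y * N x y * (v x * cnj (v y)) ^ r"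
  have "(\<lambda>r. (v x * cnj (v y)) ^ r) sums (1 / (1 - v x * cnj (v y)))" if "x \<in> S" "y \<in> S" for x y
  proof (rule geometric_sums)
    have "cmod (v x) < 1" "cmod (v y) < 1" using v S that by auto
    then have "cmod (v x) * cmod (v y) < 1"
      using mult_le_one[of "cmod (v x)" "cmod (v y)"] mult_strict_mono[of "cmod (v x)" 1 "cmod (v y)" 1] by simp
    then show "norm (v x * cnj (v y)) < 1" by (simp add: norm_mult)
  qed
  then have sm: "?f sums (\<Sum>x\<in>S. \<Sum>y\<in>S. cnj (c x) * c y * N x y * (1 / (1 - v x * cnj (v y))))"
    by (intro sums_sum sums_mult)
  have pos: "0 \<le> ?f r" for r
  proof -
    have "?f r = (\<Sum>x\<in>S. \<Sum>y\<in>S. cnj (c x * cnj (v x) ^ r) * (c y * cnj (v y) ^ r) * N x y)"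
      by (simp add: power_mult_distrib mult_ac)
    also have "0 \<le> \<dots>"
      by (rule k[unfolded is_kernel_def, rule_format, OF S])
    finally show ?thesis .
  qed
  have "0 \<le> Re (\<Sum>x\<in>S. \<Sum>y\<in>S. cnj (c x) * c y * N x y * (1 / (1 - v x * cnj (v y))))"
    using sums_le[OF _ sums_zero sums_Re[OF sm]] Re_nonneg_complex[OF pos] by blast
  moreover have "Im (\<Sum>x\<in>S. \<Sum>y\<in>S. cnj (c x) * c y * N x y * (1 / (1 - v x * cnj (v y)))) = 0"
    using sums_Im[OF sm] by (simp only: Im_nonneg_complex[OF pos] sums_0 sums_iff suminf_zero)
  ultimately show "0 \<le> (\<Sum>x\<in>S. \<Sum>y\<in>S. cnj (c x) * c y * (N x y / (1 - v x * cnj (v y))))"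
    by (simp add: less_eq_complex_def)
qed

section \<open>Direct sums and the colligation of the lurking isometry\<close>

lemma vec_inner_Plus:
  assumes "finite A" "finite B"
  shows "vec_inner (A <+> B) f g = vec_inner A (\<lambda>j. f (Inl j)) (\<lambda>j. g (Inl j)) + vec_inner B (\<lambda>j. f (Inr j)) (\<lambda>j. g (Inr j))"
  using assms by (simp add: vec_inner_def sum.Plus)

lemma vec_sqnorm_Plus:
  assumes "finite A" "finite B"
  shows "vec_sqnorm (A <+> B) f = vec_sqnorm A (\<lambda>j. f (Inl j)) + vec_sqnorm B (\<lambda>j. f (Inr j))"
  using assms by (simp add: vec_sqnorm_def sum.Plus)

lemma vec_sqnorm_sum:
  "complex_of_real (vec_sqnorm J (\<lambda>j. \<Sum>p\<in>T. c p * a p j)) = (\<Sum>p\<in>T. \<Sum>q\<in>T. c p * cnj (c q) * vec_inner J (a p) (a q))"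
  unfolding vec_inner_self[symmetric] vec_inner_sum_left vec_inner_sum_right
  by (simp add: sum_distrib_left mult_ac)

text \<open>The vectors \<open>e\<^sub>i \<oplus> u(x) g(x, i)\<close>;
  \<open>colligation_out\<close> has row \<open>i\<close> of \<open>a(x)\<close> in place of
  \<open>e\<^sub>i\<close> and no factor \<open>u(x)\<close>. If \<open>g\<close> are Gram vectors
  of the Pick matrix, clearing its denominators says that both families have the same Gram
  matrix.\<close>

definition colligation_in :: "('a \<Rightarrow> complex) \<Rightarrow> ('a \<times> nat \<Rightarrow> 'k \<Rightarrow> complex) \<Rightarrow> 'a \<times> nat \<Rightarrow> nat + 'k \<Rightarrow> complex" where
  "colligation_in u g = (\<lambda>(x, i). case_sum (\<lambda>i'. if i' = i then 1 else 0) (\<lambda>k. u x * g (x, i) k))"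

definition colligation_out :: "('a \<Rightarrow> nat \<Rightarrow> nat \<Rightarrow> complex) \<Rightarrow> ('a \<times> nat \<Rightarrow> 'k \<Rightarrow> complex) \<Rightarrow> 'a \<times> nat \<Rightarrow> nat + 'k \<Rightarrow> complex" where
  "colligation_out a g = (\<lambda>(x, i). case_sum (a x i) (g (x, i)))"

lemma vec_inner_colligation_in:
  fixes i j m :: nat
  assumes "finite I" "i < m" "j < m"
  shows "vec_inner ({..<m} <+> I) (colligation_in u g (x, i)) (colligation_in u g (y, j))
    = (if i = j then 1 else 0) + u x * cnj (u y) * vec_inner I (g (x, i)) (g (y, j))"
proof -
  have "vec_inner {..<m} (\<lambda>i'. if i' = i then 1 else 0) (\<lambda>i'. if i' = j then 1 else 0)
      = (\<Sum>i'<m. if i' = i then (if i = j then 1 else 0) else 0)"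
    unfolding vec_inner_def by (intro sum.cong) auto
  then have "vec_inner {..<m} (\<lambda>i'. if i' = i then 1 else 0) (\<lambda>i'. if i' = j then 1 else 0) = (if i = j then 1 else 0)"
    using assms by simp
  moreover have "vec_inner I (\<lambda>k. u x * g (x, i) k) (\<lambda>k. u y * g (y, j) k) = u x * cnj (u y) * vec_inner I (g (x, i)) (g (y, j))"
    by (simp add: vec_inner_def sum_distrib_left mult_ac)
  ultimately show ?thesis
    using assms(1) by (simp add: vec_inner_Plus colligation_in_def)
qed

lemma vec_inner_colligation_out:
  assumes "finite I"
  shows "vec_inner ({..<n} <+> I) (colligation_out a g (x, i)) (colligation_out a g (y, j))
    = (\<Sum>l<n. a x i l * cnj (a y j l)) + vec_inner I (g (x, i)) (g (y, j))"
  using assms by (simp add: vec_inner_Plus colligation_out_def) (simp add: vec_inner_def)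

lemma szego_denominator_nonzero:
  assumes "cmod a < 1" "cmod b < 1"
  shows "1 - a * cnj b \<noteq> 0"
proof
  assume "1 - a * cnj b = 0"
  then have "cmod (a * cnj b) = 1" by simp
  then show False
    using assms mult_strict_mono[of "cmod a" 1 "cmod b" 1] by (simp add: norm_mult)
qed

text \<open>Transfer function realisation: the map from \<open>colligation_in\<close> to
  \<open>colligation_out\<close> at the data extends to a contraction \<open>V\<close>, the
  resolvent of its block \<open>D\<close> supplies state vectors \<open>H\<close> on all of
  \<open>X\<close>, and these determine the interpolant \<open>a\<close>. Contractivity of
  \<open>V\<close> makes the block kernel of \<open>a\<close> positive.\<close>

lemma szego_interpolation:
  fixes u :: "'a \<Rightarrow> complex" and w :: "'a \<Rightarrow> nat \<Rightarrow> nat \<Rightarrow> complex" and m n :: nat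
  assumes u: "\<And>x. x \<in> X \<Longrightarrow> cmod (u x) < 1" and S: "finite S" "S \<subseteq> X"
    and pick: "is_kernel (S \<times> {..<m}) (mult_kernel n w (K_fun u))"
  shows "\<exists>a. (\<forall>x\<in>S. \<forall>i<m. \<forall>l<n. a x i l = w x i l) \<and> is_kernel (X \<times> {..<m}) (mult_kernel n a (K_fun u))"
proof -
  define I where "I = S \<times> {..<m}"
  have I: "finite I" using S by (simp add: I_def)
  obtain g where g: "\<And>p q. p \<in> I \<Longrightarrow> q \<in> I \<Longrightarrow> mult_kernel n w (K_fun u) p q = vec_inner I (g p) (g q)"
    using gram_representation[OF I pick[folded I_def]] unfolding vec_inner_def by blast
  let ?J = "{..<m} <+> I" and ?L = "{..<n} <+> I"
  have J: "finite ?J" and L: "finite ?L" using I by auto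
  have isometry: "vec_inner ?L (colligation_out w g p) (colligation_out w g q)
      = vec_inner ?J (colligation_in u g p) (colligation_in u g q)" if pq: "p \<in> I" "q \<in> I" for p q
  proof -
    obtain x i y j where *: "p = (x, i)" "q = (y, j)" "x \<in> S" "y \<in> S" "i < m" "j < m"
      using pq by (auto simp: I_def)
    have "1 - u x * cnj (u y) \<noteq> 0"
      using u S * by (intro szego_denominator_nonzero) auto
    then have "(if i = j then 1 else 0) - (\<Sum>l<n. w x i l * cnj (w y j l))
        = (1 - u x * cnj (u y)) * vec_inner I (g (x, i)) (g (y, j))"
      using g[OF pq] by (simp add: * mult_kernel_def K_fun_def field_simps)
    then show ?thesis
      using * I by (simp add: vec_inner_colligation_in vec_inner_colligation_out algebra_simps)
  qed
  have "vec_sqnorm ?L (\<lambda>l. \<Sum>k\<in>I. c k * colligation_out w g k l) \<le> vec_sqnorm ?J (\<lambda>j. \<Sum>k\<in>I. c k * colligation_in u g k j)" for c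
  proof -
    have "complex_of_real (vec_sqnorm ?L (\<lambda>l. \<Sum>k\<in>I. c k * colligation_out w g k l))
        = complex_of_real (vec_sqnorm ?J (\<lambda>j. \<Sum>k\<in>I. c k * colligation_in u g k j))"
      unfolding vec_sqnorm_sum using isometry by (intro sum.cong refl) simp
    then show ?thesis by (simp only: of_real_eq_iff)
  qed
  from contraction_extension[OF I J L this]
  obtain V where V: "\<And>d. vec_sqnorm ?L (\<lambda>l. \<Sum>j\<in>?J. d j * V j l) \<le> vec_sqnorm ?J d"
    and Vg: "\<And>k l. k \<in> I \<Longrightarrow> l \<in> ?L \<Longrightarrow> colligation_out w g k l = (\<Sum>j\<in>?J. colligation_in u g k j * V j l)"
    by blast
  have in_sum: "(\<Sum>j\<in>?J. colligation_in u h (x, i) j * V j l) = V (Inl i) l + u x * (\<Sum>k\<in>I. h (x, i) k * V (Inr k) l)"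
    if "i < m" for h x i l
  proof -
    have "(\<Sum>i'<m. (if i' = i then 1 else 0) * V (Inl i') l) = (\<Sum>i'<m. if i' = i then V (Inl i) l else 0)"
      by (intro sum.cong) auto
    then show ?thesis
      using that I by (simp add: sum.Plus colligation_in_def sum_distrib_left mult.assoc)
  qed
  define D where "D = (\<lambda>k k'. V (Inr k) (Inr k'))"
  \<comment> \<open>A corner of a contraction: inputs are padded with \<open>0\<close> and output
    coordinates are dropped.\<close>
  have D: "vec_sqnorm I (\<lambda>k'. \<Sum>k\<in>I. d k * D k k') \<le> vec_sqnorm I d" for d
  proof -
    let ?d = "case_sum (\<lambda>_. 0) d :: nat + 'a \<times> nat \<Rightarrow> complex"
    have "(\<Sum>j\<in>?J. ?d j * V j (Inr k')) = (\<Sum>k\<in>I. d k * D k k')" for k'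
      using I by (simp add: sum.Plus D_def)
    then have "vec_sqnorm I (\<lambda>k'. \<Sum>k\<in>I. d k * D k k') = vec_sqnorm I (\<lambda>k'. \<Sum>j\<in>?J. ?d j * V j (Inr k'))"
      by (simp only:)
    also have "\<dots> \<le> vec_sqnorm ?L (\<lambda>l. \<Sum>j\<in>?J. ?d j * V j l)"
      by (simp only: vec_sqnorm_Plus[OF finite_lessThan I] le_add_same_cancel2 vec_sqnorm_nonneg)
    also have "\<dots> \<le> vec_sqnorm ?J ?d"
      by (rule V)
    also have "\<dots> = vec_sqnorm I d"
      by (simp add: vec_sqnorm_Plus[OF finite_lessThan I]) (simp add: vec_sqnorm_def)
    finally show ?thesis .
  qed
  have "\<exists>h. \<forall>k'\<in>I. h k' = V (Inl (snd p)) (Inr k') + u (fst p) * (\<Sum>k\<in>I. h k * D k k')" if "p \<in> X \<times> {..<m}" for p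
    using that u by (intro resolvent_exists[OF I D]) auto
  then have "\<forall>p\<in>X \<times> {..<m}. \<exists>h. \<forall>k'\<in>I. h k' = V (Inl (snd p)) (Inr k') + u (fst p) * (\<Sum>k\<in>I. h k * D k k')"
    by blast
  from bchoice[OF this] obtain H where H': "\<forall>p\<in>X \<times> {..<m}. \<forall>k'\<in>I.
      H p k' = V (Inl (snd p)) (Inr k') + u (fst p) * (\<Sum>k\<in>I. H p k * D k k')" ..
  have H: "H (x, i) k' = V (Inl i) (Inr k') + u x * (\<Sum>k\<in>I. H (x, i) k * D k k')"
    if "x \<in> X" "i < m" "k' \<in> I" for x i k'
    using H'[rule_format, of "(x, i)" k'] that by simp
  \<comment> \<open>With \<open>V\<close> in blocks \<open>A\<close>, \<open>B\<close>,
    \<open>C\<close>, \<open>D\<close> acting on row vectors, this is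
    \<open>A + u(x) B (1 - u(x) D)\<^sup>-\<^sup>1 C\<close>.\<close>
  define a where "a = (\<lambda>x i l. V (Inl i) (Inl l) + u x * (\<Sum>k\<in>I. H (x, i) k * V (Inr k) (Inl l)))"
  have out: "colligation_out a H p l = (\<Sum>j\<in>?J. colligation_in u H p j * V j l)" if "p \<in> X \<times> {..<m}" "l \<in> ?L" for p l
  proof -
    obtain x i where p: "p = (x, i)" "x \<in> X" "i < m" using \<open>p \<in> X \<times> {..<m}\<close> by auto
    from \<open>l \<in> ?L\<close> show ?thesis
    proof
      fix l' assume l: "l = Inl l'"
      show ?thesis
        by (simp only: p(1) l in_sum[OF p(3)] colligation_out_def a_def prod.case sum.case)
    next
      fix k' assume l: "l = Inr k'" "k' \<in> I"
      show ?thesis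
        by (simp only: p(1) l(1) in_sum[OF p(3)] colligation_out_def prod.case sum.case D_def)
           (rule H[OF p(2,3) l(2), unfolded D_def])
    qed
  qed
  have agree: "a x i l = w x i l" if "x \<in> S" "i < m" "l < n" for x i l
  proof -
    have p: "(x, i) \<in> I" "x \<in> X" using that S by (auto simp: I_def)
    \<comment> \<open>At the data points the Gram vectors solve the same resolvent equation, by the
      choice of \<open>V\<close>.\<close>
    have "H (x, i) k = g (x, i) k" if "k \<in> I" for k
    proof (rule resolvent_unique[OF I D u[OF \<open>x \<in> X\<close>] _ _ that])
      show "H (x, i) k' = V (Inl i) (Inr k') + u x * (\<Sum>k\<in>I. H (x, i) k * D k k')" if "k' \<in> I" for k'
        by (rule H[OF p(2) \<open>i < m\<close> that])
      show "g (x, i) k' = V (Inl i) (Inr k') + u x * (\<Sum>k\<in>I. g (x, i) k * D k k')" if "k' \<in> I" for k'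
      proof -
        have "Inr k' \<in> ?L" using that by (rule InrI)
        from Vg[OF p(1) this] show ?thesis
          by (simp only: in_sum[OF \<open>i < m\<close>] colligation_out_def prod.case sum.case D_def)
      qed
    qed
    then have "a x i l = V (Inl i) (Inl l) + u x * (\<Sum>k\<in>I. g (x, i) k * V (Inr k) (Inl l))"
      by (simp add: a_def)
    also have "\<dots> = w x i l"
    proof -
      have "Inl l \<in> ?L" using that by (intro InlI) simp
      from Vg[OF p(1) this] show ?thesis
        by (simp only: in_sum[OF \<open>i < m\<close>] colligation_out_def prod.case sum.case)
    qed
    finally show ?thesis .
  qed
  \<comment> \<open>The defect of \<open>V\<close> on the inputs. It equals the identity minus
    \<open>a\<close> times its adjoint, minus \<open>(1 - u x * cnj (u y))\<close> times the Gram
    kernel of \<open>H\<close>; dividing by that factor and adding the Gram kernel recovers the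
    block kernel of \<open>a\<close>.\<close>
  define N where "N = (\<lambda>p q. vec_inner ?J (colligation_in u H p) (colligation_in u H q)
      - vec_inner ?L (colligation_out a H p) (colligation_out a H q))"
  have "is_kernel (X \<times> {..<m}) N"
    unfolding is_kernel_def
  proof (intro allI impI)
    fix T and c :: "'a \<times> nat \<Rightarrow> complex" assume T: "finite T \<and> T \<subseteq> X \<times> {..<m}"
    let ?d = "\<lambda>j. \<Sum>p\<in>T. cnj (c p) * colligation_in u H p j"
    let ?o = "\<lambda>l. \<Sum>p\<in>T. cnj (c p) * colligation_out a H p l"
    have "?o l = (\<Sum>j\<in>?J. ?d j * V j l)" if "l \<in> ?L" for l
    proof -
      have "?o l = (\<Sum>p\<in>T. \<Sum>j\<in>?J. cnj (c p) * colligation_in u H p j * V j l)"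
        using T out[OF _ that] by (intro sum.cong refl) (auto simp: sum_distrib_left mult.assoc)
      also have "\<dots> = (\<Sum>j\<in>?J. \<Sum>p\<in>T. cnj (c p) * colligation_in u H p j * V j l)"
        by (rule sum.swap)
      finally show ?thesis by (simp add: sum_distrib_right)
    qed
    then have "vec_sqnorm ?L ?o = vec_sqnorm ?L (\<lambda>l. \<Sum>j\<in>?J. ?d j * V j l)"
      by (intro vec_sqnorm_cong)
    then have le: "vec_sqnorm ?L ?o \<le> vec_sqnorm ?J ?d"
      using V[of ?d] by simp
    have "(\<Sum>p\<in>T. \<Sum>q\<in>T. cnj (c p) * c q * N p q) = complex_of_real (vec_sqnorm ?J ?d - vec_sqnorm ?L ?o)"
      unfolding of_real_diff vec_sqnorm_sum N_def by (simp add: right_diff_distrib sum_subtractf)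
    then show "0 \<le> (\<Sum>p\<in>T. \<Sum>q\<in>T. cnj (c p) * c q * N p q)"
      using le by (simp add: less_eq_complex_def)
  qed
  then have "is_kernel (X \<times> {..<m}) (\<lambda>p q. N p q / (1 - u (fst p) * cnj (u (fst q))))"
    using u by (intro is_kernel_div_szego) auto
  moreover have "is_kernel (X \<times> {..<m}) (\<lambda>p q. vec_inner I (H p) (H q))"
    unfolding vec_inner_def by (rule is_kernel_gram[OF I])
  ultimately have "is_kernel (X \<times> {..<m}) (\<lambda>p q. N p q / (1 - u (fst p) * cnj (u (fst q))) + vec_inner I (H p) (H q))"
    by (rule is_kernel_add)
  also have "?this \<longleftrightarrow> is_kernel (X \<times> {..<m}) (mult_kernel n a (K_fun u))"
  proof (rule is_kernel_cong)
    fix p q assume "p \<in> X \<times> {..<m}" "q \<in> X \<times> {..<m}"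
    then obtain x i y j where *: "p = (x, i)" "q = (y, j)" "x \<in> X" "y \<in> X" "i < m" "j < m"
      by auto
    have "1 - u x * cnj (u y) \<noteq> 0"
      using u * by (intro szego_denominator_nonzero) auto
    then show "N p q / (1 - u (fst p) * cnj (u (fst q))) + vec_inner I (H p) (H q) = mult_kernel n a (K_fun u) p q"
      using * I
      by (simp add: N_def vec_inner_colligation_in vec_inner_colligation_out mult_kernel_def K_fun_def)
         (simp add: field_simps)
  qed
  finally show ?thesis using agree by blast
qed

text \<open>Agreement with the Szego kernel is asked for on \<open>X\<close> alone, since
  \<open>\<phi> = \<lambda> u\<close> is known only there.\<close>

lemma CNP_kernel_szego:
  assumes u: "\<And>x. x \<in> X \<Longrightarrow> cmod (u x) < 1"
    and k: "\<And>x y. x \<in> X \<Longrightarrow> y \<in> X \<Longrightarrow> k x y = K_fun u x y"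
  shows "CNP_kernel X k"
proof -
  have "is_kernel X (\<lambda>x y. (\<Sum>j\<in>{()}. 1 * cnj 1) / (1 - u x * cnj (u y)))"
    by (rule is_kernel_div_szego[OF is_kernel_gram u]) auto
  also have "?this \<longleftrightarrow> is_kernel X k"
    by (rule is_kernel_cong) (simp add: k K_fun_def)
  finally have ker: "is_kernel X k" .
  have mk: "mult_kernel n a (K_fun u) p q = mult_kernel n b k p q"
    if "p \<in> X \<times> {..<m}" "q \<in> X \<times> {..<m}" "\<And>x i l. x \<in> fst ` {p, q} \<Longrightarrow> i < m \<Longrightarrow> l < n \<Longrightarrow> a x i l = b x i l"
    for m n :: nat and a b p q
    using that by (auto simp: mult_kernel_def k)
  have "\<exists>\<Phi>. contractive_matrix_multiplier X k m n \<Phi> \<and> (\<forall>x\<in>S. \<Phi> x = W x)"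
    if S: "finite S" "S \<subseteq> X" and W: "\<And>x. x \<in> S \<Longrightarrow> W x \<in> carrier_mat m n"
      and pick: "is_kernel (S \<times> {..<m}) (\<lambda>(x, i) (y, j). (1\<^sub>m m - W x * mat_adjoint (W y)) $$ (i, j) * k x y)"
    for m n S W
  proof -
    note pick
    also have "is_kernel (S \<times> {..<m}) (\<lambda>(x, i) (y, j). (1\<^sub>m m - W x * mat_adjoint (W y)) $$ (i, j) * k x y)
        \<longleftrightarrow> is_kernel (S \<times> {..<m}) (mult_kernel n (\<lambda>x i l. W x $$ (i, l)) k)"
      by (rule is_kernel_mult_kernel_iff) (rule W)
    also have "\<dots> \<longleftrightarrow> is_kernel (S \<times> {..<m}) (mult_kernel n (\<lambda>x i l. W x $$ (i, l)) (K_fun u))"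
      by (rule is_kernel_cong) (rule mk[symmetric], use S in auto)
    finally have pick': "is_kernel (S \<times> {..<m}) (mult_kernel n (\<lambda>x i l. W x $$ (i, l)) (K_fun u))" .
    have "\<exists>a. (\<forall>x\<in>S. \<forall>i<m. \<forall>l<n. a x i l = W x $$ (i, l)) \<and> is_kernel (X \<times> {..<m}) (mult_kernel n a (K_fun u))"
      using u S pick' by (rule szego_interpolation)
    then obtain a where a: "\<And>x i l. x \<in> S \<Longrightarrow> i < m \<Longrightarrow> l < n \<Longrightarrow> a x i l = W x $$ (i, l)"
      and ak: "is_kernel (X \<times> {..<m}) (mult_kernel n a (K_fun u))"
      by blast
    define \<Phi> where "\<Phi> = (\<lambda>x. mat m n (\<lambda>(i, l). a x i l))"
    have "is_kernel (X \<times> {..<m}) (mult_kernel n a (K_fun u))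
        \<longleftrightarrow> is_kernel (X \<times> {..<m}) (mult_kernel n (\<lambda>x i l. \<Phi> x $$ (i, l)) k)"
      by (rule is_kernel_cong) (rule mk, auto simp: \<Phi>_def)
    with ak have "contractive_matrix_multiplier X k m n \<Phi>"
      by (intro contractive_matrix_multiplierI[OF ker]) (auto simp: \<Phi>_def)
    moreover have "\<Phi> x = W x" if "x \<in> S" for x
      using W[OF that] a[OF that] by (intro eq_matI) (auto simp: \<Phi>_def)
    ultimately show ?thesis by blast
  qed
  with ker show ?thesis
    unfolding CNP_kernel_def by blast
qed

subsection \<open>Necessity in the characterisation of normalised CNP kernels\<close>

text \<open>The difference of the unit vectors at \<open>p\<close> and \<open>q\<close> is a null
  vector of the form, and by Cauchy-Schwarz a null vector is orthogonal to everything.\<close>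

lemma is_kernel_equal_columns:
  assumes k: "is_kernel Y L" and "p \<in> Y" "q \<in> Y" "r \<in> Y"
    and null: "L p p - L p q - (L q p - L q q) = 0"
  shows "L r p = L r q"
proof -
  let ?e = "\<lambda>y x. if x = y then 1 else 0 :: complex"
  let ?c = "\<lambda>x. ?e p x - ?e q x"
  have c: "?c \<in> fin_coeffs Y"
    by (rule fin_coeffs_diff[OF single_in_fin_coeffs[OF assms(2)] single_in_fin_coeffs[OF assms(3)]])
  have comb: "kernel_comb Y L ?c x = L x p - L x q" if "x \<in> Y" for x
    using that by (simp only: kernel_comb_diff[OF single_in_fin_coeffs[OF assms(2)] single_in_fin_coeffs[OF assms(3)]]
        kernel_comb_single if_True)
  have "pairing (kernel_comb Y L ?c) ?c = kernel_comb Y L ?c p - kernel_comb Y L ?c q"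
    by (simp only: pairing_diff_right[OF single_in_fin_coeffs[OF assms(2)] single_in_fin_coeffs[OF assms(3)]] pairing_single)
  then have "comb_norm Y L ?c = 0"
    using null by (simp only: comb_norm_def comb[OF assms(2)] comb[OF assms(3)]) simp
  then have "cmod (pairing (kernel_comb Y L ?c) (?e r)) \<le> 0"
    using pairing_Cauchy_Schwarz[OF k c single_in_fin_coeffs[OF assms(4)]] by simp
  then show ?thesis
    by (simp only: pairing_single comb[OF assms(4)]) simp
qed

lemma mult_kernel_row:
  "mult_kernel n a K (x, 0) (y, 0) = (1 - (\<Sum>l<n. a x 0 l * cnj (a y 0 l))) * K x y"
  by (simp add: mult_kernel_def)

text \<open>One point \<open>z\<close> is added at a time.  The Gram vectors found so far are row-matrix data whose Pick
  matrix consists of ones, so positivity forces the Pick matrix of an interpolant \<open>\<Phi>\<close> to be constant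
  in the row of \<open>z\<close> as well, and \<open>\<Phi> z\<close> is the new Gram vector up to an additional coordinate.\<close>

lemma CNP_kernel_gram:
  assumes cnp: "CNP_kernel X k" and w: "w \<in> X" and norm: "\<And>x. x \<in> X \<Longrightarrow> k x w = 1"
    and T: "finite T" "T \<subseteq> X"
  shows "\<exists>n::nat\<ge>1. \<exists>b. \<forall>x\<in>insert w T. \<forall>y\<in>insert w T.
    k x y \<noteq> 0 \<and> 1 - 1 / k x y = (\<Sum>l<n. b x l * cnj (b y l))"
  using T
proof (induction T)
  case empty
  show ?case
    \<comment> \<open>The vector of \<open>w\<close> is \<open>0\<close> because
      \<open>k w w = 1\<close>; it is given one coordinate since interpolation data need
      \<open>n \<ge> 1\<close>.\<close>
    using norm[OF w] by (intro exI[of _ 1] conjI exI[of _ "\<lambda>_ _. 0"]) auto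
next
  case (insert z T)
  have ker: "is_kernel X k"
    using cnp by (simp add: CNP_kernel_def)
  have "T \<subseteq> X" using insert.prems by simp
  from insert.IH[OF this] obtain n :: nat and b where n: "n \<ge> 1" and b0: "\<forall>x\<in>insert w T. \<forall>y\<in>insert w T.
      k x y \<noteq> 0 \<and> 1 - 1 / k x y = (\<Sum>l<n. b x l * cnj (b y l))"
    by (elim exE conjE)
  have b: "k x y \<noteq> 0 \<and> 1 - 1 / k x y = (\<Sum>l<n. b x l * cnj (b y l))"
    if "x \<in> insert w T" "y \<in> insert w T" for x y
    using bspec[OF bspec[OF b0 that(1)] that(2)] .
  have b1: "(1 - (\<Sum>l<n. b x l * cnj (b y l))) * k x y = 1"
    if "x \<in> insert w T" "y \<in> insert w T" for x y
    using b[OF that, THEN conjunct1] by (simp only: b[OF that, THEN conjunct2, symmetric]) simp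
  show ?case
  proof (cases "z = w")
    case True
    then have "insert w (insert z T) = insert w T" by blast
    with n b0 show ?thesis by (intro exI[of _ n] conjI exI[of _ b]) (simp_all only:)
  next
    case False
    let ?S = "insert w T"
    have S: "finite ?S" "?S \<subseteq> X" and z: "z \<in> X" "z \<notin> ?S"
      using insert w False by auto
    define W where "W = (\<lambda>x. mat 1 n (\<lambda>(i, l). b x l))"
    have W: "W x \<in> carrier_mat 1 n" for x by (simp add: W_def)
    have "is_kernel (?S \<times> {..<1}) (\<lambda>(x, i) (y, j). (1\<^sub>m 1 - W x * mat_adjoint (W y)) $$ (i, j) * k x y)
        \<longleftrightarrow> is_kernel (?S \<times> {..<1}) (mult_kernel n (\<lambda>x i l. W x $$ (i, l)) k)"
      by (rule is_kernel_mult_kernel_iff[OF W])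
    also have "\<dots> \<longleftrightarrow> is_kernel (?S \<times> {..<1::nat}) (\<lambda>p q. \<Sum>j\<in>{()}. 1 * cnj 1)"
    proof (rule is_kernel_cong)
      fix p q assume "p \<in> ?S \<times> {..<1::nat}" "q \<in> ?S \<times> {..<1::nat}"
      then obtain x y where *: "p = (x, 0)" "q = (y, 0)" "x \<in> ?S" "y \<in> ?S" by auto
      have "(\<Sum>l<n. W x $$ (0, l) * cnj (W y $$ (0, l))) = (\<Sum>l<n. b x l * cnj (b y l))"
        by (simp add: W_def)
      then show "mult_kernel n (\<lambda>x i l. W x $$ (i, l)) k p q = (\<Sum>j\<in>{()}. 1 * cnj 1)"
        using b1[OF *(3,4)] by (simp add: * mult_kernel_row)
    qed
    finally have "is_kernel (?S \<times> {..<1}) (\<lambda>(x, i) (y, j). (1\<^sub>m 1 - W x * mat_adjoint (W y)) $$ (i, j) * k x y)"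
      using is_kernel_gram[of "{()}" _ "\<lambda>_ _. 1"] by blast
    then have "\<exists>\<Phi>. contractive_matrix_multiplier X k 1 n \<Phi> \<and> (\<forall>x\<in>?S. \<Phi> x = W x)"
      using cnp[unfolded CNP_kernel_def, THEN conjunct2, rule_format, of 1 n ?S W] n S W by simp
    then obtain \<Phi> where \<Phi>: "contractive_matrix_multiplier X k 1 n \<Phi>" "\<And>x. x \<in> ?S \<Longrightarrow> \<Phi> x = W x"
      by blast
    define L where "L = mult_kernel n (\<lambda>x i l. \<Phi> x $$ (i, l)) k"
    define c where "c = (\<lambda>l. \<Phi> z $$ (0, l))"
    have L: "is_kernel (X \<times> {..<1}) L"
      unfolding L_def by (rule contractive_matrix_multiplier_imp_kernel[OF ker \<Phi>(1)])
    have L1: "L (x, 0) (y, 0) = 1" if "x \<in> ?S" "y \<in> ?S" for x y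
    proof -
      have "(\<Sum>l<n. \<Phi> x $$ (0, l) * cnj (\<Phi> y $$ (0, l))) = (\<Sum>l<n. b x l * cnj (b y l))"
        by (simp add: W_def \<Phi>(2)[OF that(1)] \<Phi>(2)[OF that(2)])
      then show ?thesis
        using b1[OF that] by (simp add: L_def mult_kernel_row)
    qed
    have Lz: "L (z, 0) (x, 0) = (1 - (\<Sum>l<n. c l * cnj (b x l))) * k z x" if "x \<in> ?S" for x
      using \<Phi>(2)[OF that] by (simp add: L_def mult_kernel_row W_def c_def)
    \<comment> \<open>As \<open>b w\<close> vanishes, the Pick entry at \<open>(z, w)\<close> is
      \<open>k z w = 1\<close> whatever \<open>\<Phi> z\<close> is. This is the value that
      \<open>is_kernel_equal_columns\<close> spreads along the row.\<close>
    have "complex_of_real (\<Sum>l<n. (cmod (b w l))\<^sup>2) = 0"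
      using b[of w w] norm[OF w] by (simp only: of_real_sum complex_norm_square) simp
    then have bw: "b w l = 0" if "l < n" for l
      using that by (simp add: sum_nonneg_eq_0_iff of_real_eq_0_iff del: of_real_sum)
    have Lzw: "L (z, 0) (w, 0) = 1"
      using Lz[of w] bw norm[OF z(1)] by simp
    have Lzx: "L (z, 0) (x, 0) = 1" if "x \<in> ?S" for x
    proof -
      have "L (z, 0) (x, 0) = L (z, 0) (w, 0)"
        using that S z L1 by (intro is_kernel_equal_columns[OF L]) auto
      with Lzw show ?thesis by simp
    qed
    have kz: "k z x \<noteq> 0 \<and> 1 - 1 / k z x = (\<Sum>l<n. c l * cnj (b x l))" if "x \<in> ?S" for x
    proof -
      have e: "(1 - (\<Sum>l<n. c l * cnj (b x l))) * k z x = 1"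
        using Lz[OF that] Lzx[OF that] by simp
      then have "k z x \<noteq> 0" by auto
      with e show ?thesis by (simp add: field_simps)
    qed
    have kx: "k x z \<noteq> 0 \<and> 1 - 1 / k x z = (\<Sum>l<n. b x l * cnj (c l))" if "x \<in> ?S" for x
    proof -
      have "k x z = cnj (k z x)"
        using S that z by (intro is_kernel_hermitian[OF ker]) auto
      then have "1 - 1 / k x z = cnj (1 - 1 / k z x)" by simp
      with kz[OF that] \<open>k x z = cnj (k z x)\<close> show ?thesis by (simp add: cnj_sum mult.commute)
    qed
    define s where "s = (\<Sum>l<n. (cmod (c l))\<^sup>2)"
    have cs: "(\<Sum>l<n. c l * cnj (c l)) = complex_of_real s"
      by (simp only: s_def of_real_sum complex_norm_square)
    have kr: "k z z = complex_of_real (Re (k z z))" "0 \<le> Re (k z z)"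
      using is_kernel_diag_nonneg[OF ker z(1)] by (auto simp: less_eq_complex_def complex_eq_iff)
    \<comment> \<open>Positivity at \<open>z\<close> and \<open>w\<close> gives
      \<open>s \<le> 1 - 1 / k z z\<close>, so \<open>c\<close> is not too long to be completed to
      the new Gram vector.\<close>
    have "(cmod (L (z, 0) (w, 0)))\<^sup>2 \<le> Re (L (z, 0) (z, 0)) * Re (L (w, 0) (w, 0))"
      using z w by (intro is_kernel_Cauchy_Schwarz[OF L]) auto
    moreover have "L (z, 0) (z, 0) = complex_of_real ((1 - s) * Re (k z z))"
      using kr(1) cs by (simp add: L_def mult_kernel_row c_def)
    ultimately have ge: "1 \<le> (1 - s) * Re (k z z)"
      using Lzw L1[of w w] by simp
    then have kpos: "Re (k z z) > 0"
      using kr(2) by (cases "Re (k z z) = 0") auto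
    \<comment> \<open>The squared length missing from \<open>c\<close>. The extra coordinate that
      supplies it is \<open>0\<close> at all earlier points, so the inner products with them do not
      change.\<close>
    define d where "d = 1 - s - 1 / Re (k z z)"
    have d0: "0 \<le> d"
      using ge kpos by (simp add: d_def field_simps)
    have kzz: "k z z \<noteq> 0 \<and> 1 - 1 / k z z = complex_of_real (s + d)"
    proof
      show "k z z \<noteq> 0" using kpos by auto
      have "1 / k z z = complex_of_real (1 / Re (k z z))"
        by (subst kr(1)) simp
      then show "1 - 1 / k z z = complex_of_real (s + d)"
        by (simp add: d_def)
    qed
    define b' where "b' = (\<lambda>x l. if l < n then (if x = z then c l else b x l)
      else if x = z then complex_of_real (sqrt d) else 0)"
    have b': "(\<Sum>l<Suc n. b' x l * cnj (b' y l))
        = (\<Sum>l<n. (if x = z then c l else b x l) * cnj (if y = z then c l else b y l))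
          + (if x = z \<and> y = z then complex_of_real d else 0)" for x y
    proof -
      have "complex_of_real (sqrt d) * complex_of_real (sqrt d) = complex_of_real d"
        using d0 by (simp flip: of_real_mult)
      then show ?thesis by (simp add: b'_def)
    qed
    have "k x y \<noteq> 0 \<and> 1 - 1 / k x y = (\<Sum>l<Suc n. b' x l * cnj (b' y l))"
      if xy: "x \<in> insert w (insert z T)" "y \<in> insert w (insert z T)" for x y
    proof -
      consider "x = z" "y = z" | "x = z" "y \<in> ?S" "y \<noteq> z" | "x \<in> ?S" "y = z" "x \<noteq> z"
        | "x \<in> ?S" "y \<in> ?S" "x \<noteq> z" "y \<noteq> z"
        using xy z by blast
      then show ?thesis
      proof cases
        case 1
        then show ?thesis using kzz cs unfolding b' by simp
      next
        case 2
        then show ?thesis using kz[OF 2(2)] unfolding b' by simp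
      next
        case 3
        then show ?thesis using kx[OF 3(1)] unfolding b' by simp
      next
        case 4
        then show ?thesis using b[OF 4(1,2)] unfolding b' by simp
      qed
    qed
    then show ?thesis
      by (intro exI[of _ "Suc n"] conjI exI[of _ b']) auto
  qed
qed

lemma CNP_kernel_imp_is_kernel:
  assumes "CNP_kernel X k" "w \<in> X" "\<And>x. x \<in> X \<Longrightarrow> k x w = 1"
  shows "is_kernel X (\<lambda>x y. 1 - 1 / k x y)"
  unfolding is_kernel_def
proof (intro allI impI)
  fix S and c :: "'a \<Rightarrow> complex" assume S: "finite S \<and> S \<subseteq> X"
  obtain n :: nat and b where b: "\<forall>x\<in>insert w S. \<forall>y\<in>insert w S.
      k x y \<noteq> 0 \<and> 1 - 1 / k x y = (\<Sum>l<n. b x l * cnj (b y l))"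
    using CNP_kernel_gram[OF assms, of S] S by blast
  have "(\<Sum>x\<in>S. \<Sum>y\<in>S. cnj (c x) * c y * (1 - 1 / k x y))
      = (\<Sum>x\<in>S. \<Sum>y\<in>S. cnj (c x) * c y * (\<Sum>l<n. b x l * cnj (b y l)))"
    using b by (intro sum.cong refl) auto
  also have "0 \<le> \<dots>"
    using is_kernel_gram[OF finite_lessThan, of S b n, unfolded is_kernel_def] S by blast
  finally show "0 \<le> (\<Sum>x\<in>S. \<Sum>y\<in>S. cnj (c x) * c y * (1 - 1 / k x y))" .
qed

subsection \<open>Holomorphic functions on domains\<close>

lemma bounded_linear_scale_vec: "bounded_linear (\<lambda>h::complex. h *s (v :: complex ^ 'd))"
  by (rule linear_conv_bounded_linear[THEN iffD1], rule linearI) (simp_all add: Finite_Cartesian_Product.vec_eq_iff distrib_right)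

text \<open>Along a complex line the derivative acts as multiplication by \<open>D v\<close>,
  because \<open>D\<close> is complex linear; this reduces everything to one variable.\<close>

lemma holomorphic_multi_slice:
  fixes f :: "complex ^ 'd \<Rightarrow> complex" and w v :: "complex ^ 'd"
  assumes "holomorphic_multi_on f \<Omega>"
  shows "(\<lambda>t. f (w + t *s v)) holomorphic_on {t. w + t *s v \<in> \<Omega>}"
proof (rule holomorphic_onI)
  fix t assume "t \<in> {t. w + t *s v \<in> \<Omega>}"
  then obtain D where D: "(f has_derivative D) (at (w + t *s v))" "\<And>c v. D (c *s v) = c * D v"
    using assms unfolding holomorphic_multi_on_def by blast
  have "((\<lambda>t. w + t *s v) has_derivative (\<lambda>h. 0 + h *s v)) (at t)"
    by (intro has_derivative_add has_derivative_const bounded_linear_imp_has_derivative bounded_linear_scale_vec)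
  then have "((\<lambda>t. w + t *s v) has_derivative (\<lambda>h. h *s v)) (at t)"
    by simp
  from has_derivative_compose[OF this D(1)]
  have "((\<lambda>t. f (w + t *s v)) has_derivative (\<lambda>h. D v * h)) (at t)"
    by (simp add: D(2) mult.commute)
  then have "((\<lambda>t. f (w + t *s v)) has_field_derivative D v) (at t)"
    by (simp add: has_field_derivative_def)
  then show "(\<lambda>t. f (w + t *s v)) field_differentiable at t within {t. w + t *s v \<in> \<Omega>}"
    using field_differentiable_at_within field_differentiable_def by blast
qed

text \<open>Slices of balls are convex, whereas slices of a domain may be disconnected. This is why
  the identity theorem is proved inside balls first.\<close>

lemma slice_of_ball:
  fixes a x v :: "complex ^ 'd"
  shows "open {t. x + t *s v \<in> ball a r}" "connected {t. x + t *s v \<in> ball a r}"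
proof -
  interpret bounded_linear "\<lambda>h::complex. h *s v" by (rule bounded_linear_scale_vec)
  have "continuous_on UNIV (\<lambda>t. x + t *s v)"
    by (intro continuous_intros continuous_on)
  from open_vimage[OF open_ball this] show "open {t. x + t *s v \<in> ball a r}"
    by (simp add: vimage_def)
  have "{t. x + t *s v \<in> ball a r} = (\<lambda>h. h *s v) -` ((\<lambda>y. - x + y) ` ball a r)"
    by (force simp: image_iff)
  moreover have "convex ((\<lambda>h. h *s v) -` ((\<lambda>y. - x + y) ` ball a r))"
    by (intro convex_linear_vimage convex_translation convex_ball) (rule linear_axioms)
  ultimately show "connected {t. x + t *s v \<in> ball a r}"
    by (simp add: convex_connected)
qed

text \<open>The one-variable identity theorem on the line through \<open>x\<close> and
  \<open>y\<close>, where \<open>f\<close> equals \<open>c\<close> near the parameter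
  \<open>0\<close>.\<close>

lemma holomorphic_multi_constant_on_ball:
  fixes f :: "complex ^ 'd \<Rightarrow> complex"
  assumes f: "holomorphic_multi_on f \<Omega>" and B: "ball a r \<subseteq> \<Omega>" and x: "x \<in> ball a r" "y \<in> ball a r"
    and e: "e > 0" "\<And>z. z \<in> ball x e \<Longrightarrow> f z = c"
  shows "f y = c"
proof -
  let ?v = "y - x"
  let ?U = "{t. x + t *s ?v \<in> ball a r}"
  have "(\<lambda>t. f (x + t *s ?v)) holomorphic_on ?U"
    using holomorphic_multi_slice[OF f] by (rule holomorphic_on_subset) (use B in auto)
  then have holo: "(\<lambda>t. f (x + t *s ?v) - c) holomorphic_on ?U"
    by (intro holomorphic_intros)
  have 0: "0 \<in> ?U" and 1: "1 \<in> ?U"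
    using x by auto
  let ?V = "{t. x + t *s ?v \<in> ball x e} \<inter> ?U"
  have "open ?V"
    by (intro open_Int slice_of_ball(1))
  moreover have "0 \<in> ?V"
    using 0 e(1) by simp
  ultimately have lim: "0 islimpt ?V"
    using islimpt_eq_acc_point interior_limit_point interior_open by metis
  have "f (x + 1 *s ?v) - c = 0"
    by (rule analytic_continuation[OF holo slice_of_ball _ 0 lim _ 1]) (use e(2) in auto)
  then show ?thesis by simp
qed

text \<open>Being equal to \<open>c\<close> near a point spreads between any two points of a ball
  inside \<Omega>, and connectedness carries it through \<Omega>.\<close>

lemma holomorphic_multi_identity:
  fixes f :: "complex ^ 'd \<Rightarrow> complex"
  assumes f: "holomorphic_multi_on f \<Omega>" and \<Omega>: "open \<Omega>" "connected \<Omega>"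
    and w: "w \<in> \<Omega>" and e: "e > 0" "\<And>z. z \<in> ball w e \<Longrightarrow> f z = c" and x: "x \<in> \<Omega>"
  shows "f x = c"
proof -
  define P where "P = (\<lambda>x. \<exists>e>0. \<forall>z\<in>ball x e. f z = c)"
  have "P x"
  proof (rule connected_induction_simple[OF \<Omega>(2), of w x P])
    show "w \<in> \<Omega>" "x \<in> \<Omega>" "P w"
      using w x e by (auto simp: P_def)
    fix a assume "a \<in> \<Omega>"
    then obtain r where r: "r > 0" "ball a r \<subseteq> \<Omega>"
      using \<Omega>(1) openE by blast
    have spread: "P y" if "p \<in> ball a r" "y \<in> ball a r" "P p" for p y
    proof -
      have "f z = c" if "z \<in> ball a r" for z
        using holomorphic_multi_constant_on_ball[OF f r(2) \<open>p \<in> ball a r\<close> that] \<open>P p\<close>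
        unfolding P_def by blast
      moreover obtain d where "d > 0" "ball y d \<subseteq> ball a r"
        using \<open>y \<in> ball a r\<close> open_ball openE by blast
      ultimately show ?thesis unfolding P_def by blast
    qed
    have op: "openin (top_of_set \<Omega>) (ball a r)"
      by (rule open_openin_trans[OF \<Omega>(1) open_ball r(2)])
    have mem: "a \<in> ball a r"
      using r(1) by simp
    show "\<exists>T. openin (top_of_set \<Omega>) T \<and> a \<in> T \<and> (\<forall>x\<in>T. \<forall>y\<in>T. P x \<longrightarrow> P y)"
      by (intro exI[of _ "ball a r"] conjI ballI impI op mem) (rule spread)
  qed
  then obtain d where "d > 0" "\<forall>z\<in>ball x d. f z = c"
    unfolding P_def by blast
  then show ?thesis by simp
qed

text \<open>The identity theorem provides a nearby \<open>y\<close> with another value, so the slice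
  towards \<open>y\<close> is nonconstant and the one-variable open mapping theorem applies.\<close>

lemma holomorphic_multi_open_at:
  fixes f :: "complex ^ 'd \<Rightarrow> complex"
  assumes f: "holomorphic_multi_on f \<Omega>" and \<Omega>: "open \<Omega>" "connected \<Omega>"
    and w: "w \<in> \<Omega>" and nc: "\<not> f constant_on \<Omega>"
  shows "\<exists>r>0. ball (f w) r \<subseteq> f ` \<Omega>"
proof -
  obtain r where r: "r > 0" "ball w r \<subseteq> \<Omega>"
    using \<Omega>(1) w openE by blast
  have "\<exists>y\<in>ball w r. f y \<noteq> f w"
    using holomorphic_multi_identity[OF f \<Omega> w r(1), of "f w"] nc unfolding constant_on_def by blast
  then obtain y where y: "y \<in> ball w r" "f y \<noteq> f w" by blast
  let ?U = "{t. w + t *s (y - w) \<in> ball w r}"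
  let ?g = "\<lambda>t. f (w + t *s (y - w))"
  have 0: "0 \<in> ?U" and 1: "1 \<in> ?U"
    using y r by auto
  have "?g holomorphic_on ?U"
    using holomorphic_multi_slice[OF f] by (rule holomorphic_on_subset) (use r in auto)
  moreover have "\<not> ?g constant_on ?U"
  proof
    assume "?g constant_on ?U"
    then have "?g 0 = ?g 1" using 0 1 unfolding constant_on_def by metis
    with y(2) show False by simp
  qed
  ultimately have "open (?g ` ?U)"
    by (intro open_mapping_thm[OF _ slice_of_ball slice_of_ball(1) order_refl])
  moreover have "f w \<in> ?g ` ?U"
    using 0 by (intro image_eqI[of _ _ 0]) auto
  ultimately obtain d where "d > 0" "ball (f w) d \<subseteq> ?g ` ?U"
    using openE by blast
  moreover have "?g ` ?U \<subseteq> f ` \<Omega>"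
    using r(2) by auto
  ultimately show ?thesis by blast
qed

subsection \<open>Rigidity\<close>

lemma is_kernel_rescale:
  assumes "is_kernel X K"
  shows "is_kernel X (\<lambda>x y. f x * K x y * cnj (f y))"
  unfolding is_kernel_def
proof (intro allI impI)
  fix S and c :: "'a \<Rightarrow> complex" assume S: "finite S \<and> S \<subseteq> X"
  have "(\<Sum>x\<in>S. \<Sum>y\<in>S. cnj (c x) * c y * (f x * K x y * cnj (f y)))
      = (\<Sum>x\<in>S. \<Sum>y\<in>S. cnj (c x * cnj (f x)) * (c y * cnj (f y)) * K x y)"
    by (simp add: mult_ac)
  also have "0 \<le> \<dots>"
    by (rule assms[unfolded is_kernel_def, rule_format, OF S])
  finally show "0 \<le> (\<Sum>x\<in>S. \<Sum>y\<in>S. cnj (c x) * c y * (f x * K x y * cnj (f y)))" .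
qed

text \<open>With \<open>r = |z|\<close> and \<open>|2 - z| >= 2 - r\<close> the bound becomes
  \<open>(1 - r)^2 (2 + s (1 + 2 r - r^2)) <= 0\<close>. The second factor is positive by
  \<open>r^2 <= 2\<close> and \<open>s < 1\<close>, so \<open>r = 1\<close>. Then the bound reads
  \<open>|2 - z| <= 1\<close>, and this disc meets the unit circle only at \<open>1\<close>.\<close>

lemma eq_one_of_two_minus_bound:
  fixes z :: complex and s :: real
  assumes s: "0 < s" "s < 1" and z: "(cmod z)\<^sup>2 \<le> 2" "s * (cmod z)\<^sup>2 < 1"
    and le: "(cmod (2 - z))\<^sup>2 \<le> (2 - s - (cmod z)\<^sup>2) / (1 - s * (cmod z)\<^sup>2)"
  shows "z = 1"
proof -
  define r where "r = cmod z"
  have r0: "0 \<le> r" by (simp add: r_def)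
  have "r \<le> 2"
    using z(1) by (intro power2_le_imp_le[of r 2]) (auto simp: r_def)
  moreover have "2 - r \<le> cmod (2 - z)"
    using norm_triangle_ineq2[of 2 z] by (simp add: r_def)
  ultimately have "(2 - r)\<^sup>2 \<le> (cmod (2 - z))\<^sup>2"
    by (intro power_mono) auto
  with le have "(2 - r)\<^sup>2 \<le> (2 - s - r\<^sup>2) / (1 - s * r\<^sup>2)"
    by (simp add: r_def)
  then have "(2 - r)\<^sup>2 * (1 - s * r\<^sup>2) \<le> 2 - s - r\<^sup>2"
    using z(2) by (simp add: r_def pos_le_divide_eq)
  moreover have "2 - s - r\<^sup>2 - (2 - r)\<^sup>2 * (1 - s * r\<^sup>2) = - ((1 - r)\<^sup>2 * (2 + s * (1 + 2 * r - r\<^sup>2)))"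
    by (simp add: power2_eq_square algebra_simps)
  ultimately have prod: "(1 - r)\<^sup>2 * (2 + s * (1 + 2 * r - r\<^sup>2)) \<le> 0"
    by linarith
  have "-1 \<le> 1 + 2 * r - r\<^sup>2"
    using r0 z(1) unfolding r_def by linarith
  then have "s * (1 + 2 * r - r\<^sup>2) \<ge> s * (-1)"
    using s(1) by (intro mult_left_mono) simp_all
  then have "2 + s * (1 + 2 * r - r\<^sup>2) > 0"
    using s(2) by linarith
  with prod have "(1 - r)\<^sup>2 \<le> 0"
    by (simp add: mult_le_0_iff)
  then have r1: "cmod z = 1"
    by (simp add: r_def)
  then have "(cmod (2 - z))\<^sup>2 \<le> 1"
    using le s by simp
  moreover have "(cmod (2 - z))\<^sup>2 = 4 - 4 * Re z + (cmod z)\<^sup>2"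
    unfolding cmod_power2 by (simp add: power2_diff)
  ultimately have "Re z \<ge> 1"
    using r1 by simp
  moreover have "(Re z)\<^sup>2 + (Im z)\<^sup>2 = 1"
    using r1 cmod_power2[of z] by simp
  moreover have "(Re z)\<^sup>2 \<ge> 1" if "Re z \<ge> 1"
    using that by (simp add: one_le_power)
  ultimately have "Im z = 0" "(Re z)\<^sup>2 = 1"
    using zero_le_power2[of "Im z"] by (smt (verit) zero_eq_power2)+
  with \<open>Re z \<ge> 1\<close> show ?thesis
    by (simp add: complex_eq_iff power2_eq_1_iff)
qed

text \<open>With \<open>\<psi> = \<phi> / u\<close>, \<open>s = u(x) u(y)\<^sup>*\<close> and \<open>P = \<psi>(x) \<psi>(y)\<^sup>*\<close>, the kernel divided by \<open>s\<close> is
  \<open>(2 - P) - s (1 - P)\<^sup>2 / (1 - s P)\<close>.  At two points with opposite small values of \<open>u\<close>, the vector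
  \<open>(1, -1)\<close> kills the constant and turns both \<open>-P\<close> and the remainder into nonpositive terms.\<close>

lemma kernel_rigidity:
  fixes u \<phi> :: "'a \<Rightarrow> complex"
  assumes ker: "is_kernel X (\<lambda>x y. 1 - (1 - u x * cnj (u y))\<^sup>2 / (1 - \<phi> x * cnj (\<phi> y)))"
    and u: "\<And>x. x \<in> X \<Longrightarrow> cmod (u x) < 1" and \<phi>: "\<And>x. x \<in> X \<Longrightarrow> cmod (\<phi> x) < 1"
    and r: "r > 0" "ball 0 r \<subseteq> u ` X"
  shows "\<exists>l\<in>sphere 0 1. \<forall>x\<in>X. \<phi> x = l * u x"
proof -
  define \<psi> where "\<psi> = (\<lambda>x. \<phi> x / u x)"
  define X' where "X' = {x \<in> X. u x \<noteq> 0}"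
  define Q where "Q = (\<lambda>x y. 1 - (1 - u x * cnj (u y))\<^sup>2 / (1 - \<phi> x * cnj (\<phi> y)))"
  define R where "R = (\<lambda>x y. (1 / u x) * Q x y * cnj (1 / u y))"
  define E where "E = (\<lambda>s P :: complex. (1 - P)\<^sup>2 / (1 - s * P))"
  \<comment> \<open>The diagonal entry at \<open>x\<close>. It makes \<open>\<phi>\<close> vanish
    where \<open>u\<close> does, and elsewhere it bounds \<open>\<psi>\<close>, as compactness
    requires.\<close>
  have bound: "(cmod (\<phi> x))\<^sup>2 \<le> 2 * (cmod (u x))\<^sup>2 - (cmod (u x))\<^sup>2 * (cmod (u x))\<^sup>2" if "x \<in> X" for x
  proof -
    define s t where "s = (cmod (u x))\<^sup>2" and "t = (cmod (\<phi> x))\<^sup>2"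
    have "t < 1"
      using \<phi>[OF that] by (simp add: t_def power_less_one_iff)
    have "1 - (1 - u x * cnj (u x))\<^sup>2 / (1 - \<phi> x * cnj (\<phi> x)) = complex_of_real (1 - (1 - s)\<^sup>2 / (1 - t))"
      unfolding complex_norm_square[symmetric] s_def t_def by simp
    with is_kernel_diag_nonneg[OF ker that] have "0 \<le> 1 - (1 - s)\<^sup>2 / (1 - t)"
      by (simp only: less_eq_complex_def Re_complex_of_real zero_complex.sel)
    then have "(1 - s)\<^sup>2 \<le> 1 - t"
      using \<open>t < 1\<close> by (simp add: divide_le_eq)
    then have "t \<le> 2 * s - s * s"
      by (simp add: power2_eq_square algebra_simps)
    then show ?thesis
      by (simp only: s_def t_def)
  qed
  have \<psi>u: "\<phi> x = \<psi> x * u x" if "x \<in> X'" for x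
    using that by (simp add: \<psi>_def X'_def)
  have \<psi>2: "(cmod (\<psi> x))\<^sup>2 \<le> 2" if "x \<in> X'" for x
  proof -
    have x: "x \<in> X" "(cmod (u x))\<^sup>2 > 0" using that by (auto simp: X'_def)
    have "(cmod (\<psi> x))\<^sup>2 * (cmod (u x))\<^sup>2 = (cmod (\<phi> x))\<^sup>2"
      by (simp add: \<psi>u[OF that] norm_mult power_mult_distrib)
    also have "\<dots> \<le> 2 * (cmod (u x))\<^sup>2"
      using bound[OF x(1)] mult_nonneg_nonneg[OF zero_le_power2 zero_le_power2, of "cmod (u x)" "cmod (u x)"]
      by linarith
    finally have "(cmod (\<psi> x))\<^sup>2 * (cmod (u x))\<^sup>2 \<le> 2 * (cmod (u x))\<^sup>2" .
    then show ?thesis using x(2) by simp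
  qed
  have RK: "is_kernel X' R"
    unfolding R_def Q_def by (intro is_kernel_rescale is_kernel_subset[OF ker]) (auto simp: X'_def)
  have den: "1 - u x * cnj (u y) * (\<psi> x * cnj (\<psi> y)) \<noteq> 0" if "x \<in> X'" "y \<in> X'" for x y
  proof -
    have "1 - \<phi> x * cnj (\<phi> y) \<noteq> 0"
      using that \<phi> by (intro szego_denominator_nonzero) (auto simp: X'_def)
    then show ?thesis
      using \<psi>u[OF that(1)] \<psi>u[OF that(2)] by (simp add: mult_ac)
  qed
  \<comment> \<open>This quotient serves for taking limits; the expansion \<open>R2\<close> serves
    for the cancellation at opposite values of \<open>u\<close>.\<close>
  have R1: "R x y = (2 - u x * cnj (u y) - \<psi> x * cnj (\<psi> y)) / (1 - u x * cnj (u y) * (\<psi> x * cnj (\<psi> y)))"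
    if "x \<in> X'" "y \<in> X'" for x y
  proof -
    define s P where "s = u x * cnj (u y)" and "P = \<psi> x * cnj (\<psi> y)"
    have s0: "s \<noteq> 0" using that by (simp add: s_def X'_def)
    have d0: "1 - s * P \<noteq> 0" using den[OF that] by (simp add: s_def P_def)
    have "\<phi> x * cnj (\<phi> y) = s * P"
      using \<psi>u[OF that(1)] \<psi>u[OF that(2)] by (simp add: s_def P_def mult_ac)
    then have "R x y = (1 - (1 - s)\<^sup>2 / (1 - s * P)) / s"
      by (simp add: R_def Q_def s_def)
    also have "\<dots> = (2 - s - P) / (1 - s * P)"
      using s0 d0 by (simp add: divide_simps) (simp add: power2_eq_square algebra_simps)
    finally show ?thesis by (simp add: s_def P_def)
  qed
  have R2: "R x y = 2 - \<psi> x * cnj (\<psi> y) - u x * cnj (u y) * E (u x * cnj (u y)) (\<psi> x * cnj (\<psi> y))"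
    if "x \<in> X'" "y \<in> X'" for x y
    using den[OF that] unfolding R1[OF that] E_def
    by (simp add: divide_simps) (simp add: power2_eq_square algebra_simps)
  have pair: "(cmod (\<psi> x - \<psi> y))\<^sup>2 + d\<^sup>2 * Re (E (of_real (d\<^sup>2)) (\<psi> x * cnj (\<psi> x)) + E (of_real (d\<^sup>2)) (\<psi> y * cnj (\<psi> y))
      + E (- of_real (d\<^sup>2)) (\<psi> x * cnj (\<psi> y)) + E (- of_real (d\<^sup>2)) (\<psi> y * cnj (\<psi> x))) \<le> 0"
    if x: "x \<in> X" "u x = of_real d" and y: "y \<in> X" "u y = - of_real d" and d: "d > 0" for x y d
  proof -
    have X': "x \<in> X'" "y \<in> X'" using x y d by (auto simp: X'_def)
    have "x \<noteq> y"
      using x y d by auto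
    have s: "u x * cnj (u x) = of_real (d\<^sup>2)" "u y * cnj (u y) = of_real (d\<^sup>2)"
      "u x * cnj (u y) = - of_real (d\<^sup>2)" "u y * cnj (u x) = - of_real (d\<^sup>2)"
      by (simp_all add: x y power2_eq_square)
    have "0 \<le> Re (R x x - R x y + (- R y x + R y y))"
      using Re_nonneg_complex[OF is_kernel_two_points[OF RK X' \<open>x \<noteq> y\<close>, of 1 "-1"]] by simp
    also have "R x x - R x y + (- R y x + R y y) = - ((\<psi> x - \<psi> y) * cnj (\<psi> x - \<psi> y))
        - of_real (d\<^sup>2) * (E (of_real (d\<^sup>2)) (\<psi> x * cnj (\<psi> x)) + E (of_real (d\<^sup>2)) (\<psi> y * cnj (\<psi> y))
          + E (- of_real (d\<^sup>2)) (\<psi> x * cnj (\<psi> y)) + E (- of_real (d\<^sup>2)) (\<psi> y * cnj (\<psi> x)))"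
      unfolding R2[OF X'(1,1)] R2[OF X'(1,2)] R2[OF X'(2,1)] R2[OF X'(2,2)] s
      by (simp add: algebra_simps)
    also have "(\<psi> x - \<psi> y) * cnj (\<psi> x - \<psi> y) = of_real ((cmod (\<psi> x - \<psi> y))\<^sup>2)"
      by (rule complex_norm_square[symmetric])
    finally show ?thesis
      by (simp only: minus_complex.sel uminus_complex.sel plus_complex.sel times_complex.sel
          Re_complex_of_real Im_complex_of_real mult_zero_left diff_zero)
  qed
  \<comment> \<open>The denominator starts at \<open>2\<close>, so \<open>\<delta> n\<close> and
    \<open>- \<delta> n\<close> lie in the open ball of radius \<open>r\<close> for every
    \<open>n\<close>.\<close>
  define \<delta> where "\<delta> = (\<lambda>n. r / real (Suc (Suc n)))"
  have \<delta>: "\<delta> n > 0" "\<delta> n < r" for n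
    using r(1) by (auto simp: \<delta>_def field_simps intro: add_pos_nonneg)
  have \<delta>0: "\<delta> \<longlonglongrightarrow> 0"
  proof -
    have "(\<lambda>n. r * inverse (real (Suc (Suc n)))) \<longlonglongrightarrow> r * 0"
      by (intro tendsto_mult tendsto_const LIMSEQ_Suc[OF LIMSEQ_inverse_real_of_nat])
    then show ?thesis by (simp add: \<delta>_def divide_inverse)
  qed
  have mem: "of_real (\<delta> n) \<in> u ` X" "- of_real (\<delta> n) \<in> u ` X" for n
    using r(2) \<delta>[of n] by (auto simp: subset_iff)
  define A B where "A = (\<lambda>n. inv_into X u (of_real (\<delta> n)))" and "B = (\<lambda>n. inv_into X u (- of_real (\<delta> n)))"
  have A: "A n \<in> X" "u (A n) = of_real (\<delta> n)" and B: "B n \<in> X" "u (B n) = - of_real (\<delta> n)" for n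
    using inv_into_into[OF mem(1)] f_inv_into_f[OF mem(1)] inv_into_into[OF mem(2)] f_inv_into_f[OF mem(2)]
    by (simp_all add: A_def B_def)
  have AB': "A n \<in> X'" "B n \<in> X'" for n
    using A B \<delta>(1)[of n] by (auto simp: X'_def)
  have "cmod (\<psi> x) \<le> 2" if "x \<in> X'" for x
    by (rule power2_le_imp_le) (use \<psi>2[OF that] in simp_all)
  then have inn: "\<forall>n. (\<psi> (A n), \<psi> (B n)) \<in> cball 0 2 \<times> cball 0 2"
    using AB' by simp
  \<comment> \<open>Pairs are used so that both values converge along one common
    subsequence.\<close>
  have sc: "seq_compact (cball 0 2 \<times> cball (0 :: complex) 2 :: (complex \<times> complex) set)"
    by (intro compact_imp_seq_compact compact_Times compact_cball)
  obtain l \<rho> where "l \<in> cball 0 2 \<times> cball 0 2" and \<rho>: "strict_mono \<rho>"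
    and l: "((\<lambda>n. (\<psi> (A n), \<psi> (B n))) \<circ> \<rho>) \<longlonglongrightarrow> l"
    by (rule seq_compactE[OF sc inn])
  define a b d where "a = (\<lambda>n. \<psi> (A (\<rho> n)))" and "b = (\<lambda>n. \<psi> (B (\<rho> n)))" and "d = (\<lambda>n. \<delta> (\<rho> n))"
  define \<alpha> \<beta> where "\<alpha> = fst l" and "\<beta> = snd l"
  have lim_a: "a \<longlonglongrightarrow> \<alpha>" and lim_b: "b \<longlonglongrightarrow> \<beta>"
    using tendsto_fst[OF l] tendsto_snd[OF l] by (simp_all add: a_def b_def \<alpha>_def \<beta>_def o_def)
  have lim_d: "d \<longlonglongrightarrow> 0"
    using LIMSEQ_subseq_LIMSEQ[OF \<delta>0 \<rho>] by (simp add: d_def o_def)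
  have lim_E: "(\<lambda>n. E (c * of_real ((d n)\<^sup>2)) (f n * cnj (g n))) \<longlonglongrightarrow> (1 - x * cnj y)\<^sup>2"
    if "f \<longlonglongrightarrow> x" "g \<longlonglongrightarrow> y" for f g x y c
  proof -
    have "(\<lambda>n. E (c * of_real ((d n)\<^sup>2)) (f n * cnj (g n)))
        \<longlonglongrightarrow> (1 - x * cnj y)\<^sup>2 / (1 - c * of_real (0\<^sup>2) * (x * cnj y))"
      unfolding E_def by (intro tendsto_intros that lim_d) simp
    then show ?thesis by simp
  qed
  define G where "G = (\<lambda>n. Re (E (of_real ((d n)\<^sup>2)) (a n * cnj (a n)) + E (of_real ((d n)\<^sup>2)) (b n * cnj (b n))
      + E (- of_real ((d n)\<^sup>2)) (a n * cnj (b n)) + E (- of_real ((d n)\<^sup>2)) (b n * cnj (a n))))"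
  have lim_G: "G \<longlonglongrightarrow> Re ((1 - \<alpha> * cnj \<alpha>)\<^sup>2 + (1 - \<beta> * cnj \<beta>)\<^sup>2 + (1 - \<alpha> * cnj \<beta>)\<^sup>2 + (1 - \<beta> * cnj \<alpha>)\<^sup>2)"
    unfolding G_def
    using lim_E[OF lim_a lim_a, of 1] lim_E[OF lim_b lim_b, of 1]
      lim_E[OF lim_a lim_b, of "-1"] lim_E[OF lim_b lim_a, of "-1"]
    by (intro tendsto_Re tendsto_add) simp_all
  have G: "(cmod (a n - b n))\<^sup>2 + (d n)\<^sup>2 * G n \<le> 0" and d: "d n > 0" for n
    unfolding a_def b_def d_def G_def by (intro pair A B \<delta>)+
  \<comment> \<open>The same inequality is exploited twice. In the limit the factor
    \<open>(d n)\<^sup>2\<close> removes \<open>G\<close>, which gives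
    \<open>\<beta> = \<alpha>\<close>; dropping the first square and dividing by
    \<open>(d n)\<^sup>2\<close> then gives \<open>G n \<le> 0\<close>, which determines the modulus
    of \<open>\<alpha>\<close>.\<close>
  have "(\<lambda>n. (cmod (a n - b n))\<^sup>2 + (d n)\<^sup>2 * G n) \<longlonglongrightarrow> (cmod (\<alpha> - \<beta>))\<^sup>2
      + 0\<^sup>2 * Re ((1 - \<alpha> * cnj \<alpha>)\<^sup>2 + (1 - \<beta> * cnj \<beta>)\<^sup>2 + (1 - \<alpha> * cnj \<beta>)\<^sup>2 + (1 - \<beta> * cnj \<alpha>)\<^sup>2)"
    by (intro tendsto_add tendsto_mult tendsto_power tendsto_norm tendsto_diff lim_a lim_b lim_d lim_G)
  then have "(cmod (\<alpha> - \<beta>))\<^sup>2 + 0\<^sup>2 * Re ((1 - \<alpha> * cnj \<alpha>)\<^sup>2 + (1 - \<beta> * cnj \<beta>)\<^sup>2 + (1 - \<alpha> * cnj \<beta>)\<^sup>2 + (1 - \<beta> * cnj \<alpha>)\<^sup>2) \<le> 0"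
    by (rule LIMSEQ_le_const2) (intro exI allI impI, rule G)
  then have \<alpha>\<beta>: "\<beta> = \<alpha>" by simp
  have "G n \<le> 0" for n
  proof -
    have "(d n)\<^sup>2 * G n \<le> 0"
      using G[of n] zero_le_power2[of "cmod (a n - b n)"] by linarith
    then show ?thesis
      using d[of n] by (simp add: mult_le_0_iff)
  qed
  then have "Re ((1 - \<alpha> * cnj \<alpha>)\<^sup>2 + (1 - \<beta> * cnj \<beta>)\<^sup>2 + (1 - \<alpha> * cnj \<beta>)\<^sup>2 + (1 - \<beta> * cnj \<alpha>)\<^sup>2) \<le> 0"
    by (intro LIMSEQ_le_const2[OF lim_G]) blast
  moreover have "(1 - \<alpha> * cnj \<alpha>)\<^sup>2 = of_real ((1 - (cmod \<alpha>)\<^sup>2)\<^sup>2)"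
    by (simp only: complex_norm_square[symmetric] of_real_diff of_real_power of_real_1)
  ultimately have "(1 - (cmod \<alpha>)\<^sup>2)\<^sup>2 \<le> 0"
    by (simp only: \<alpha>\<beta> plus_complex.sel Re_complex_of_real)
  then have "(cmod \<alpha>)\<^sup>2 = 1\<^sup>2"
    by simp
  then have \<alpha>1: "cmod \<alpha> = 1"
    by (rule power2_eq_imp_eq) simp_all
  have \<alpha>\<alpha>: "\<alpha> * cnj \<alpha> = 1"
    using \<alpha>1 complex_norm_square[of \<alpha>] by simp
  have "\<phi> x = \<alpha> * u x" if "x \<in> X" for x
  proof (cases "u x = 0")
    case True
    then show ?thesis using bound[OF that] by simp
  next
    case False
    then have x: "x \<in> X'" using that by (simp add: X'_def)
    have lim1: "(\<lambda>n. R x (A (\<rho> n))) \<longlonglongrightarrow> 2 - \<psi> x * cnj \<alpha>"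
    proof -
      have "(\<lambda>n. (2 - u x * cnj (of_real (d n)) - \<psi> x * cnj (a n)) / (1 - u x * cnj (of_real (d n)) * (\<psi> x * cnj (a n))))
          \<longlonglongrightarrow> (2 - u x * cnj (of_real 0) - \<psi> x * cnj \<alpha>) / (1 - u x * cnj (of_real 0) * (\<psi> x * cnj \<alpha>))"
        by (intro tendsto_intros lim_a lim_d) simp
      then show ?thesis
        by (simp add: R1[OF x AB'(1)] A a_def d_def)
    qed
    \<comment> \<open>The limit is \<open>2 - |\<alpha>|^2\<close>, and
      \<open>|\<alpha>| = 1\<close> brings it down to \<open>1\<close>.\<close>
    have lim2: "(\<lambda>n. R (A (\<rho> n)) (A (\<rho> n))) \<longlonglongrightarrow> 1"
    proof -
      have "(\<lambda>n. (2 - of_real (d n) * cnj (of_real (d n)) - a n * cnj (a n)) / (1 - of_real (d n) * cnj (of_real (d n)) * (a n * cnj (a n))))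
          \<longlonglongrightarrow> (2 - of_real 0 * cnj (of_real 0) - \<alpha> * cnj \<alpha>) / (1 - of_real 0 * cnj (of_real 0) * (\<alpha> * cnj \<alpha>))"
        by (intro tendsto_intros lim_a lim_d) simp
      then show ?thesis
        by (simp add: R1[OF AB'(1) AB'(1)] A a_def d_def \<alpha>\<alpha>)
    qed
    have "(cmod (2 - \<psi> x * cnj \<alpha>))\<^sup>2 \<le> Re (R x x) * Re 1"
    proof (rule LIMSEQ_le)
      show "(\<lambda>n. (cmod (R x (A (\<rho> n))))\<^sup>2) \<longlonglongrightarrow> (cmod (2 - \<psi> x * cnj \<alpha>))\<^sup>2"
        by (intro tendsto_intros lim1)
      show "(\<lambda>n. Re (R x x) * Re (R (A (\<rho> n)) (A (\<rho> n)))) \<longlonglongrightarrow> Re (R x x) * Re 1"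
        by (intro tendsto_intros lim2)
      show "\<exists>N. \<forall>n\<ge>N. (cmod (R x (A (\<rho> n))))\<^sup>2 \<le> Re (R x x) * Re (R (A (\<rho> n)) (A (\<rho> n)))"
        using is_kernel_Cauchy_Schwarz[OF RK x AB'(1)] by blast
    qed
    moreover have "R x x = complex_of_real ((2 - (cmod (u x))\<^sup>2 - (cmod (\<psi> x))\<^sup>2) / (1 - (cmod (u x))\<^sup>2 * (cmod (\<psi> x))\<^sup>2))"
      unfolding R1[OF x x] complex_norm_square[symmetric] by simp
    moreover have n\<psi>: "cmod (\<psi> x * cnj \<alpha>) = cmod (\<psi> x)"
      by (simp add: norm_mult \<alpha>1)
    ultimately have "(cmod (2 - \<psi> x * cnj \<alpha>))\<^sup>2
        \<le> (2 - (cmod (u x))\<^sup>2 - (cmod (\<psi> x * cnj \<alpha>))\<^sup>2) / (1 - (cmod (u x))\<^sup>2 * (cmod (\<psi> x * cnj \<alpha>))\<^sup>2)"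
      by (simp only: Re_complex_of_real n\<psi> one_complex.sel mult_1_right)
    moreover have "(cmod (u x))\<^sup>2 * (cmod (\<psi> x))\<^sup>2 < 1"
      using \<phi>[OF that] \<psi>u[OF x] by (simp add: norm_mult power_less_one_iff mult.commute flip: power_mult_distrib)
    moreover have "0 < (cmod (u x))\<^sup>2" "(cmod (u x))\<^sup>2 < 1"
      using u[OF that] False by (auto simp: power_less_one_iff)
    ultimately have "\<psi> x * cnj \<alpha> = 1"
      using \<psi>2[OF x] n\<psi> by (intro eq_one_of_two_minus_bound[of "(cmod (u x))\<^sup>2"]) simp_all
    then have "\<psi> x * (\<alpha> * cnj \<alpha>) = \<alpha>"
      by (simp add: mult.left_commute)
    then show ?thesis
      using \<psi>u[OF x] \<alpha>\<alpha> by simp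
  qed
  then show ?thesis
    using \<alpha>1 by (intro bexI[of _ \<alpha>]) auto
qed

theorem theorem4p5:
  fixes \<Omega> :: "(complex ^ 'd) set"
    and u \<phi> :: "complex ^ 'd \<Rightarrow> complex"
    and w :: "complex ^ 'd"
    and K :: "complex ^ 'd \<Rightarrow> complex ^ 'd \<Rightarrow> complex"
  assumes "complex_domain \<Omega>"
    and "u ` \<Omega> \<subseteq> ball 0 1" and "holomorphic_multi_on u \<Omega>" and "\<not> u constant_on \<Omega>"
    and "w \<in> \<Omega>" and "u w = 0"
    and "K = schur_product (K_fun u) (K_fun u)"
    and "\<phi> ` \<Omega> \<subseteq> ball 0 1" and "holomorphic_multi_on \<phi> \<Omega>" and "\<not> \<phi> constant_on \<Omega>"
    and "\<phi> \<in> contractive_multipliers \<Omega> K" and "\<phi> w = 0"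
  shows "CNP_kernel \<Omega> (dbr_kernel \<phi> K) \<longleftrightarrow>
    (\<exists>l \<in> sphere 0 1. \<forall>x\<in>\<Omega>. \<phi> x = l * u x)"
proof
  note \<Omega> = assms(1)[unfolded complex_domain_def, THEN conjunct2, THEN conjunct1]
    assms(1)[unfolded complex_domain_def, THEN conjunct2, THEN conjunct2]
  have u: "cmod (u x) < 1" and \<phi>: "cmod (\<phi> x) < 1" if "x \<in> \<Omega>" for x
    using assms(2,8) that by (auto simp: subset_iff)
  {
    assume cnp: "CNP_kernel \<Omega> (dbr_kernel \<phi> K)"
    have "dbr_kernel \<phi> K x w = 1" for x
      by (simp add: dbr_kernel_def assms(6,7,12) schur_product_def K_fun_def)
    then have "is_kernel \<Omega> (\<lambda>x y. 1 - 1 / dbr_kernel \<phi> K x y)"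
      using CNP_kernel_imp_is_kernel[OF cnp assms(5)] by blast
    also have "(\<lambda>x y. 1 - 1 / dbr_kernel \<phi> K x y)
        = (\<lambda>x y. 1 - (1 - u x * cnj (u y))\<^sup>2 / (1 - \<phi> x * cnj (\<phi> y)))"
      by (simp add: fun_eq_iff dbr_kernel_def assms(7) schur_product_def K_fun_def power2_eq_square)
    finally have ker: "is_kernel \<Omega> (\<lambda>x y. 1 - (1 - u x * cnj (u y))\<^sup>2 / (1 - \<phi> x * cnj (\<phi> y)))" .
    \<comment> \<open>The ball is centred at \<open>0\<close> because \<open>u w = 0\<close>;
      \<open>kernel_rigidity\<close> lets \<open>u\<close> tend to this value.\<close>
    obtain r where "r > 0" "ball 0 r \<subseteq> u ` \<Omega>"
      using holomorphic_multi_open_at[OF assms(3) \<Omega> assms(5,4)] assms(6) by auto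
    with ker u \<phi> show "\<exists>l\<in>sphere 0 1. \<forall>x\<in>\<Omega>. \<phi> x = l * u x"
      by (rule kernel_rigidity)
  }
  assume "\<exists>l\<in>sphere 0 1. \<forall>x\<in>\<Omega>. \<phi> x = l * u x"
  then obtain l where l: "cmod l = 1" "\<And>x. x \<in> \<Omega> \<Longrightarrow> \<phi> x = l * u x"
    by auto
  have "l * cnj l = 1"
    using l(1) complex_norm_square[of l] by simp
  \<comment> \<open>The unimodular \<open>l\<close> drops out, so
    \<open>1 - \<phi> x * cnj (\<phi> y)\<close> cancels one of the two equal factors of
    \<open>K\<close>.\<close>
  then have "\<phi> x * cnj (\<phi> y) = u x * cnj (u y)" if "x \<in> \<Omega>" "y \<in> \<Omega>" for x y
    using l(2) that by simp
  moreover have "1 - u x * cnj (u y) \<noteq> 0" if "x \<in> \<Omega>" "y \<in> \<Omega>" for x y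
    using u that by (intro szego_denominator_nonzero) auto
  ultimately show "CNP_kernel \<Omega> (dbr_kernel \<phi> K)"
    using u by (intro CNP_kernel_szego[of \<Omega> u])
      (simp_all add: dbr_kernel_def assms(7) schur_product_def K_fun_def)
qed

end
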